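(* There are no closed saddle connections on the surface of the regular tetrahedron, the regular octahedron, the cube, or the regular icosahedron.
   Context: The surface of a Platonic solid is regarded as a Euclidean cone surface with its intrinsic flat metric, whose singularities are the vertices of the solid. A saddle connection is a geodesic segment in this flat metric (a straight line on faces, continued over an edge by unfolding the adjacent face into the same plane) connecting two, possibly equal, vertices and having no vertex in its interior. It is closed if it connects a vertex to itself. *)

theory Defs
  imports "HOL-Analysis.Analysis"
begin

section \<open>The four solids\<close>

text \<open>Each solid is a convex polytope in Euclidean 3-space, given by standard coordinates
  and taken up to similarity, so that position and edge length are arbitrary.\<close>

definition similarity :: "(real^3 \<Rightarrow> real^3) \<Rightarrow> bool" where
  "similarity f \<longleftrightarrow> (\<exists>c>0. \<forall>x y. dist (f x) (f y) = c * dist x y)"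

definition similar_to :: "(real^3) set \<Rightarrow> (real^3) set \<Rightarrow> bool" where
  "similar_to Q P \<longleftrightarrow> (\<exists>f. similarity f \<and> P = f ` Q)"

definition std_tetrahedron :: "(real^3) set" where
  "std_tetrahedron = convex hull
     {vector [1, 1, 1], vector [1, -1, -1], vector [-1, 1, -1], vector [-1, -1, 1]}"

definition std_octahedron :: "(real^3) set" where
  "std_octahedron = convex hull
     ({vector [a, 0, 0] | a. a \<in> {-1, 1}} \<union> {vector [0, a, 0] | a. a \<in> {-1, 1}} \<union>
      {vector [0, 0, a] | a. a \<in> {-1, 1}})"

definition std_cube :: "(real^3) set" where
  "std_cube = convex hull
     {vector [a, b, c] | a b c. a \<in> {-1, 1} \<and> b \<in> {-1, 1} \<and> c \<in> {-1, 1}}"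

definition golden_ratio :: real where
  "golden_ratio = (1 + sqrt 5) / 2"

definition std_icosahedron :: "(real^3) set" where
  "std_icosahedron = convex hull
     ({vector [0, a, b * golden_ratio] | a b. a \<in> {-1, 1} \<and> b \<in> {-1, 1}} \<union>
      {vector [b * golden_ratio, 0, a] | a b. a \<in> {-1, 1} \<and> b \<in> {-1, 1}} \<union>
      {vector [a, b * golden_ratio, 0] | a b. a \<in> {-1, 1} \<and> b \<in> {-1, 1}})"

definition regular_tetrahedron :: "(real^3) set \<Rightarrow> bool" where
  "regular_tetrahedron P \<longleftrightarrow> similar_to std_tetrahedron P"

definition regular_octahedron :: "(real^3) set \<Rightarrow> bool" where
  "regular_octahedron P \<longleftrightarrow> similar_to std_octahedron P"

definition cube :: "(real^3) set \<Rightarrow> bool" where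
  "cube P \<longleftrightarrow> similar_to std_cube P"

definition regular_icosahedron :: "(real^3) set \<Rightarrow> bool" where
  "regular_icosahedron P \<longleftrightarrow> similar_to std_icosahedron P"

section \<open>Saddle connections\<close>

text \<open>The surface of a polytope \<open>P\<close> is the union of its facets, its vertices are the extreme
  points of \<open>P\<close>. Two facets are adjacent if they share an edge. The degenerate case
  \<open>F = G\<close> is allowed, so that a single face is also covered by the notions below.\<close>

definition equal_or_adjacent :: "(real^3) set \<Rightarrow> (real^3) set \<Rightarrow> (real^3) set \<Rightarrow> bool" where
  "equal_or_adjacent P F G \<longleftrightarrow>
     F facet_of P \<and> G facet_of P \<and> (F = G \<or> (F \<inter> G) edge_of P)"

text \<open>An unfolding lays \<open>F\<close> and \<open>G\<close> isometrically into one plane. Since the two images agree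
  on the common edge, they either overlap or lie on opposite sides of that edge;
  injectivity on \<open>F \<union> G\<close> excludes the former.\<close>

definition unfolding_map ::
    "(real^3) set \<Rightarrow> (real^3) set \<Rightarrow> (real^3 \<Rightarrow> real^2) \<Rightarrow> bool" where
  "unfolding_map F G D \<longleftrightarrow>
     (\<forall>x\<in>F. \<forall>y\<in>F. dist (D x) (D y) = dist x y) \<and>
     (\<forall>x\<in>G. \<forall>y\<in>G. dist (D x) (D y) = dist x y) \<and>
     inj_on D (F \<union> G)"

text \<open>A curve, parametrized over the unit interval, is straight at \<open>t\<close> if near \<open>t\<close> it runs
  in one face or two adjacent faces and becomes a straight line, traversed at constant
  nonzero velocity, when these are unfolded. This is the intended notion only where the
  curve does not pass through a vertex, since around a vertex two adjacent faces do not
  cover a neighbourhood on the surface.\<close>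

definition straight_at :: "(real^3) set \<Rightarrow> (real \<Rightarrow> real^3) \<Rightarrow> real \<Rightarrow> bool" where
  "straight_at P \<gamma> t \<longleftrightarrow>
     (\<exists>F G D a v \<epsilon>. equal_or_adjacent P F G \<and> unfolding_map F G D \<and> v \<noteq> 0 \<and> \<epsilon> > 0 \<and>
        (\<forall>s\<in>{0..1}. \<bar>s - t\<bar> < \<epsilon> \<longrightarrow> \<gamma> s \<in> F \<union> G \<and> D (\<gamma> s) = a + s *\<^sub>R v))"

definition saddle_connection :: "(real^3) set \<Rightarrow> (real \<Rightarrow> real^3) \<Rightarrow> bool" where
  "saddle_connection P \<gamma> \<longleftrightarrow>
     path \<gamma> \<and> (\<forall>t\<in>{0..1}. straight_at P \<gamma> t) \<and>
     pathstart \<gamma> extreme_point_of P \<and> pathfinish \<gamma> extreme_point_of P \<and>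
     (\<forall>t\<in>{0<..<1}. \<not> \<gamma> t extreme_point_of P)"

definition closed_saddle_connection :: "(real^3) set \<Rightarrow> (real \<Rightarrow> real^3) \<Rightarrow> bool" where
  "closed_saddle_connection P \<gamma> \<longleftrightarrow>
     saddle_connection P \<gamma> \<and> pathstart \<gamma> = pathfinish \<gamma>"

end

theory Submission
  imports Defs
begin

text \<open>
  All faces of the four solids are regular triangles or squares, and these tile the plane. Hence a
  saddle connection, unfolded into the plane of one of its faces, becomes a straight segment between
  two points of the lattice of tile vertices. Its midpoint is half the sum of two lattice points and
  lies in a tile, but it is no vertex; so it is the midpoint of an edge or the centre of a square.
  The half-turn of the solid about the axis through this point is a symmetry of the surface that
  fixes the point and reverses the direction of the curve there. A geodesic is determined by
  its germ at any point, so the half-turn reverses the whole saddle connection and exchanges its end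
  points. If these coincided, the half-turn would fix a vertex; but no vertex lies on its axis.

  The unfolding is carried out in space. If \<open>m\<close> is the midpoint of an edge, then the reflection
  \<open>mirror m\<close> in the plane through \<open>m\<close> orthogonal to \<open>m\<close> carries either face at the edge into the plane of the
  other one, as unfolding does (\<open>unfold_hinged\<close>), and it differs from the half-turn about \<open>m\<close> by a point
  reflection. So lattices of adjacent faces correspond to each other (\<open>hinge_mirror_lattice\<close>), which
  by a connectedness argument puts both ends of the unfolded curve on the lattice
  (\<open>lattice_along_geodesic\<close>); the midpoint is then located by \<open>center_symmetry\<close>. Uniqueness of continuation
  (\<open>geodesics_agree\<close>) uses that at most two faces meet outside the vertices.

  These arguments take place in the locale \<open>reversible_solid\<close>, which asks for a finite set of vertices on
  a sphere such that the faces are of the right shape and the half-turns are symmetries without fixed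
  vertices. For each of the four solids both conditions are verified in coordinates, the shape of the
  faces by way of inner products of vertices.
\<close>

section \<open>Similarities and time reversal\<close>

text \<open>The similarity type of a solid is arbitrary, and the half-turns used below are similarities with
  ratio 1. Transport of saddle connections along similarities therefore serves twice: it reduces
  the theorem to standard coordinates, and it turns a geodesic into its image under a symmetry.\<close>

lemma similarity_affine:
  assumes "similarity f"
  obtains b c g where "c > 0" "orthogonal_transformation g" "f = (\<lambda>x. b + c *\<^sub>R g x)"
proof -
  obtain c where c: "c > 0" "\<And>x y. dist (f x) (f y) = c * dist x y"
    using assms unfolding similarity_def by blast
  define g where "g x = (1 / c) *\<^sub>R (f x - f 0)" for x
  have "dist (g x) (g y) = dist x y" for x y
  proof -
    have "g x - g y = (1 / c) *\<^sub>R (f x - f y)"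
      by (simp add: g_def algebra_simps)
    then have "dist (g x) (g y) = (1 / c) * dist (f x) (f y)"
      using c(1) by (simp add: dist_norm)
    then show ?thesis using c by simp
  qed
  then have "orthogonal_transformation g"
    by (simp add: orthogonal_transformation_isometry g_def)
  moreover have "f = (\<lambda>x. f 0 + c *\<^sub>R g x)" using c(1) by (simp add: g_def)
  ultimately show thesis using that c by blast
qed

lemma similarity_bij:
  assumes "similarity f" shows "bij f"
proof -
  obtain b c g where g: "c > 0" "orthogonal_transformation g" "f = (\<lambda>x. b + c *\<^sub>R g x)"
    using similarity_affine[OF assms] by metis
  have "f = (\<lambda>y. b + c *\<^sub>R y) \<circ> g" using g(3) by auto
  moreover have "bij (\<lambda>y. b + c *\<^sub>R y)"
    by (rule o_bij[of "\<lambda>z. (1/c) *\<^sub>R (z - b)"]) (use g(1) in \<open>auto simp: fun_eq_iff\<close>)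
  ultimately show ?thesis using orthogonal_transformation_bij[OF g(2)] bij_comp by metis
qed

lemma similarity_inv:
  assumes "similarity f" shows "similarity (inv f)"
proof -
  obtain c where c: "c > 0" "\<And>x y. dist (f x) (f y) = c * dist x y"
    using assms unfolding similarity_def by blast
  have "dist (inv f x) (inv f y) = (1/c) * dist x y" for x y
    using c(2)[of "inv f x" "inv f y"] c(1) similarity_bij[OF assms]
    by (simp add: bij_is_surj surj_f_inv_f)
  then show ?thesis unfolding similarity_def using c(1) by (intro exI[of _ "1/c"]) auto
qed

lemma similarity_image_faces:
  assumes "similarity f"
  shows "f ` F face_of f ` P \<longleftrightarrow> F face_of P" "aff_dim (f ` F) = aff_dim F"
proof -
  obtain b c g where g: "c > 0" "orthogonal_transformation g" "f = (\<lambda>x. b + c *\<^sub>R g x)"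
    using similarity_affine[OF assms] by metis
  define h where "h x = c *\<^sub>R g x" for x
  have h: "linear h" "inj h"
    using g(1) orthogonal_transformation_linear[OF g(2)] orthogonal_transformation_inj[OF g(2)]
    by (auto simp: h_def[abs_def] linear_compose_scale_right inj_def)
  have im: "f ` A = (+) b ` (h ` A)" for A by (simp add: g(3) h_def image_image)
  show "f ` F face_of f ` P \<longleftrightarrow> F face_of P"
    unfolding im by (simp only: face_of_translation_eq face_of_linear_image[OF h])
  show "aff_dim (f ` F) = aff_dim F"
    unfolding im using h by (simp only: aff_dim_translation_eq aff_dim_injective_linear_image)
qed

lemma similarity_facet:
  assumes "similarity f" "F facet_of P" shows "f ` F facet_of f ` P"
  using assms similarity_image_faces[OF assms(1)] by (simp add: facet_of_def)

lemma similarity_extreme_point: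
  assumes "similarity f" shows "f x extreme_point_of f ` P \<longleftrightarrow> x extreme_point_of P"
  using similarity_image_faces(1)[OF assms, of "{x}" P] by (simp add: face_of_singleton)

text \<open>An unfolding of the image faces is the old unfolding precomposed with the inverse similarity; the
  factor \<open>c\<close> restores the isometry condition.\<close>

lemma straight_at_similarity:
  assumes f: "similarity f" and st: "straight_at P \<gamma> t"
  shows "straight_at (f ` P) (f \<circ> \<gamma>) t"
proof -
  obtain c where c: "c > 0" "\<And>x y. dist (f x) (f y) = c * dist x y"
    using f unfolding similarity_def by blast
  note bf = similarity_bij[OF f]
  have invf [simp]: "inv f (f x) = x" for x using bf by (simp add: bij_is_inj)
  obtain F G D a v e where *: "equal_or_adjacent P F G" "unfolding_map F G D" "v \<noteq> 0" "e > 0"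
    "\<forall>s\<in>{0..1}. \<bar>s - t\<bar> < e \<longrightarrow> \<gamma> s \<in> F \<union> G \<and> D (\<gamma> s) = a + s *\<^sub>R v"
    using st unfolding straight_at_def by metis
  define D' where "D' y = c *\<^sub>R D (inv f y)" for y
  have D': "D' (f x) = c *\<^sub>R D x" for x by (simp add: D'_def)
  have adj: "equal_or_adjacent (f ` P) (f ` F) (f ` G)"
    using *(1) similarity_facet[OF f] similarity_image_faces[OF f]
    unfolding equal_or_adjacent_def edge_of_def
    by (auto simp flip: image_Int[OF bij_is_inj[OF bf]])
  have ds: "dist (c *\<^sub>R a) (c *\<^sub>R b) = c * dist a b" for a b :: "real^2"
    using c(1) by (simp add: dist_norm flip: scaleR_diff_right)
  have unf: "unfolding_map (f ` F) (f ` G) D'"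
    unfolding unfolding_map_def
  proof (intro conjI ballI)
    show "inj_on D' (f ` F \<union> f ` G)"
    proof (rule inj_onI)
      fix x y assume "x \<in> f ` F \<union> f ` G" "y \<in> f ` F \<union> f ` G" and eq: "D' x = D' y"
      then obtain x' y' where xy: "x' \<in> F \<union> G" "x = f x'" "y' \<in> F \<union> G" "y = f y'" by auto
      then have "D x' = D y'" using eq c(1) by (simp add: D')
      then show "x = y" using *(2) xy unfolding unfolding_map_def by (metis inj_onD)
    qed
  qed (use *(2) c(2) ds in \<open>auto simp: unfolding_map_def D'\<close>)
  show ?thesis
    unfolding straight_at_def
    by (rule exI[of _ "f ` F"], rule exI[of _ "f ` G"], rule exI[of _ D'], rule exI[of _ "c *\<^sub>R a"],
        rule exI[of _ "c *\<^sub>R v"], rule exI[of _ e])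
      (use adj unf * c in \<open>auto simp: D' algebra_simps\<close>)
qed

lemma straight_at_reverse:
  assumes "straight_at P \<gamma> t"
  shows "straight_at P (\<lambda>s. \<gamma> (1 - s)) (1 - t)"
proof -
  obtain F G D a v e where *: "equal_or_adjacent P F G" "unfolding_map F G D" "v \<noteq> 0" "e > 0"
    "\<forall>s\<in>{0..1}. \<bar>s - t\<bar> < e \<longrightarrow> \<gamma> s \<in> F \<union> G \<and> D (\<gamma> s) = a + s *\<^sub>R v"
    using assms unfolding straight_at_def by metis
  have "\<forall>s\<in>{0..1}. \<bar>s - (1 - t)\<bar> < e \<longrightarrow>
      \<gamma> (1 - s) \<in> F \<union> G \<and> D (\<gamma> (1 - s)) = (a + v) + s *\<^sub>R (- v)"
  proof (intro ballI impI)
    fix s :: real assume "s \<in> {0..1}" "\<bar>s - (1 - t)\<bar> < e"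
    then show "\<gamma> (1 - s) \<in> F \<union> G \<and> D (\<gamma> (1 - s)) = (a + v) + s *\<^sub>R (- v)"
      using *(5)[rule_format, of "1 - s"] by (auto simp: algebra_simps)
  qed
  moreover have "- v \<noteq> 0" using *(3) by simp
  ultimately show ?thesis unfolding straight_at_def using *(1,2,4) by blast
qed

lemma closed_saddle_connection_similarity:
  assumes f: "similarity f" and "closed_saddle_connection P \<gamma>"
  shows "closed_saddle_connection (f ` P) (f \<circ> \<gamma>)"
proof -
  obtain c where c: "c > 0" "\<And>x y. dist (f x) (f y) = c * dist x y"
    using f unfolding similarity_def by blast
  have "c-lipschitz_on UNIV f" using c by (auto intro: lipschitz_onI)
  then have "continuous_on (path_image \<gamma>) f"
    by (meson lipschitz_on_continuous_on continuous_on_subset subset_UNIV)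
  then show ?thesis
    using assms(2) straight_at_similarity[OF f] similarity_extreme_point[OF f]
    unfolding closed_saddle_connection_def saddle_connection_def
    by (simp add: path_continuous_image pathstart_compose pathfinish_compose)
qed

section \<open>Half-turns about an axis and reflections in a plane\<close>

text \<open>The rotation by \<open>\<pi>\<close> about the line through \<open>0\<close> and \<open>m\<close>. For \<open>m = 0\<close> division by zero makes it
  the point reflection \<open>y \<mapsto> - y\<close>, so that most of the identities below need no case distinction.\<close>

definition half_turn :: "real^3 \<Rightarrow> real^3 \<Rightarrow> real^3" where
  "half_turn m y = (2 * (y \<bullet> m) / (m \<bullet> m)) *\<^sub>R m - y"

text \<open>The reflection in the plane \<open>{y. y \<bullet> m = m \<bullet> m}\<close>, that is, the plane through \<open>m\<close> orthogonal to \<open>m\<close>.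
  If \<open>m\<close> is the midpoint of an edge and the half-turn about \<open>m\<close> exchanges the two faces at that edge,
  then this plane contains the edge and bisects the exterior angle there: the reflection carries
  one face into the plane of the other one, on the far side of the edge. It is thus the unfolding
  across the edge, expressed without leaving space. Writing it through the half-turn makes the
  link between unfolding and symmetry an identity.\<close>

definition mirror :: "real^3 \<Rightarrow> real^3 \<Rightarrow> real^3" where
  "mirror m y = 2 *\<^sub>R m - half_turn m y"

lemma linear_half_turn: "linear (half_turn m)"
  unfolding half_turn_def
  by (rule linearI) (simp_all add: algebra_simps add_divide_distrib)

lemma half_turn_half_turn [simp]: "half_turn m (half_turn m y) = y"
  by (cases "m = 0") (simp_all add: half_turn_def algebra_simps)

lemma half_turn_inner: "half_turn m x \<bullet> half_turn m y = x \<bullet> y"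
  by (cases "m = 0") (simp_all add: half_turn_def algebra_simps inner_commute)

lemma half_turn_inner_axis: "half_turn m y \<bullet> m = y \<bullet> m"
  by (cases "m = 0") (simp_all add: half_turn_def algebra_simps)

lemma half_turn_axis [simp]: "half_turn m m = m"
  by (cases "m = 0") (simp_all add: half_turn_def scaleR_2)

lemma similarity_half_turn: "similarity (half_turn m)"
proof -
  have "dist (half_turn m x) (half_turn m y) = 1 * dist x y" for x y
    using half_turn_inner[of m "x - y" "x - y"]
    by (simp add: dist_norm norm_eq_sqrt_inner linear_diff[OF linear_half_turn])
  then show ?thesis unfolding similarity_def by (intro exI[of _ 1]) auto
qed

lemma mirror_affine: "mirror m (p + s *\<^sub>R u) = mirror m p + s *\<^sub>R (- half_turn m u)"
  by (simp add: mirror_def linear_add[OF linear_half_turn] linear_scale[OF linear_half_turn])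

lemma mirror_comb: "mirror m (a + b - d) = mirror m a + mirror m b - mirror m d"
  by (simp add: mirror_def linear_add[OF linear_half_turn] linear_diff[OF linear_half_turn])

lemma mirror_mirror [simp]: "mirror m (mirror m y) = y"
  by (simp add: mirror_def linear_add[OF linear_half_turn] linear_diff[OF linear_half_turn]
      linear_scale[OF linear_half_turn])

lemma mirror_inner_axis: "mirror m y \<bullet> m = 2 * (m \<bullet> m) - y \<bullet> m"
  by (simp add: mirror_def inner_diff_left half_turn_inner_axis)

lemma mirror_fixes_iff:
  assumes "m \<noteq> 0" shows "mirror m y = y \<longleftrightarrow> y \<bullet> m = m \<bullet> m"
proof
  assume "mirror m y = y" then show "y \<bullet> m = m \<bullet> m" using mirror_inner_axis[of m y] by simp
next
  assume "y \<bullet> m = m \<bullet> m" then show "mirror m y = y" using assms by (simp add: mirror_def half_turn_def)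
qed

section \<open>Rigidity of unfoldings\<close>

lemma polarization_dist:
  fixes x y z :: "'a::real_inner"
  shows "(x - z) \<bullet> (y - z) = ((dist x z)^2 + (dist y z)^2 - (dist x y)^2) / 2"
proof -
  have "(dist x y)^2 = (x - y) \<bullet> (x - y)" for x y :: 'a
    by (simp add: dist_norm power2_norm_eq_inner)
  then show ?thesis by (simp add: algebra_simps inner_commute)
qed

lemma isometric_inner:
  fixes D :: "'a::real_inner \<Rightarrow> 'b::real_inner"
  assumes "\<forall>x\<in>F. \<forall>y\<in>F. dist (D x) (D y) = dist x y" "x \<in> F" "y \<in> F" "z \<in> F"
  shows "(D x - D z) \<bullet> (D y - D z) = (x - z) \<bullet> (y - z)"
  using assms by (simp add: polarization_dist)

text \<open>Inner products of differences are determined by distances, so both sides have the same Gram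
  matrix relative to \<open>D p\<close>, and the squared norm of their difference vanishes.\<close>

lemma isometric_affine_coordinates:
  fixes D :: "'a::real_inner \<Rightarrow> 'b::real_inner"
  assumes iso: "\<forall>x\<in>F. \<forall>y\<in>F. dist (D x) (D y) = dist x y"
    and F: "p \<in> F" "p + u \<in> F" "p + w \<in> F" "p + i *\<^sub>R u + j *\<^sub>R w \<in> F"
  shows "D (p + i *\<^sub>R u + j *\<^sub>R w) = D p + i *\<^sub>R (D (p + u) - D p) + j *\<^sub>R (D (p + w) - D p)"
proof -
  let ?x = "p + i *\<^sub>R u + j *\<^sub>R w"
  define X where "X = D ?x - D p"
  define U where "U = D (p + u) - D p"
  define W where "W = D (p + w) - D p"
  note I = isometric_inner[OF iso _ _ F(1)]
  have g: "X \<bullet> X = (i *\<^sub>R u + j *\<^sub>R w) \<bullet> (i *\<^sub>R u + j *\<^sub>R w)" "X \<bullet> U = (i *\<^sub>R u + j *\<^sub>R w) \<bullet> u"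
    "X \<bullet> W = (i *\<^sub>R u + j *\<^sub>R w) \<bullet> w" "U \<bullet> U = u \<bullet> u" "U \<bullet> W = u \<bullet> w" "W \<bullet> W = w \<bullet> w"
    using I[OF F(4,4)] I[OF F(4,2)] I[OF F(4,3)] I[OF F(2,2)] I[OF F(2,3)] I[OF F(3,3)]
    by (simp_all add: X_def U_def W_def add.assoc)
  have "(X - i *\<^sub>R U - j *\<^sub>R W) \<bullet> (X - i *\<^sub>R U - j *\<^sub>R W) =
     X \<bullet> X - 2 * i * (X \<bullet> U) - 2 * j * (X \<bullet> W) + i * i * (U \<bullet> U) + 2 * i * j * (U \<bullet> W) + j * j * (W \<bullet> W)"
    by (simp add: algebra_simps inner_commute)
  also have "\<dots> = 0" unfolding g by (simp add: algebra_simps inner_commute)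
  finally have "X - i *\<^sub>R U - j *\<^sub>R W = 0" by (simp only: inner_eq_zero_iff)
  then have "X = i *\<^sub>R U + j *\<^sub>R W" by (simp add: algebra_simps)
  then show ?thesis by (simp add: X_def U_def W_def algebra_simps)
qed

lemma gram_zero_iff:
  fixes U W :: "'a::real_inner"
  assumes "(U \<bullet> U) * (W \<bullet> W) \<noteq> (U \<bullet> W)^2"
  shows "independent {U, W}" "U \<noteq> W"
proof -
  show "U \<noteq> W" using assms by (auto simp: power2_eq_square)
  show "independent {U, W}"
  proof
    assume "dependent {U, W}"
    moreover have "W \<noteq> 0" using assms by auto
    ultimately have "U \<in> span {W}" using \<open>U \<noteq> W\<close> independent_insert[of U "{W}"] by simp
    then obtain k where "U = k *\<^sub>R W" by (auto simp: span_singleton)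
    then show False using assms by (auto simp: power2_eq_square)
  qed
qed

text \<open>Laying a plane piece back into space: two independent vectors of the plane may be sent to any
  two vectors in space with the same Gram matrix.\<close>

lemma plane_embedding:
  fixes U W :: "real^2" and u w :: "real^3"
  assumes g: "U \<bullet> U = u \<bullet> u" "U \<bullet> W = u \<bullet> w" "W \<bullet> W = w \<bullet> w"
    and ind: "(u \<bullet> u) * (w \<bullet> w) \<noteq> (u \<bullet> w)^2"
  obtains k where "linear k" "k U = u" "k W = w" "\<forall>v. v \<noteq> 0 \<longrightarrow> k v \<noteq> 0"
    "\<forall>v. \<exists>i j. v = i *\<^sub>R U + j *\<^sub>R W"
proof -
  have i: "independent {U, W}" "U \<noteq> W" using gram_zero_iff[of U W] g ind by auto
  have "span {U, W} = UNIV"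
    using i card_ge_dim_independent[of "{U, W}" UNIV] by (simp add: top.extremum_uniqueI)
  then have sp: "\<exists>i j. v = i *\<^sub>R U + j *\<^sub>R W" for v
  proof -
    have "v \<in> span {U, W}" using \<open>span {U, W} = UNIV\<close> by simp
    then obtain i where "v - i *\<^sub>R U \<in> span {W}" by (auto simp: span_insert)
    then obtain j where "v - i *\<^sub>R U = j *\<^sub>R W" by (auto simp: span_singleton)
    then have "v = i *\<^sub>R U + j *\<^sub>R W" by (simp add: algebra_simps)
    then show ?thesis by blast
  qed
  obtain k :: "real^2 \<Rightarrow> real^3" where k: "linear k" "\<forall>x\<in>{U, W}. k x = (if x = U then u else w)"
    using linear_independent_extend[OF i(1), of "\<lambda>x. if x = U then u else w"] by blast
  then have k': "k U = u" "k W = w" using i(2) by auto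
  have "k v \<noteq> 0" if "v \<noteq> 0" for v
  proof -
    obtain a b where v: "v = a *\<^sub>R U + b *\<^sub>R W" using sp by blast
    have "k v = a *\<^sub>R u + b *\<^sub>R w" using v k' by (simp add: linear_add[OF k(1)] linear_scale[OF k(1)])
    then have "k v \<bullet> k v = v \<bullet> v" using v g by (simp add: algebra_simps inner_commute)
    then show ?thesis using that by auto
  qed
  then show thesis using that[OF k(1) k'] sp by simp
qed

text \<open>Any unfolding of two congruent pieces along the edge from \<open>p\<close> to \<open>p + u\<close> is the canonical one. The
  vector \<open>w\<close> points from \<open>p\<close> to another vertex of \<open>F\<close>, and \<open>w'\<close> from \<open>p + u\<close> to the corresponding vertex
  of \<open>H\<close> under a symmetry that exchanges the ends of the edge. Distances leave two positions for
  the image of that vertex, one on each side of the unfolded edge. The one on the side of \<open>F\<close> is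
  already occupied by the image of \<open>p + w + \<kappa> u\<close>, the mirror image of \<open>p + w\<close> in the perpendicular
  bisector of the edge, so injectivity rules it out. This is where the symmetry of the faces
  (\<open>\<kappa> = 0\<close> for a triangle, \<open>\<kappa> = 1\<close> for a square) enters.\<close>

lemma unfold_across_edge:
  fixes D :: "real^3 \<Rightarrow> real^2" and p u w w' :: "real^3"
  defines "\<kappa> \<equiv> 1 - 2 * (w \<bullet> u) / (u \<bullet> u)"
  assumes D: "unfolding_map F H D"
    and F: "p \<in> F" "p + u \<in> F" "p + w \<in> F" "p + w + \<kappa> *\<^sub>R u \<in> F"
    and H: "p + u \<in> H" "p \<in> H" "p + u + w' \<in> H"
    and g: "w' \<bullet> u = - (w \<bullet> u)" "w' \<bullet> w' = w \<bullet> w"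
    and ind: "(u \<bullet> u) * (w \<bullet> w) \<noteq> (u \<bullet> w)^2"
    and ne: "p + u + w' \<noteq> p + w + \<kappa> *\<^sub>R u"
  obtains k where "linear k" "\<forall>v. v \<noteq> 0 \<longrightarrow> k v \<noteq> 0"
    "\<forall>i j. p + i *\<^sub>R u + j *\<^sub>R w \<in> F \<longrightarrow>
       p + k (D (p + i *\<^sub>R u + j *\<^sub>R w) - D p) = p + i *\<^sub>R u + j *\<^sub>R w"
    "\<forall>i j. p + u + i *\<^sub>R (- u) + j *\<^sub>R w' \<in> H \<longrightarrow>
       p + k (D (p + u + i *\<^sub>R (- u) + j *\<^sub>R w') - D p) = p + u + i *\<^sub>R (- u) + j *\<^sub>R (- w)"
proof -
  have isoF: "\<forall>x\<in>F. \<forall>y\<in>F. dist (D x) (D y) = dist x y"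
    and isoH: "\<forall>x\<in>H. \<forall>y\<in>H. dist (D x) (D y) = dist x y" and inj: "inj_on D (F \<union> H)"
    using D unfolding unfolding_map_def by auto
  define U where "U = D (p + u) - D p"
  define W where "W = D (p + w) - D p"
  define Z where "Z = D (p + u + w') - D (p + u)"
  note I = isometric_inner[OF isoF _ _ F(1)] and J = isometric_inner[OF isoH _ _ H(1)]
  have G: "U \<bullet> U = u \<bullet> u" "U \<bullet> W = u \<bullet> w" "W \<bullet> W = w \<bullet> w"
    using I[OF F(2,2)] I[OF F(2,3)] I[OF F(3,3)] by (simp_all add: U_def W_def)
  have Z: "Z \<bullet> Z = w \<bullet> w" "Z \<bullet> U = - (w \<bullet> u)"
    using J[OF H(3,3)] J[OF H(3,2)] g by (simp_all add: Z_def U_def algebra_simps)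
  have u0: "u \<noteq> 0" using ind by auto
  obtain k where k: "linear k" "k U = u" "k W = w" "\<forall>v. v \<noteq> 0 \<longrightarrow> k v \<noteq> 0"
    "\<forall>v. \<exists>i j. v = i *\<^sub>R U + j *\<^sub>R W"
    by (rule plane_embedding[OF G ind]) (rule that)
  have ZW: "Z = - W"
  proof -
    obtain i j where ij: "Z = i *\<^sub>R U + j *\<^sub>R W" using k(5) by blast
    have 1: "i * (u \<bullet> u) + (1 + j) * (u \<bullet> w) = 0"
      using Z(2) unfolding ij by (simp add: G inner_commute algebra_simps)
    have 2: "i * i * (u \<bullet> u) + 2 * i * j * (u \<bullet> w) + j * j * (w \<bullet> w) = w \<bullet> w"
      using Z(1) unfolding ij by (simp add: G inner_commute algebra_simps)
    have i: "i = - (1 + j) * (u \<bullet> w) / (u \<bullet> u)"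
      using 1 u0 by (simp add: field_simps)
    \<comment> \<open>Eliminating \<open>i\<close> from the two equations leaves a multiple of the Gram determinant.\<close>
    have "(1 + j) * (1 - j) * ((u \<bullet> u) * (w \<bullet> w) - (u \<bullet> w)^2) = 0"
      using 1 2 by algebra
    then have "j = -1 \<or> j = 1" using ind by auto
    then show ?thesis
    proof
      assume "j = -1" then show ?thesis using i ij by simp
    next
      assume j: "j = 1"
      then have "Z = W + (\<kappa> - 1) *\<^sub>R U"
        using i ij by (simp add: \<kappa>_def inner_commute)
      then have "D (p + u + w') = D p + \<kappa> *\<^sub>R U + 1 *\<^sub>R W"
        by (simp add: Z_def U_def algebra_simps)
      also have "\<dots> = D (p + \<kappa> *\<^sub>R u + 1 *\<^sub>R w)"
        unfolding U_def W_def
        by (rule isometric_affine_coordinates[OF isoF F(1,2,3), symmetric])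
          (use F(4) in \<open>simp add: algebra_simps\<close>)
      finally have "D (p + u + w') = D (p + w + \<kappa> *\<^sub>R u)" by (simp add: algebra_simps)
      then have "p + u + w' = p + w + \<kappa> *\<^sub>R u"
        using inj H(3) F(4) by (meson Un_iff inj_onD)
      with ne show ?thesis by simp
    qed
  qed
  show thesis
  proof (rule that[OF k(1,4)]; intro allI impI)
    fix i j assume a: "p + i *\<^sub>R u + j *\<^sub>R w \<in> F"
    show "p + k (D (p + i *\<^sub>R u + j *\<^sub>R w) - D p) = p + i *\<^sub>R u + j *\<^sub>R w"
      unfolding isometric_affine_coordinates[OF isoF F(1,2,3) a]
      by (simp add: k(2,3) linear_add[OF k(1)] linear_scale[OF k(1)] flip: U_def W_def)
  next
    fix i j assume a: "p + u + i *\<^sub>R (- u) + j *\<^sub>R w' \<in> H"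
    have h: "p + u + - u \<in> H" using H(2) by simp
    have "D (p + u + i *\<^sub>R (- u) + j *\<^sub>R w') - D p = U + i *\<^sub>R (- U) + j *\<^sub>R (- W)"
      using isometric_affine_coordinates[OF isoH H(1) h H(3) a] ZW
      unfolding U_def[symmetric] Z_def[symmetric] by (simp add: U_def algebra_simps)
    then show "p + k (D (p + u + i *\<^sub>R (- u) + j *\<^sub>R w') - D p) = p + u + i *\<^sub>R (- u) + j *\<^sub>R (- w)"
      by (simp only: k(2,3) linear_add[OF k(1)] linear_neg[OF k(1)] linear_scale[OF k(1)]) simp
  qed
qed

section \<open>Lattices in the planes of triangular and square faces\<close>

text \<open>The vertices of a regular triangle or of a square, given by one corner \<open>p\<close> and its two neighbours.\<close>

definition tile :: "bool \<Rightarrow> real^3 \<Rightarrow> real^3 \<Rightarrow> real^3 \<Rightarrow> (real^3) set" where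
  "tile sq p q r = (if sq then {p, q, r, q + r - p} else {p, q, r})"

text \<open>All vertices lie on a sphere of squared radius \<open>N\<close> about \<open>0\<close>, and \<open>c\<close> is the inner product of two
  adjacent ones. Then \<open>2 * c - N\<close> is what the inner product of opposite vertices of a
  square has to be. The last condition keeps the centre of a square face away from \<open>0\<close>; it excludes
  the equatorial squares of the octahedron.\<close>

definition corner :: "bool \<Rightarrow> real \<Rightarrow> real \<Rightarrow> real^3 \<Rightarrow> real^3 \<Rightarrow> real^3 \<Rightarrow> bool" where
  "corner sq N c p q r \<longleftrightarrow>
     p \<bullet> q = c \<and> p \<bullet> r = c \<and> q \<bullet> r = (if sq then 2 * c - N else c) \<and> (sq \<longrightarrow> q + r \<noteq> 0)"

text \<open>For the vertices of a triangle or a square this is the lattice that they generate in their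
  plane. The closure condition mentions no base point and is preserved by every affine map.\<close>

inductive_set lattice :: "'a::ab_group_add set \<Rightarrow> 'a set" for T where
  vertex: "v \<in> T \<Longrightarrow> v \<in> lattice T"
| parallelogram: "a \<in> lattice T \<Longrightarrow> b \<in> lattice T \<Longrightarrow> d \<in> lattice T \<Longrightarrow> a + b - d \<in> lattice T"

text \<open>A sphere meets a line in at most two points, and the prescribed inner products with \<open>p\<close> and \<open>q\<close>
  confine \<open>x\<close>, \<open>y\<close>, \<open>z\<close> to a line in the direction of the cross product.\<close>

lemma two_points_on_sphere:
  fixes p q x y z :: "real^3"
  assumes "x \<bullet> x = N" "y \<bullet> y = N" "z \<bullet> z = N"
    and "p \<bullet> x = b" "p \<bullet> y = b" "p \<bullet> z = b" "q \<bullet> x = d" "q \<bullet> y = d" "q \<bullet> z = d"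
    and ind: "\<not> collinear {0, p, q}"
  shows "x = y \<or> x = z \<or> y = z"
proof -
  define n where "n = cross3 p q"
  have n: "n \<noteq> 0" using ind by (simp add: n_def cross_eq_0)
  have par: "\<exists>s. y = x + s *\<^sub>R n" if "p \<bullet> x = b" "p \<bullet> y = b" "q \<bullet> x = d" "q \<bullet> y = d" for x y
  proof -
    have "cross3 (y - x) n = 0"
      using that unfolding n_def Lagrange by (simp add: inner_diff_right inner_commute)
    then have "collinear {0, n, y - x}" by (simp add: cross_eq_0 insert_commute)
    then obtain s where "y - x = s *\<^sub>R n" using n by (auto simp: collinear_lemma)
    then show ?thesis by (metis add.commute diff_add_cancel)
  qed
  obtain s where s: "y = x + s *\<^sub>R n" using par[of x y] assms by blast
  obtain t where t: "z = x + t *\<^sub>R n" using par[of x z] assms by blast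
  have 1: "s * (2 * (x \<bullet> n) + s * (n \<bullet> n)) = 0"
    using assms(1,2) unfolding s by (simp add: algebra_simps inner_commute)
  have 2: "t * (2 * (x \<bullet> n) + t * (n \<bullet> n)) = 0"
    using assms(1,3) unfolding t by (simp add: algebra_simps inner_commute)
  have "s = t" if "s \<noteq> 0" "t \<noteq> 0"
  proof -
    have "2 * (x \<bullet> n) + s * (n \<bullet> n) = 0" "2 * (x \<bullet> n) + t * (n \<bullet> n) = 0" using 1 2 that by auto
    then have "s * (n \<bullet> n) = t * (n \<bullet> n)" by linarith
    moreover have "n \<bullet> n \<noteq> 0" using n by simp
    ultimately show ?thesis by simp
  qed
  then show ?thesis using s t by auto
qed

lemma half_turn_scale: "k \<noteq> 0 \<Longrightarrow> half_turn (k *\<^sub>R m) = half_turn m"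
  by (rule ext) (simp add: half_turn_def field_simps)

lemma coordinates_unique:
  fixes u w :: "'a::real_inner"
  assumes "(u \<bullet> u) * (w \<bullet> w) \<noteq> (u \<bullet> w)^2" "i *\<^sub>R u + j *\<^sub>R w = k *\<^sub>R u + l *\<^sub>R w"
  shows "i = k" "j = l"
proof -
  have z: "(i - k) *\<^sub>R u + (j - l) *\<^sub>R w = 0" using assms(2) by (simp add: algebra_simps)
  then have "((i - k) *\<^sub>R u + (j - l) *\<^sub>R w) \<bullet> u = 0" "((i - k) *\<^sub>R u + (j - l) *\<^sub>R w) \<bullet> w = 0" by simp_all
  then have e: "(i - k) * (u \<bullet> u) + (j - l) * (u \<bullet> w) = 0" "(i - k) * (u \<bullet> w) + (j - l) * (w \<bullet> w) = 0"
    by (simp_all only: inner_add_left inner_scaleR_left inner_commute[of w u])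
  then have "(i - k) * ((u \<bullet> u) * (w \<bullet> w) - (u \<bullet> w)^2) = 0" "(j - l) * ((u \<bullet> u) * (w \<bullet> w) - (u \<bullet> w)^2) = 0"
    by algebra+
  then show "i = k" "j = l" using assms(1) by auto
qed

section \<open>Solids with regular triangular or square faces and edge half-turns\<close>

text \<open>The combinatorial data that the argument needs: \<open>S\<close> is the vertex set, and two vertices are
  adjacent if their inner product is the maximal value \<open>c\<close>. Besides the shape of the faces the
  essential hypothesis is \<open>turn\<close>: half-turns about edge midpoints and about centres of square
  faces (whose axes are spanned by the sum of two opposite vertices) are symmetries, and none of
  them fixes a vertex.\<close>

locale reversible_solid =
  fixes S :: "(real^3) set" and N c :: real and sq :: bool
  assumes fin: "finite S"
    and norm: "v \<in> S \<Longrightarrow> v \<bullet> v = N"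
    and inner_le: "v \<in> S \<Longrightarrow> w \<in> S \<Longrightarrow> v \<noteq> w \<Longrightarrow> v \<bullet> w \<le> c"
    and c_less: "c < N" and c_greater: "- N < c"
    and turn: "p \<in> S \<Longrightarrow> q \<in> S \<Longrightarrow> p \<bullet> q = c \<or> sq \<and> p \<bullet> q = 2 * c - N \<and> p + q \<noteq> 0 \<Longrightarrow> v \<in> S \<Longrightarrow>
        half_turn (p + q) v \<in> S - {v}"
    and facet: "F facet_of convex hull S \<Longrightarrow> \<exists>p q r. corner sq N c p q r \<and> S \<inter> F = tile sq p q r"
begin

abbreviation P where "P \<equiv> convex hull S"

lemma face_eq_hull: "F face_of P \<Longrightarrow> F = convex hull (S \<inter> F)"
proof -
  assume F: "F face_of P"
  then obtain S' where S': "S' \<subseteq> S" "F = convex hull S'"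
    using face_of_convex_hull_subset[OF finite_imp_compact[OF fin]] by metis
  have "convex hull S' \<subseteq> convex hull (S \<inter> F)"
    using S' hull_subset[of S' convex] by (intro hull_mono) auto
  moreover have "convex hull (S \<inter> F) \<subseteq> F"
    using face_of_imp_convex[OF F] by (intro hull_minimal) auto
  ultimately show ?thesis using S' by auto
qed

lemma facet_face: "F facet_of P \<Longrightarrow> F face_of P" by (rule facet_of_imp_face_of)

text \<open>A facet contained in another one would be a proper face of it, and so of smaller dimension.\<close>

lemma facet_eqI:
  assumes "F facet_of P" "H facet_of P" "S \<inter> F \<subseteq> H"
  shows "F = H"
proof (rule ccontr)
  assume "F \<noteq> H"
  have "F \<subseteq> H"
    by (subst face_eq_hull[OF facet_face[OF assms(1)]])
      (intro hull_minimal assms(3) face_of_imp_convex[OF facet_face[OF assms(2)]])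
  then have "F face_of H"
    using face_of_subset[OF facet_face[OF assms(1)]] facet_of_imp_subset[OF assms(2)] by blast
  then have "aff_dim F < aff_dim H"
    using face_of_aff_dim_lt face_of_imp_convex[OF facet_face[OF assms(2)]] \<open>F \<noteq> H\<close> by blast
  then show False using assms unfolding facet_of_def by simp
qed

text \<open>Each vertex \<open>v\<close> is exposed by its own inner product functional, because \<open>v\<close> lies on the sphere that
  encloses the solid.\<close>

lemma extreme_iff_vertex: "v extreme_point_of P \<longleftrightarrow> v \<in> S"
proof
  assume "v \<in> S"
  have "S \<subseteq> cball 0 (sqrt N)"
    using norm by (auto simp: norm_eq_sqrt_inner)
  then have ball: "P \<subseteq> cball 0 (sqrt N)" by (intro hull_minimal) auto
  have "v \<bullet> y \<le> N" if "y \<in> S" for y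
    using inner_le[OF \<open>v \<in> S\<close> that] norm[OF that] c_less by (cases "v = y") auto
  then have "S \<subseteq> {y. v \<bullet> y \<le> N}" by blast
  then have le: "P \<subseteq> {y. v \<bullet> y \<le> N}" by (intro hull_minimal) (auto simp: convex_halfspace_le)
  have "y = v" if "y \<in> P" "v \<bullet> y = N" for y
  proof -
    have "y \<bullet> y \<le> N"
      using ball that(1) by (auto simp: norm_eq_sqrt_inner)
    then have "(y - v) \<bullet> (y - v) \<le> 0"
      using that(2) norm[OF \<open>v \<in> S\<close>] by (simp add: algebra_simps inner_commute)
    then show ?thesis using inner_gt_zero_iff[of "y - v"] by (auto simp: not_less[symmetric])
  qed
  moreover have "v \<in> P" "v \<bullet> v = N" using \<open>v \<in> S\<close> norm hull_inc by auto
  ultimately have "P \<inter> {y. v \<bullet> y = N} = {v}" by auto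
  moreover have "P \<inter> {y. v \<bullet> y = N} face_of P"
    by (rule face_of_Int_supporting_hyperplane_le) (use le in auto)
  ultimately show "v extreme_point_of P" by (simp add: face_of_singleton)
qed (rule extreme_point_of_convex_hull)

lemma corner_swap: "corner sq N c p q r \<Longrightarrow> corner sq N c p r q" "tile sq p r q = tile sq p q r"
  by (auto simp: corner_def tile_def inner_commute add.commute)

lemma corner_rotate:
  assumes "corner sq N c p q r" "p \<in> S" "q \<in> S" "r \<in> S"
  shows "\<exists>s. corner sq N c q p s \<and> tile sq q p s = tile sq p q r"
proof (cases sq)
  case True
  have "corner sq N c q p (q + r - p) \<and> tile sq q p (q + r - p) = tile sq p q r"
    using assms True norm by (auto simp: corner_def tile_def inner_commute algebra_simps)
  then show ?thesis by blast
next
  case False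
  then have "corner sq N c q p r \<and> tile sq q p r = tile sq p q r"
    using assms by (auto simp: corner_def tile_def inner_commute)
  then show ?thesis by blast
qed

lemma corner_in: "S \<inter> F = tile sq p q r \<Longrightarrow> {p, q, r} \<subseteq> S \<inter> F \<and> (sq \<longrightarrow> q + r - p \<in> S \<inter> F)"
  by (auto simp: tile_def)

text \<open>Two vertices of a face are adjacent, or they are opposite vertices of a square. In the first case
  the description of the face can be made to start at that edge.\<close>

lemma pair_in_facet:
  assumes F: "F facet_of P" and "p \<in> S \<inter> F" "q \<in> S \<inter> F" "p \<noteq> q"
  shows "p \<bullet> q = c \<and> (\<exists>r. corner sq N c p q r \<and> S \<inter> F = tile sq p q r) \<or>
    sq \<and> p \<bullet> q = 2 * c - N \<and> p + q \<noteq> 0 \<and> (\<exists>r\<in>S. \<exists>s\<in>S. p + q = r + s \<and> r \<noteq> s \<and> S \<inter> F = {p, q, r, s})"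
proof -
  obtain a b d where *: "corner sq N c a b d" "S \<inter> F = tile sq a b d" using facet[OF F] by blast
  note abd = corner_in[OF *(2)]
  define Q where "Q x y \<longleftrightarrow> (\<exists>r. corner sq N c x y r \<and> S \<inter> F = tile sq x y r)" for x y
  have E: "Q a' b' \<and> Q b' a' \<and> Q a' d' \<and> Q d' a'"
    if cor: "corner sq N c a' b' d'" "S \<inter> F = tile sq a' b' d'" for a' b' d'
  proof -
    have in': "a' \<in> S" "b' \<in> S" "d' \<in> S" using corner_in[OF cor(2)] by auto
    have sw: "corner sq N c a' d' b'" "S \<inter> F = tile sq a' d' b'"
      using corner_swap(1)[OF cor(1)] corner_swap(2)[of a' d' b'] cor(2) by simp_all
    have "Q b' a'" using corner_rotate[OF cor(1) in'] cor(2) by (auto simp: Q_def)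
    moreover have "Q d' a'" using corner_rotate[OF sw(1) in'(1,3,2)] sw(2) by (auto simp: Q_def)
    ultimately show ?thesis using cor sw by (auto simp: Q_def)
  qed
  have Qc: "p \<bullet> q = c" if "Q p q" using that by (auto simp: Q_def corner_def)
  show ?thesis
  proof (cases sq)
    case False
    have "corner sq N c b a d \<and> S \<inter> F = tile sq b a d"
      using * False by (auto simp: corner_def tile_def inner_commute)
    then have "Q b d" "Q d b" using E[of b a d] by auto
    moreover have "S \<inter> F = {a, b, d}" using *(2) False by (simp add: tile_def)
    ultimately have "Q p q" using E[OF *] assms(2-4) by auto
    then show ?thesis using Qc Q_def by blast
  next
    case True
    define e where "e = b + d - a"
    have S4: "S \<inter> F = {a, b, d, e}" using * True by (auto simp: tile_def e_def)
    have ip: "a \<bullet> b = c" "a \<bullet> d = c" "b \<bullet> d = 2 * c - N" "b + d \<noteq> 0"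
      using *(1) True by (auto simp: corner_def)
    have nn: "a \<bullet> a = N" "b \<bullet> b = N" "d \<bullet> d = N" using abd norm by auto
    have ce: "corner sq N c e b d" "S \<inter> F = tile sq e b d"
      using ip nn True S4 by (auto simp: corner_def tile_def e_def algebra_simps inner_commute)
    have ae: "a \<bullet> e = 2 * c - N" "a + e = b + d" using ip nn by (auto simp: e_def algebra_simps inner_commute)
    have "b \<noteq> d" "a \<noteq> e" using ip(3) ae nn c_less by auto
    define R where "R x y \<longleftrightarrow> sq \<and> x \<bullet> y = 2 * c - N \<and> x + y \<noteq> 0 \<and>
      (\<exists>r\<in>S. \<exists>s\<in>S. x + y = r + s \<and> r \<noteq> s \<and> S \<inter> F = {x, y, r, s})" for x y
    have Rs: "R y x" if "R x y" for x y
      using that unfolding R_def by (simp add: inner_commute add.commute insert_commute)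
    have in': "a \<in> S" "b \<in> S" "d \<in> S" "e \<in> S" using S4 by auto
    have "R a e"
      unfolding R_def using True ae ip(4) in' \<open>b \<noteq> d\<close> S4
      by (intro conjI bexI[of _ b] bexI[of _ d]) auto
    moreover have "R b d"
      unfolding R_def using True ae ip(3,4) in' \<open>a \<noteq> e\<close> S4
      by (intro conjI bexI[of _ a] bexI[of _ e]) auto
    moreover have "Q p q \<or> {p, q} = {a, e} \<or> {p, q} = {b, d}"
      using assms(2-4) E[OF *] E[OF ce] unfolding S4 by auto
    ultimately have "Q p q \<or> R p q"
      unfolding doubleton_eq_iff using Rs by blast
    then show ?thesis using Qc unfolding Q_def R_def by blast
  qed
qed

lemma adjacent_not_collinear:
  assumes "p \<in> S" "q \<in> S" "p \<bullet> q = c" shows "\<not> collinear {0, p, q}"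
proof
  assume "collinear {0, p, q}"
  moreover have "p \<noteq> 0" "q \<noteq> 0" using norm[OF assms(1)] norm[OF assms(2)] c_less c_greater by auto
  ultimately obtain k where "q = k *\<^sub>R p" using collinear_lemma by metis
  then have k: "k * (k * N) = N" "k * N = c" using norm[OF assms(1)] norm[OF assms(2)] assms(3) by auto
  have "c * c = (k * (k * N)) * N" by (simp add: k(2)[symmetric])
  then have "c * c = N * N" unfolding k(1) .
  then have "c = N \<or> c = - N" by (simp add: square_eq_iff)
  then show False using c_less c_greater by auto
qed

text \<open>The third vertex of a face at the edge \<open>p q\<close> has prescribed norm and inner products with \<open>p\<close> and \<open>q\<close>,
  which leaves only two positions; and it determines the face.\<close>

lemma two_facets_at_edge:
  assumes "F facet_of P" "G facet_of P" "H facet_of P" "{p, q} \<subseteq> S \<inter> (F \<inter> G \<inter> H)" "p \<bullet> q = c"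
  shows "F = G \<or> F = H \<or> G = H"
proof -
  have pq: "p \<in> S" "q \<in> S" using assms by auto
  have "p \<noteq> q" using norm[OF pq(1)] assms(5) c_less by auto
  then have ex: "\<exists>r. corner sq N c p q r \<and> S \<inter> X = tile sq p q r" if "X facet_of P" "{p, q} \<subseteq> S \<inter> X" for X
    using pair_in_facet[OF that(1), of p q] that(2) assms(5) c_less by auto
  have sub: "{p, q} \<subseteq> S \<inter> F" "{p, q} \<subseteq> S \<inter> G" "{p, q} \<subseteq> S \<inter> H" using assms(4) by auto
  obtain r s t where *: "corner sq N c p q r" "S \<inter> F = tile sq p q r" "corner sq N c p q s"
     "S \<inter> G = tile sq p q s" "corner sq N c p q t" "S \<inter> H = tile sq p q t"
    using ex[OF assms(1) sub(1)] ex[OF assms(2) sub(2)] ex[OF assms(3) sub(3)] by blast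
  have "r \<in> S" "s \<in> S" "t \<in> S"
    using corner_in[OF *(2)] corner_in[OF *(4)] corner_in[OF *(6)] by simp_all
  note nn = this[THEN norm]
  have "r = s \<or> r = t \<or> s = t"
    by (rule two_points_on_sphere[OF nn _ _ _ _ _ _ adjacent_not_collinear[OF pq assms(5)]])
      (use *(1,3,5) in \<open>simp_all only: corner_def\<close>)
  then show ?thesis
  proof (elim disjE)
    assume "r = s" then show ?thesis using facet_eqI[OF assms(1,2)] * by auto
  next
    assume "r = t" then show ?thesis using facet_eqI[OF assms(1,3)] * by auto
  next
    assume "s = t" then show ?thesis using facet_eqI[OF assms(2,3)] * by auto
  qed
qed

lemma adjacent_sum:
  assumes "p \<in> S" "q \<in> S" "p \<bullet> q = c"
  shows "(p + q) \<bullet> (p + q) = 2 * (N + c)" "p + q \<noteq> 0"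
proof -
  show "(p + q) \<bullet> (p + q) = 2 * (N + c)"
    using assms norm by (simp add: algebra_simps inner_commute)
  then show "p + q \<noteq> 0" using c_greater by auto
qed

lemma half_turn_swaps:
  assumes "p \<in> S" "q \<in> S" "p \<bullet> q = c" shows "half_turn (p + q) p = q" "half_turn (p + q) q = p"
proof -
  have "2 * (p \<bullet> (p + q)) / ((p + q) \<bullet> (p + q)) = 1" "2 * (q \<bullet> (p + q)) / ((p + q) \<bullet> (p + q)) = 1"
    unfolding adjacent_sum[OF assms] using assms norm c_greater by (auto simp: inner_add_right inner_commute)
  then show "half_turn (p + q) p = q" "half_turn (p + q) q = p" by (simp_all add: half_turn_def)
qed

text \<open>Directions of edge midpoints and of centres of square faces.\<close>

definition turn_axis :: "real^3 \<Rightarrow> bool" where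
  "turn_axis m \<longleftrightarrow> (\<exists>p\<in>S. \<exists>q\<in>S. (p \<bullet> q = c \<or> sq \<and> p \<bullet> q = 2 * c - N \<and> p + q \<noteq> 0) \<and> m = p + q)"

lemma turn_axis_symmetry:
  assumes "turn_axis m"
  shows "half_turn m ` S = S" "half_turn m ` P = P" "F facet_of P \<Longrightarrow> half_turn m ` F facet_of P"
    "v \<in> S \<Longrightarrow> half_turn m v \<noteq> v"
proof -
  have *: "half_turn m v \<in> S - {v}" if "v \<in> S" for v using assms turn that unfolding turn_axis_def by auto
  then show "v \<in> S \<Longrightarrow> half_turn m v \<noteq> v" by auto
  show 1: "half_turn m ` S = S"
  proof
    show "half_turn m ` S \<subseteq> S" using * by auto
    then have "half_turn m ` half_turn m ` S \<subseteq> half_turn m ` S" by (rule image_mono)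
    then show "S \<subseteq> half_turn m ` S" by (simp add: image_image)
  qed
  then show 2: "half_turn m ` P = P"
    using convex_hull_linear_image[OF linear_half_turn] by metis
  show "half_turn m ` F facet_of P" if "F facet_of P"
    using similarity_facet[OF similarity_half_turn that, of m] by (simp only: 2)
qed

lemma half_turn_vertices:
  assumes "turn_axis m" shows "S \<inter> half_turn m ` F = half_turn m ` (S \<inter> F)"
proof -
  have "inj (half_turn m)" by (metis half_turn_half_turn injI)
  then show ?thesis using turn_axis_symmetry(1)[OF assms] by (simp add: image_Int)
qed

text \<open>The half-turn about the midpoint of an edge carries a face at that edge to the other one. If it
  preserved the face, it would fix the third vertex of a triangle, which \<open>turn\<close> forbids, or it
  would exchange the other two vertices of a square, whose midpoint would then be on the axis;
  comparing norms, this happens only if the centre of the square is \<open>0\<close>.\<close>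

lemma opposite_facet:
  assumes F: "F facet_of P" and cor: "corner sq N c p q r" "S \<inter> F = tile sq p q r"
  defines "h \<equiv> half_turn (p + q)"
  shows "h ` F facet_of P" "h ` F \<noteq> F" "S \<inter> h ` F = tile sq q p (h r)" "corner sq N c q p (h r)" "turn_axis (p + q)"
proof -
  note pqr = corner_in[OF cor(2)]
  then have pq: "p \<in> S" "q \<in> S" "r \<in> S" by auto
  have ip: "p \<bullet> q = c" "p \<bullet> r = c" "q \<bullet> r = (if sq then 2 * c - N else c)" using cor(1) by (auto simp: corner_def)
  show ax: "turn_axis (p + q)" using pq ip unfolding turn_axis_def by blast
  show "h ` F facet_of P" unfolding h_def by (rule turn_axis_symmetry(3)[OF ax F])
  note sw = half_turn_swaps[OF pq(1,2) ip(1), folded h_def]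
  have lin: "linear h" unfolding h_def by (rule linear_half_turn)
  have inn: "h x \<bullet> h y = x \<bullet> y" for x y unfolding h_def by (rule half_turn_inner)
  have Sh: "S \<inter> h ` F = h ` (S \<inter> F)" unfolding h_def by (rule half_turn_vertices[OF ax])
  then show "S \<inter> h ` F = tile sq q p (h r)"
    unfolding cor(2) by (auto simp: tile_def sw linear_add[OF lin] linear_diff[OF lin])
  have "p + h r \<noteq> 0" if "q + r \<noteq> 0"
  proof
    assume "p + h r = 0"
    then have "h (q + r) = 0" by (simp add: linear_add[OF lin] sw)
    then have "h (h (q + r)) = 0" using linear_0[OF lin] by simp
    then show False using that by (simp add: h_def)
  qed
  then show "corner sq N c q p (h r)"
    using cor(1) inn[of p r] inn[of q r] by (auto simp: corner_def sw inner_commute)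
  show "h ` F \<noteq> F"
  proof
    assume eq: "h ` F = F"
    have hr: "h r \<in> tile sq p q r" using Sh pqr unfolding eq cor(2) by auto
    have "h r \<noteq> r" unfolding h_def by (rule turn_axis_symmetry(4)[OF ax pq(3)])
    have pn: "p \<noteq> r" "q \<noteq> r" using ip norm[OF pq(1)] norm[OF pq(2)] c_less by (auto split: if_splits)
    have hh: "h (h r) = r" by (simp add: h_def)
    have "h r \<noteq> p" "h r \<noteq> q" using pn sw hh by auto
    with hr \<open>h r \<noteq> r\<close> have sq and "h r = q + r - p" by (auto simp: tile_def split: if_splits)
    then have e: "q + 2 *\<^sub>R r - p = (2 * (r \<bullet> (p + q)) / ((p + q) \<bullet> (p + q))) *\<^sub>R (p + q)"
      by (simp add: h_def half_turn_def algebra_simps scaleR_2)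
    define l where "l = (3 * c - N) / (N + c)"
    have "2 * (r \<bullet> (p + q)) / ((p + q) \<bullet> (p + q)) = l"
    proof -
      have "r \<bullet> (p + q) = 3 * c - N" using ip \<open>sq\<close> by (simp add: inner_add_right inner_commute)
      then show ?thesis
        unfolding adjacent_sum(1)[OF pq(1,2) ip(1)] l_def by (simp only: mult_divide_mult_cancel_left_if) simp
    qed
    with e have "(q + 2 *\<^sub>R r - p) \<bullet> r = (l *\<^sub>R (p + q)) \<bullet> r" by simp
    then have "c + N = l * (3 * c - N)"
      using ip \<open>sq\<close> norm[OF pq(3)] by (simp add: inner_add_left inner_diff_left)
    then have "(c + N) * (N + c) = (3 * c - N) * (3 * c - N)"
      using c_greater by (simp add: l_def field_simps)
    then have "8 * (c * (c - N)) = 0" by algebra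
    then have "c = 0" using c_less by auto
    then have "(q + r) \<bullet> (q + r) = 0"
      using ip \<open>sq\<close> norm[OF pq(2)] norm[OF pq(3)] by (simp add: inner_add_left inner_add_right inner_commute)
    then show False using cor(1) \<open>sq\<close> by (simp add: corner_def)
  qed
qed

text \<open>Two faces that share an edge. A common point that is not a vertex is the form in which
  adjacency arises along a geodesic.\<close>

definition hinged :: "(real^3) set \<Rightarrow> (real^3) set \<Rightarrow> bool" where
  "hinged F H \<longleftrightarrow> F facet_of P \<and> H facet_of P \<and> F \<noteq> H \<and> (\<exists>x\<in>F \<inter> H. x \<notin> S)"

text \<open>For hinged faces the sum has two terms, so this is the midpoint of the common edge.\<close>

definition mid :: "(real^3) set \<Rightarrow> (real^3) set \<Rightarrow> real^3" where
  "mid F H = (1/2) *\<^sub>R \<Sum>(S \<inter> (F \<inter> H))"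

lemma hinged_sym: "hinged F H \<Longrightarrow> hinged H F" unfolding hinged_def by blast

lemma mid_sym: "mid F H = mid H F" unfolding mid_def by (simp add: Int_commute)

text \<open>The intersection is a face of the solid, hence spanned by the common vertices. Opposite vertices
  \<open>a\<close>, \<open>b\<close> of a square are never shared: their midpoint is also the midpoint of the other diagonal
  \<open>r s\<close>, and a face containing an interior point of that diagonal contains \<open>r\<close> and \<open>s\<close> too. So all
  common vertices are pairwise adjacent, and there are exactly two of them.\<close>

lemma hinged_edge:
  assumes "hinged F H"
  obtains p q r where "S \<inter> (F \<inter> H) = {p, q}" "p \<bullet> q = c" "corner sq N c p q r" "S \<inter> F = tile sq p q r"
    "F \<inter> H = convex hull {p, q}"
proof -
  have F: "F facet_of P" and H: "H facet_of P" and "F \<noteq> H" using assms by (auto simp: hinged_def)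
  obtain x where x: "x \<in> F" "x \<in> H" "x \<notin> S" using assms by (auto simp: hinged_def)
  define T where "T = S \<inter> (F \<inter> H)"
  have FH: "F \<inter> H face_of P" using facet_face[OF F] facet_face[OF H] by (rule face_of_Int)
  have hull: "F \<inter> H = convex hull T" unfolding T_def by (rule face_eq_hull[OF FH])
  have notsub: "\<not> S \<inter> F \<subseteq> H" using facet_eqI[OF F H] \<open>F \<noteq> H\<close> by blast
  have TS: "T \<subseteq> S" by (auto simp: T_def)
  have adj: "a \<bullet> b = c" if ab: "a \<in> T" "b \<in> T" "a \<noteq> b" for a b
  proof (rule ccontr)
    assume "a \<bullet> b \<noteq> c"
    then obtain r s where rs: "r \<in> S" "s \<in> S" "a + b = r + s" "r \<noteq> s" "S \<inter> F = {a, b, r, s}"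
      using pair_in_facet[OF F, of a b] ab unfolding T_def by auto
    have "(1/2) *\<^sub>R (a + b) \<in> F \<inter> H"
    proof -
      have "midpoint a b \<in> closed_segment a b" by simp
      also have "closed_segment a b \<subseteq> F \<inter> H"
        using ab face_of_imp_convex[OF FH] by (intro closed_segment_subset) (auto simp: T_def)
      finally show ?thesis by (simp add: midpoint_def)
    qed
    then have "midpoint r s \<in> F \<inter> H" using rs(3) by (simp add: midpoint_def)
    moreover have "midpoint r s \<in> open_segment r s" using rs(4) by simp
    ultimately have "r \<in> H" "s \<in> H"
      using face_ofD[OF FH, of "midpoint r s" r s] hull_inc[OF rs(1)] hull_inc[OF rs(2)] by auto
    then have "S \<inter> F \<subseteq> H" using rs(5) ab by (auto simp: T_def)
    then show False using notsub by simp
  qed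
  have xT: "x \<in> convex hull T" using hull x by blast
  then have "T \<noteq> {}" by auto
  then obtain p where p: "p \<in> T" by blast
  have "T \<noteq> {p}"
  proof
    assume "T = {p}"
    then have "x = p" using xT by simp
    then show False using x(3) p TS by blast
  qed
  then obtain q where q: "q \<in> T" "p \<noteq> q" using p by blast
  have pq: "p \<bullet> q = c" by (rule adj[OF p q])
  obtain r where r: "corner sq N c p q r" "S \<inter> F = tile sq p q r"
    using pair_in_facet[OF F, of p q] p q pq c_less unfolding T_def by auto
  have nn: "p \<bullet> p = N" "q \<bullet> q = N" "r \<bullet> r = N" using corner_in[OF r(2)] norm by auto
  have "y \<in> {p, q}" if "y \<in> T" for y
  proof (rule ccontr)
    assume y: "y \<notin> {p, q}"
    have yT: "y \<in> tile sq p q r" using that r(2) by (auto simp: T_def)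
    show False
    proof (cases sq)
      case False
      then have "y = r" using y yT by (auto simp: tile_def)
      then have "S \<inter> F \<subseteq> H" using that p q r(2) False by (auto simp: T_def tile_def)
      then show False using notsub by simp
    next
      case True
      then have "y = r \<or> y = q + r - p" using y yT by (auto simp: tile_def)
      moreover have "r \<bullet> q = 2 * c - N" "(q + r - p) \<bullet> p = 2 * c - N"
        using r(1) True nn by (simp_all add: corner_def inner_commute inner_add_right inner_diff_right)
      ultimately have "y \<bullet> q = 2 * c - N \<or> y \<bullet> p = 2 * c - N" by blast
      moreover have "y \<bullet> q = c" "y \<bullet> p = c" using adj that p q y by auto
      ultimately show False using c_less by auto
    qed
  qed
  then have "T = {p, q}" using p q by auto
  then show thesis using that r pq hull unfolding T_def by metis
qed

text \<open>Adjacent vertices have the largest possible inner product, so \<open>p + q\<close> attains its maximum over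
  the solid on the edge \<open>p q\<close>.\<close>

lemma edge_support:
  assumes "p \<in> S" "q \<in> S" "p \<bullet> q = c" "y \<in> P"
  shows "y \<bullet> (p + q) \<le> N + c"
proof -
  have "v \<bullet> (p + q) \<le> N + c" if "v \<in> S" for v
    using inner_le[OF that assms(1)] inner_le[OF that assms(2)] norm[OF assms(1)] norm[OF assms(2)] assms(3) c_less
    by (cases "v = p"; cases "v = q") (auto simp: inner_add_right inner_commute)
  then have "S \<subseteq> {y. (p + q) \<bullet> y \<le> N + c}" by (auto simp: inner_commute[of "p + q"])
  then have "P \<subseteq> {y. (p + q) \<bullet> y \<le> N + c}" by (intro hull_minimal) (auto simp: convex_halfspace_le)
  then show ?thesis using assms(4) by (auto simp: inner_commute)
qed

text \<open>The properties of an edge midpoint on which the rest relies: the plane orthogonal to it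
  supports the solid along the edge, and the half-turn about it exchanges the two faces.\<close>

lemma hinged_mid:
  assumes "hinged F H"
  shows "mid F H \<noteq> 0" "y \<in> P \<Longrightarrow> y \<bullet> mid F H \<le> mid F H \<bullet> mid F H"
    "y \<in> F \<inter> H \<Longrightarrow> y \<bullet> mid F H = mid F H \<bullet> mid F H"
    "half_turn (mid F H) ` F = H"
    "half_turn (mid F H) ` P = P"
    "\<And>v. v \<in> S \<Longrightarrow> half_turn (mid F H) v \<noteq> v"
proof -
  obtain p q r where *: "S \<inter> (F \<inter> H) = {p, q}" "p \<bullet> q = c" "corner sq N c p q r" "S \<inter> F = tile sq p q r"
    "F \<inter> H = convex hull {p, q}" using hinged_edge[OF assms] by metis
  have F: "F facet_of P" and H: "H facet_of P" and "F \<noteq> H" using assms by (auto simp: hinged_def)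
  have pq: "p \<in> S" "q \<in> S" "p \<in> F" "q \<in> F" "p \<in> H" "q \<in> H" using *(1) by auto
  have "p \<noteq> q" using norm[OF pq(1)] *(2) c_less by auto
  then have m: "mid F H = (1/2) *\<^sub>R (p + q)" by (simp add: mid_def *(1))
  note s = adjacent_sum[OF pq(1,2) *(2)]
  have mm: "mid F H \<bullet> mid F H = (1/2) * (N + c)" using s(1) by (simp add: m)
  show "mid F H \<noteq> 0" using m s by simp
  show "y \<bullet> mid F H \<le> mid F H \<bullet> mid F H" if "y \<in> P"
    unfolding mm using edge_support[OF pq(1,2) *(2) that] by (simp add: m inner_scaleR_right)
  have ht: "half_turn (mid F H) = half_turn (p + q)" unfolding m by (rule half_turn_scale) simp
  note op = opposite_facet[OF F *(3,4)]
  show "half_turn (mid F H) ` P = P" "\<And>v. v \<in> S \<Longrightarrow> half_turn (mid F H) v \<noteq> v"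
    unfolding ht using turn_axis_symmetry[OF op(5)] by auto
  have "{p, q} \<subseteq> S \<inter> half_turn (p + q) ` F" unfolding op(3) by (auto simp: tile_def)
  then have "{p, q} \<subseteq> S \<inter> (F \<inter> H \<inter> half_turn (p + q) ` F)" using pq by auto
  have "H = half_turn (p + q) ` F"
    using two_facets_at_edge[OF F H op(1) \<open>{p, q} \<subseteq> S \<inter> (F \<inter> H \<inter> half_turn (p + q) ` F)\<close> *(2)] \<open>F \<noteq> H\<close> op(2) by metis
  then show "half_turn (mid F H) ` F = H" unfolding ht by auto
  show "y \<bullet> mid F H = mid F H \<bullet> mid F H" if "y \<in> F \<inter> H"
  proof -
    have "convex hull {p, q} \<subseteq> {y. (p + q) \<bullet> y = N + c}"
      using norm[OF pq(1)] norm[OF pq(2)] *(2)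
      by (intro hull_minimal convex_hyperplane) (auto simp: inner_add_left inner_commute[of q p])
    then have "(p + q) \<bullet> y = N + c" using that *(5) by auto
    then show ?thesis unfolding mm by (simp add: m inner_commute)
  qed
qed

text \<open>A face containing a point of an edge other than its ends contains the whole edge, and only two faces
  contain an edge. So at most two faces meet at a point that is not a vertex.\<close>

lemma third_facet:
  assumes "hinged F H" "hinged F G" "x \<in> F \<inter> G \<inter> H" "x \<notin> S" shows "G = H"
proof (rule ccontr)
  assume "G \<noteq> H"
  have F: "F facet_of P" "G facet_of P" "H facet_of P" "F \<noteq> G" "F \<noteq> H" using assms by (auto simp: hinged_def)
  obtain p q r where *: "S \<inter> (F \<inter> H) = {p, q}" "p \<bullet> q = c" "F \<inter> H = convex hull {p, q}"
    using hinged_edge[OF assms(1)] by metis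
  have "F \<inter> H face_of P" "G face_of P" using facet_face[OF F(1)] facet_face[OF F(2)] facet_face[OF F(3)] by (auto intro: face_of_Int)
  then have "F \<inter> H \<inter> G face_of P" by (rule face_of_Int)
  then have "F \<inter> H \<inter> G = convex hull (S \<inter> (F \<inter> H \<inter> G))" by (rule face_eq_hull)
  moreover have sub: "S \<inter> (F \<inter> H \<inter> G) \<subseteq> {p, q}" using *(1) by auto
  moreover have "x \<in> F \<inter> H \<inter> G" using assms by auto
  ultimately have x: "x \<in> convex hull (S \<inter> (F \<inter> H \<inter> G))" by simp
  have "S \<inter> (F \<inter> H \<inter> G) = {p, q}"
  proof (rule ccontr)
    assume "S \<inter> (F \<inter> H \<inter> G) \<noteq> {p, q}"
    then consider "S \<inter> (F \<inter> H \<inter> G) = {}" | "S \<inter> (F \<inter> H \<inter> G) = {p}" | "S \<inter> (F \<inter> H \<inter> G) = {q}"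
      using sub by blast
    then show False using x assms(4) *(1) by cases auto
  qed
  then have "{p, q} \<subseteq> S \<inter> (F \<inter> G \<inter> H)" by auto
  from two_facets_at_edge[OF F(1-3) this *(2)] F \<open>G \<noteq> H\<close> show False by auto
qed

abbreviation hinge_mirror :: "(real^3) set \<Rightarrow> (real^3) set \<Rightarrow> real^3 \<Rightarrow> real^3" where
  "hinge_mirror F H \<equiv> mirror (mid F H)"

text \<open>The solid lies on one side of the mirror plane, so a point and its mirror image can both belong
  to it only if they coincide.\<close>

lemma hinge_mirror_fixes:
  assumes "hinged F H" "y \<in> F" "hinge_mirror F H y \<in> H" shows "hinge_mirror F H y = y"
proof -
  have "y \<in> P" "hinge_mirror F H y \<in> P" using assms facet_of_imp_subset unfolding hinged_def by blast+
  from this[THEN hinged_mid(2)[OF assms(1)]] have "y \<bullet> mid F H = mid F H \<bullet> mid F H"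
    unfolding mirror_inner_axis by linarith
  then show ?thesis using mirror_fixes_iff hinged_mid(1)[OF assms(1)] by blast
qed

lemma hinge_mirror_edge: "hinged F H \<Longrightarrow> y \<in> F \<inter> H \<Longrightarrow> hinge_mirror F H y = y"
  by (simp only: mirror_fixes_iff[OF hinged_mid(1)] hinged_mid(3))

text \<open>Since \<open>2 *\<^sub>R mid F H = p + q\<close> for the ends of the common edge, the mirror image of a vertex \<open>v\<close> of \<open>F\<close> is
  \<open>p + q - v'\<close>, where \<open>v'\<close> is the vertex of \<open>H\<close> to which the half-turn sends \<open>v\<close>. Hence unfolding carries
  the lattice of a face to that of its neighbour: the tiling of the plane continues over the edge.\<close>

lemma hinge_mirror_lattice:
  assumes "hinged F H" "y \<in> lattice (S \<inter> F)" shows "hinge_mirror F H y \<in> lattice (S \<inter> H)"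
  using assms(2)
proof induction
  case (parallelogram a b d)
  then show ?case unfolding mirror_comb by (intro lattice.parallelogram)
next
  case (vertex v)
  obtain p q r where *: "S \<inter> (F \<inter> H) = {p, q}" "p \<bullet> q = c" "corner sq N c p q r"
    using hinged_edge[OF assms(1)] by metis
  have pq: "p \<in> S \<inter> H" "q \<in> S \<inter> H" using *(1) by auto
  have "p \<noteq> q" using norm[of p] pq *(2) c_less by auto
  then have m: "mid F H = (1/2) *\<^sub>R (p + q)" by (simp add: mid_def *(1))
  have ax: "turn_axis (p + q)" using pq *(2) unfolding turn_axis_def by blast
  have ht: "half_turn (mid F H) = half_turn (p + q)" unfolding m by (rule half_turn_scale) simp
  have "half_turn (mid F H) v \<in> S \<inter> H"
  proof -
    have "half_turn (p + q) v \<in> half_turn (p + q) ` S" "half_turn (p + q) v \<in> half_turn (p + q) ` F"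
      using vertex by auto
    then show ?thesis using hinged_mid(4)[OF assms(1)] turn_axis_symmetry(1)[OF ax] unfolding ht by simp
  qed
  then have "p + q - half_turn (mid F H) v \<in> lattice (S \<inter> H)"
    using pq by (intro lattice.intros)
  then show ?case by (simp add: mirror_def m)
qed

lemma corner_gram:
  assumes "corner sq N c p q r" "p \<in> S" "q \<in> S" "r \<in> S"
  shows "(q - p) \<bullet> (q - p) = 2 * (N - c)" "(r - p) \<bullet> (r - p) = 2 * (N - c)"
    "(r - p) \<bullet> (q - p) = (if sq then 0 else N - c)"
    "((q - p) \<bullet> (q - p)) * ((r - p) \<bullet> (r - p)) \<noteq> ((q - p) \<bullet> (r - p))^2"
proof -
  have ip: "p \<bullet> q = c" "p \<bullet> r = c" "q \<bullet> r = (if sq then 2 * c - N else c)"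
    "q \<bullet> p = c" "r \<bullet> p = c" "r \<bullet> q = (if sq then 2 * c - N else c)"
    using assms(1) by (simp_all add: corner_def inner_commute)
  note nn = norm[OF assms(2)] norm[OF assms(3)] norm[OF assms(4)]
  show g: "(q - p) \<bullet> (q - p) = 2 * (N - c)" "(r - p) \<bullet> (r - p) = 2 * (N - c)"
    "(r - p) \<bullet> (q - p) = (if sq then 0 else N - c)"
    using ip nn by (simp_all add: inner_diff_left inner_diff_right)
  have "2 * (N - c) * (2 * (N - c)) > (if sq then 0 else N - c)^2"
  proof -
    define t where "t = N - c"
    have "0 < t * t" using c_less by (simp add: t_def)
    then have "(if sq then 0 else t)^2 < 2 * t * (2 * t)" by (simp add: power2_eq_square)
    then show ?thesis unfolding t_def .
  qed
  then show "((q - p) \<bullet> (q - p)) * ((r - p) \<bullet> (r - p)) \<noteq> ((q - p) \<bullet> (r - p))^2"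
    unfolding inner_commute[of "q - p" "r - p"] g by linarith
qed

lemma facet_coordinates:
  assumes F: "F facet_of P" and t: "S \<inter> F = tile sq p q r" and x: "x \<in> F"
  obtains i j where "x = p + i *\<^sub>R (q - p) + j *\<^sub>R (r - p)" "0 \<le> i" "0 \<le> j"
    "if sq then i \<le> 1 \<and> j \<le> 1 else i + j \<le> 1"
proof -
  define K where "K = {x. \<exists>i j. x = p + i *\<^sub>R (q - p) + j *\<^sub>R (r - p) \<and> 0 \<le> i \<and> 0 \<le> j \<and>
      (if sq then i \<le> 1 \<and> j \<le> 1 else i + j \<le> 1)}"
  have "convex K"
  proof (rule convexI)
    fix x y and a b :: real
    assume "x \<in> K" "y \<in> K" and ab: "0 \<le> a" "0 \<le> b" "a + b = 1"
    then obtain i j k l where x: "x = p + i *\<^sub>R (q - p) + j *\<^sub>R (r - p)" "0 \<le> i" "0 \<le> j"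
        "if sq then i \<le> 1 \<and> j \<le> 1 else i + j \<le> 1"
      and y: "y = p + k *\<^sub>R (q - p) + l *\<^sub>R (r - p)" "0 \<le> k" "0 \<le> l"
        "if sq then k \<le> 1 \<and> l \<le> 1 else k + l \<le> 1"
      unfolding K_def by blast
    have "a *\<^sub>R x + b *\<^sub>R y = (a + b) *\<^sub>R p + (a * i + b * k) *\<^sub>R (q - p) + (a * j + b * l) *\<^sub>R (r - p)"
      unfolding x(1) y(1) by (simp add: scaleR_add_left scaleR_add_right)
    moreover have "if sq then a * i + b * k \<le> 1 \<and> a * j + b * l \<le> 1
        else (a * i + b * k) + (a * j + b * l) \<le> 1"
    proof (cases sq)
      case True
      then show ?thesis
        using x(4) y(4) convex_bound_le[OF _ _ ab] by simp
    next
      case False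
      then have "a * (i + j) + b * (k + l) \<le> 1"
        using x(4) y(4) convex_bound_le[OF _ _ ab] by simp
      then show ?thesis using False by (simp add: distrib_left)
    qed
    ultimately show "a *\<^sub>R x + b *\<^sub>R y \<in> K"
      unfolding K_def using ab x(2,3) y(2,3) by (intro CollectI exI[of _ "a * i + b * k"] exI[of _ "a * j + b * l"]) simp
  qed
  moreover have in_K: "p + i *\<^sub>R (q - p) + j *\<^sub>R (r - p) \<in> K"
    if "0 \<le> i" "0 \<le> j" "if sq then i \<le> 1 \<and> j \<le> 1 else i + j \<le> 1" for i j
    unfolding K_def using that by blast
  have "tile sq p q r \<subseteq> K"
    using in_K[of 0 0] in_K[of 1 0] in_K[of 0 1] in_K[of 1 1] by (auto simp: tile_def algebra_simps split: if_splits)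
  ultimately have "convex hull (S \<inter> F) \<subseteq> K" unfolding t by (intro hull_minimal)
  then have "x \<in> K" using x face_eq_hull[OF facet_face[OF F]] by auto
  then show thesis using that unfolding K_def by blast
qed

lemma lattice_coordinates:
  assumes "y \<in> lattice (tile sq p q r)"
  shows "\<exists>i j. y = p + of_int i *\<^sub>R (q - p) + of_int j *\<^sub>R (r - p)"
  using assms
proof induction
  case (vertex v)
  have "p = p + of_int 0 *\<^sub>R (q - p) + of_int 0 *\<^sub>R (r - p)" "q = p + of_int 1 *\<^sub>R (q - p) + of_int 0 *\<^sub>R (r - p)"
    "r = p + of_int 0 *\<^sub>R (q - p) + of_int 1 *\<^sub>R (r - p)"
    "q + r - p = p + of_int 1 *\<^sub>R (q - p) + of_int 1 *\<^sub>R (r - p)" by simp_all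
  moreover have "v \<in> {p, q, r, q + r - p}" using vertex by (auto simp: tile_def split: if_splits)
  ultimately show ?case by blast
next
  case (parallelogram a b d)
  then obtain i j k l m n where
    "a = p + of_int i *\<^sub>R (q - p) + of_int j *\<^sub>R (r - p)"
    "b = p + of_int k *\<^sub>R (q - p) + of_int l *\<^sub>R (r - p)"
    "d = p + of_int m *\<^sub>R (q - p) + of_int n *\<^sub>R (r - p)" by blast
  then have "a + b - d = p + of_int (i + k - m) *\<^sub>R (q - p) + of_int (j + l - n) *\<^sub>R (r - p)"
    by (simp add: scaleR_add_left scaleR_diff_left)
  then show ?case by blast
qed

text \<open>In the coordinates of a corner, half a lattice point has half-integral coordinates, and a tile
  contains only few of those. Each of them is the midpoint of two vertices of the tile.\<close>

lemma half_lattice_point: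
  assumes F: "F facet_of P" and yz: "y \<in> lattice (S \<inter> F)" "z \<in> lattice (S \<inter> F)"
    and x: "x = (1/2) *\<^sub>R (y + z)" "x \<in> F" "x \<notin> S"
  obtains a b where "a \<in> S \<inter> F" "b \<in> S \<inter> F" "x = (1/2) *\<^sub>R (a + b)" "a \<noteq> b"
proof -
  note finish = that
  obtain p q r where cor: "corner sq N c p q r" "S \<inter> F = tile sq p q r" using facet[OF F] by blast
  note cin = corner_in[OF cor(2)]
  obtain i j where ij: "y = p + of_int i *\<^sub>R (q - p) + of_int j *\<^sub>R (r - p)"
    using lattice_coordinates yz(1) unfolding cor(2) by blast
  obtain k l where kl: "z = p + of_int k *\<^sub>R (q - p) + of_int l *\<^sub>R (r - p)"
    using lattice_coordinates yz(2) unfolding cor(2) by blast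
  obtain \<alpha> \<beta> where ab: "x = p + \<alpha> *\<^sub>R (q - p) + \<beta> *\<^sub>R (r - p)" "0 \<le> \<alpha>" "0 \<le> \<beta>"
    "if sq then \<alpha> \<le> 1 \<and> \<beta> \<le> 1 else \<alpha> + \<beta> \<le> 1"
    using facet_coordinates[OF F cor(2) x(2)] by blast
  define m n where "m = i + k" and "n = j + l"
  have "y + z = 2 *\<^sub>R p + of_int m *\<^sub>R (q - p) + of_int n *\<^sub>R (r - p)"
    unfolding ij kl m_def n_def by (simp add: scaleR_add_left scaleR_2)
  then have xm: "x = p + (of_int m / 2) *\<^sub>R (q - p) + (of_int n / 2) *\<^sub>R (r - p)"
    unfolding x(1) by (simp add: scaleR_add_right)
  have "\<alpha> *\<^sub>R (q - p) + \<beta> *\<^sub>R (r - p) = (of_int m / 2) *\<^sub>R (q - p) + (of_int n / 2) *\<^sub>R (r - p)"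
    using ab(1) xm by simp
  from coordinates_unique[OF _ this] corner_gram(4)[OF cor(1)] cin
  have "\<alpha> = of_int m / 2" "\<beta> = of_int n / 2" by auto
  with ab have "0 \<le> m" "0 \<le> n" "if sq then m \<le> 2 \<and> n \<le> 2 else m + n \<le> 2"
    by (auto split: if_splits)
  then have mn: "m \<in> {0, 1, 2}" "n \<in> {0, 1, 2}" "\<not> sq \<Longrightarrow> m + n \<le> 2"
    by (auto split: if_splits)
  have two: "x = (1/2) *\<^sub>R (2 *\<^sub>R p + of_int m *\<^sub>R (q - p) + of_int n *\<^sub>R (r - p))"
    unfolding xm by (simp add: scaleR_add_right)
  have goal: thesis if "2 *\<^sub>R p + of_int m *\<^sub>R (q - p) + of_int n *\<^sub>R (r - p) = a + b"
    "a \<in> S \<inter> F" "b \<in> S \<inter> F" for a b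
  proof (cases "a = b")
    case True
    then have "x = a" using two that(1) by (simp flip: scaleR_2)
    then show thesis using x(3) that(2) by simp
  next
    case False
    moreover have "x = (1/2) *\<^sub>R (a + b)" using two that(1) by simp
    ultimately show thesis using finish that(2,3) by blast
  qed
  have sqin: "sq \<Longrightarrow> q + r - p \<in> S \<inter> F" "p \<in> S \<inter> F" "q \<in> S \<inter> F" "r \<in> S \<inter> F" using cin by auto
  consider "m = 0" "n = 0" | "m = 1" "n = 0" | "m = 2" "n = 0" | "m = 0" "n = 1" | "m = 0" "n = 2"
    | "m = 1" "n = 1" | "m = 2" "n = 1" "sq" | "m = 1" "n = 2" "sq" | "m = 2" "n = 2" "sq"
    using mn by fastforce
  then show thesis
  proof cases
    case 1 then show thesis using sqin by (intro goal[of p p]) (auto simp: scaleR_2)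
  next
    case 2 then show thesis using sqin by (intro goal[of p q]) (auto simp: scaleR_2)
  next
    case 3 then show thesis using sqin by (intro goal[of q q]) (auto simp: scaleR_2)
  next
    case 4 then show thesis using sqin by (intro goal[of p r]) (auto simp: scaleR_2)
  next
    case 5 then show thesis using sqin by (intro goal[of r r]) (auto simp: scaleR_2)
  next
    case 6 then show thesis using sqin by (intro goal[of q r]) (auto simp: scaleR_2)
  next
    case 7 then show thesis using sqin by (intro goal[of q "q + r - p"]) (auto simp: scaleR_2)
  next
    case 8 then show thesis using sqin by (intro goal[of r "q + r - p"]) (auto simp: scaleR_2)
  next
    case 9 then show thesis using sqin
      by (intro goal[of "q + r - p" "q + r - p"]) (auto simp: scaleR_2)
  qed
qed

text \<open>The midpoint of two vertices of a face is the midpoint of an edge, shared with the image of the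
  face under the half-turn about it, or the centre of a square; about the latter the half-turn acts
  on the face as a point reflection.\<close>

lemma center_symmetry:
  assumes F: "F facet_of P" and yz: "y \<in> lattice (S \<inter> F)" "z \<in> lattice (S \<inter> F)"
    and x: "x = (1/2) *\<^sub>R (y + z)" "x \<in> F" "x \<notin> S"
  obtains (edge) H where "hinged F H" "mid F H = x"
  | (face) m where "turn_axis m" "\<And>y. y \<in> F \<Longrightarrow> half_turn m y = 2 *\<^sub>R x - y"
proof -
  obtain a b where ab: "a \<in> S \<inter> F" "b \<in> S \<inter> F" "x = (1/2) *\<^sub>R (a + b)" "a \<noteq> b"
    using half_lattice_point[OF F yz x] by blast
  from pair_in_facet[OF F ab(1,2,4)] show thesis
  proof (elim disjE conjE exE)
    fix r assume c: "a \<bullet> b = c" "corner sq N c a b r" "S \<inter> F = tile sq a b r"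
    let ?H = "half_turn (a + b) ` F"
    note op = opposite_facet[OF F c(2,3)]
    have "a \<in> S \<inter> ?H" "b \<in> S \<inter> ?H" unfolding op(3) by (auto simp: tile_def)
    then have abH: "{a, b} \<subseteq> S \<inter> (F \<inter> ?H)" using ab by auto
    have "midpoint a b \<in> closed_segment a b" by simp
    also have "closed_segment a b \<subseteq> F \<inter> ?H"
      using abH face_of_imp_convex[OF facet_face[OF F]] face_of_imp_convex[OF facet_face[OF op(1)]]
      by (intro closed_segment_subset convex_Int) auto
    finally have "x \<in> F \<inter> ?H" by (simp add: midpoint_def ab(3))
    then have h: "hinged F ?H" unfolding hinged_def using F op(1,2) x(3) by blast
    obtain p q where pq: "S \<inter> (F \<inter> ?H) = {p, q}" using hinged_edge[OF h] by metis
    then have "S \<inter> (F \<inter> ?H) = {a, b}" using abH ab(4) by auto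
    then have "mid F ?H = x" using ab by (simp add: mid_def)
    then show thesis by (rule edge[OF h])
  next
    assume s: "sq" "a \<bullet> b = 2 * c - N" "a + b \<noteq> 0"
      and "\<exists>r\<in>S. \<exists>s\<in>S. a + b = r + s \<and> r \<noteq> s \<and> S \<inter> F = {a, b, r, s}"
    then obtain r s where rs: "r \<in> S" "s \<in> S" "a + b = r + s" "S \<inter> F = {a, b, r, s}" by blast
    have nn: "a \<bullet> a = N" "b \<bullet> b = N" "r \<bullet> r = N" "s \<bullet> s = N" using ab rs norm by auto
    have aa: "(a + b) \<bullet> (a + b) = 4 * c" using nn s(2) by (simp add: inner_add_left inner_add_right inner_commute)
    then have "(r + s) \<bullet> (r + s) = 4 * c" using rs(3) by simp
    then have "r \<bullet> s = 2 * c - N" using nn by (simp add: inner_add_left inner_add_right inner_commute)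
    then have "r \<bullet> (r + s) = 2 * c" "s \<bullet> (r + s) = 2 * c" "a \<bullet> (a + b) = 2 * c" "b \<bullet> (a + b) = 2 * c"
      using nn s(2) by (simp_all add: inner_add_right inner_commute)
    then have "S \<inter> F \<subseteq> {y. (a + b) \<bullet> y = 2 * c}"
      using rs(3,4) by (auto simp: inner_commute)
    then have "convex hull (S \<inter> F) \<subseteq> {y. (a + b) \<bullet> y = 2 * c}" by (intro hull_minimal convex_hyperplane)
    then have const: "(a + b) \<bullet> y = 2 * c" if "y \<in> F" for y
      using face_eq_hull[OF facet_face[OF F]] that by blast
    have c0: "c \<noteq> 0" using aa s(3) by auto
    have "half_turn (a + b) y = 2 *\<^sub>R x - y" if "y \<in> F" for y
    proof -
      have "2 * (y \<bullet> (a + b)) / ((a + b) \<bullet> (a + b)) = 2 * (2 * c) / (4 * c)"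
        unfolding aa inner_commute[of y] const[OF that] ..
      also have "\<dots> = 1" using c0 by simp
      finally have e: "2 * (y \<bullet> (a + b)) / ((a + b) \<bullet> (a + b)) = 1" .
      show ?thesis unfolding half_turn_def e ab(3) by simp
    qed
    moreover have "turn_axis (a + b)" using ab(1,2) s unfolding turn_axis_def by blast
    ultimately show thesis using face[of "a + b"] by simp
  qed
qed

text \<open>An isometry of a face into the plane has an affine inverse, so straightness in the plane
  means straightness in the face.\<close>

lemma unfold_facet:
  fixes D :: "real^3 \<Rightarrow> real^2"
  assumes F: "F facet_of P" and iso: "\<forall>x\<in>F. \<forall>y\<in>F. dist (D x) (D y) = dist x y"
  obtains k p d where "linear k" "\<forall>v. v \<noteq> 0 \<longrightarrow> k v \<noteq> 0" "\<forall>y\<in>F. p + k (D y - d) = y"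
proof -
  obtain p q r where cor: "corner sq N c p q r" "S \<inter> F = tile sq p q r" using facet[OF F] by blast
  note cin = corner_in[OF cor(2)]
  define u w where "u = q - p" and "w = r - p"
  have in': "p \<in> F" "p + u \<in> F" "p + w \<in> F" using cin by (auto simp: u_def w_def)
  note I = isometric_inner[OF iso _ _ in'(1)]
  let ?U = "D (p + u) - D p" and ?W = "D (p + w) - D p"
  have g: "?U \<bullet> ?U = u \<bullet> u" "?U \<bullet> ?W = u \<bullet> w" "?W \<bullet> ?W = w \<bullet> w"
    using I[OF in'(2,2)] I[OF in'(2,3)] I[OF in'(3,3)] by simp_all
  have ind: "(u \<bullet> u) * (w \<bullet> w) \<noteq> (u \<bullet> w)^2" using corner_gram(4)[OF cor(1)] cin by (simp add: u_def w_def)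
  obtain k where k: "linear k" "k ?U = u" "k ?W = w" "\<forall>v. v \<noteq> 0 \<longrightarrow> k v \<noteq> 0"
    "\<forall>v. \<exists>i j. v = i *\<^sub>R ?U + j *\<^sub>R ?W"
    by (rule plane_embedding[OF g ind]) (rule that)
  have "p + k (D y - D p) = y" if yF: "y \<in> F" for y
  proof -
    obtain i j where y: "y = p + i *\<^sub>R u + j *\<^sub>R w"
      using facet_coordinates[OF F cor(2) yF] unfolding u_def w_def by blast
    have "D y - D p = i *\<^sub>R ?U + j *\<^sub>R ?W"
      using isometric_affine_coordinates[OF iso in', of i j] yF unfolding y by simp
    then show ?thesis unfolding y by (simp add: k(2,3) linear_add[OF k(1)] linear_scale[OF k(1)])
  qed
  then show thesis using that[OF k(1,4), of p "D p"] by simp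
qed

text \<open>The same for two faces: the affine map that lays the plane back onto \<open>F\<close> lays the image of \<open>H\<close> onto
  its mirror image. So every unfolding \<open>D\<close> may be replaced by the reflection.\<close>

lemma unfold_hinged:
  fixes D :: "real^3 \<Rightarrow> real^2"
  assumes FH: "hinged F H" and D: "unfolding_map F H D"
  obtains k p d where "linear k" "\<forall>v. v \<noteq> 0 \<longrightarrow> k v \<noteq> 0" "\<forall>y\<in>F. p + k (D y - d) = y"
    "\<forall>y\<in>H. p + k (D y - d) = hinge_mirror F H y"
proof -
  obtain p q r where e: "S \<inter> (F \<inter> H) = {p, q}" "p \<bullet> q = c" "corner sq N c p q r" "S \<inter> F = tile sq p q r"
    using hinged_edge[OF FH] by metis
  have F: "F facet_of P" using FH by (simp add: hinged_def)
  note cin = corner_in[OF e(4)]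
  have pqr: "p \<in> S" "q \<in> S" "r \<in> S" "p \<in> H" "q \<in> H" "p \<in> F" "q \<in> F" "r \<in> F" using e(1) cin by auto
  have ip: "p \<bullet> r = c" "q \<bullet> r = (if sq then 2 * c - N else c)" using e(3) by (auto simp: corner_def)
  have ne: "p \<noteq> q" "p \<noteq> r" "q \<noteq> r"
    using e(2) ip norm[OF pqr(1)] norm[OF pqr(2)] c_less by (auto split: if_splits)
  then have m: "mid F H = (1/2) *\<^sub>R (p + q)" by (simp add: mid_def e(1))
  have ax: "turn_axis (p + q)" using pqr e(2) unfolding turn_axis_def by blast
  define h where "h = half_turn (p + q)"
  have hm: "half_turn (mid F H) = h" unfolding m h_def by (rule half_turn_scale) simp
  have lin: "linear h" unfolding h_def by (rule linear_half_turn)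
  have hh: "h (h x) = x" for x by (simp add: h_def)
  have sw: "h p = q" "h q = p" unfolding h_def using half_turn_swaps[OF pqr(1,2) e(2)] by auto
  have hF: "h ` F = H" using hinged_mid(4)[OF FH] hm by simp
  have hr: "h r \<in> S" "h r \<in> H" using turn_axis_symmetry(1)[OF ax] pqr hF unfolding h_def by auto
  define u w w' where "u = q - p" and "w = r - p" and "w' = h r - q"
  note gram = corner_gram[OF e(3) pqr(1-3), folded u_def w_def]
  define \<kappa> where "\<kappa> = 1 - 2 * (w \<bullet> u) / (u \<bullet> u)"
  have kap: "\<kappa> = (if sq then 1 else 0)" unfolding \<kappa>_def gram using c_less by auto
  have rs: "p + w + \<kappa> *\<^sub>R u \<in> S \<inter> F"
    using cin unfolding kap u_def w_def by (auto simp: algebra_simps)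
  have inn: "h x \<bullet> h y = x \<bullet> y" for x y unfolding h_def by (rule half_turn_inner)
  have w': "w' = h w" "h u = - u" unfolding w'_def w_def u_def by (simp_all add: linear_diff[OF lin] sw)
  have "w' \<bullet> h u = w \<bullet> u" unfolding w'(1) by (rule inn)
  then have g: "w' \<bullet> u = - (w \<bullet> u)" "w' \<bullet> w' = w \<bullet> w" using w'(2) by (simp_all add: w'(1) inn)
  have hrn: "h r \<noteq> p" "h r \<noteq> q" using hh[of r] sw ne by auto
  have "h r \<noteq> p + w + \<kappa> *\<^sub>R u"
  proof
    assume "h r = p + w + \<kappa> *\<^sub>R u"
    then have "h r \<in> S \<inter> (F \<inter> H)" using rs hr by auto
    then show False using e(1) hrn by auto
  qed
  then have ne': "p + u + w' \<noteq> p + w + \<kappa> *\<^sub>R u" by (simp add: u_def w'_def)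
  have in': "p \<in> F" "p + u \<in> F" "p + w \<in> F" "p + w + \<kappa> *\<^sub>R u \<in> F" "p + u \<in> H" "p \<in> H" "p + u + w' \<in> H"
    using pqr hr rs by (simp_all add: u_def w_def w'_def)
  obtain k where k: "linear k" "\<forall>v. v \<noteq> 0 \<longrightarrow> k v \<noteq> 0"
    "\<forall>i j. p + i *\<^sub>R u + j *\<^sub>R w \<in> F \<longrightarrow>
       p + k (D (p + i *\<^sub>R u + j *\<^sub>R w) - D p) = p + i *\<^sub>R u + j *\<^sub>R w"
    "\<forall>i j. p + u + i *\<^sub>R (- u) + j *\<^sub>R w' \<in> H \<longrightarrow>
       p + k (D (p + u + i *\<^sub>R (- u) + j *\<^sub>R w') - D p) = p + u + i *\<^sub>R (- u) + j *\<^sub>R (- w)"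
    by (rule unfold_across_edge[OF D in'(1-3) in'(4)[unfolded \<kappa>_def] in'(5-7) g gram(4) ne'[unfolded \<kappa>_def]])
      (rule that)
  have "p + k (D y - D p) = y" if yF: "y \<in> F" for y
  proof -
    obtain i j where "y = p + i *\<^sub>R u + j *\<^sub>R w"
      using facet_coordinates[OF F e(4) yF] unfolding u_def w_def by blast
    then show ?thesis using k(3)[rule_format, of i j] yF by simp
  qed
  moreover have "p + k (D y - D p) = hinge_mirror F H y" if yH: "y \<in> H" for y
  proof -
    obtain x where x: "x \<in> F" "y = h x" using yH hF by blast
    obtain i j where ij: "x = p + i *\<^sub>R u + j *\<^sub>R w"
      using facet_coordinates[OF F e(4) x(1)] unfolding u_def w_def by blast
    have y: "y = p + u + i *\<^sub>R (- u) + j *\<^sub>R w'"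
      unfolding x(2) ij by (simp add: linear_add[OF lin] linear_scale[OF lin] w' sw) (simp add: u_def)
    have "hinge_mirror F H y = p + q - x" unfolding mirror_def hm x(2) hh by (simp add: m)
    also have "\<dots> = p + u + i *\<^sub>R (- u) + j *\<^sub>R (- w)" unfolding ij by (simp add: u_def algebra_simps)
    finally show ?thesis using k(4)[rule_format, of i j] yH unfolding y by simp
  qed
  ultimately show thesis using that[OF k(1,2), of p "D p"] by simp
qed

end

section \<open>Lines in space\<close>

definition line :: "(real \<Rightarrow> real^3) \<Rightarrow> bool" where
  "line l \<longleftrightarrow> (\<exists>p u. u \<noteq> 0 \<and> l = (\<lambda>s. p + s *\<^sub>R u))"

lemma line_eqI:
  assumes "line l" "line l'" "l a = l' a" "l b = l' b" "a \<noteq> b"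
  shows "l = l'"
proof -
  obtain p u p' u' where l: "l = (\<lambda>s. p + s *\<^sub>R u)" "l' = (\<lambda>s. p' + s *\<^sub>R u')"
    using assms unfolding line_def by blast
  have e: "p - p' = a *\<^sub>R (u' - u)" "p - p' = b *\<^sub>R (u' - u)"
    using assms(3,4) unfolding l by (simp_all add: algebra_simps)
  from trans[OF e(1)[symmetric] e(2)] have "a = b \<or> u' - u = 0" by (simp only: scaleR_cancel_right)
  then have u: "u' = u" using assms(5) by simp
  then have "p = p'" using e(1) by simp
  then show ?thesis unfolding l u by simp
qed

lemma line_inj: "line l \<Longrightarrow> l a = l b \<longleftrightarrow> a = b"
  unfolding line_def by auto

lemma line_continuous: "line l \<Longrightarrow> continuous_on A l"
  unfolding line_def by (auto intro!: continuous_intros)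

lemma line_mirror: "line l \<Longrightarrow> line (\<lambda>s. mirror m (l s))"
proof -
  assume "line l"
  then obtain p u where "u \<noteq> 0" "l = (\<lambda>s. p + s *\<^sub>R u)" unfolding line_def by blast
  moreover have "half_turn m u \<noteq> 0"
  proof
    assume "half_turn m u = 0"
    then have "half_turn m (half_turn m u) = 0" using linear_0[OF linear_half_turn] by simp
    then show False using \<open>u \<noteq> 0\<close> by simp
  qed
  ultimately show ?thesis unfolding line_def
    by (intro exI[of _ "mirror m p"] exI[of _ "- half_turn m u"]) (simp only: mirror_affine neg_equal_0_iff_equal, simp)
qed

context reversible_solid
begin

subsection \<open>Charts along a geodesic\<close>

text \<open>Near time \<open>t\<close> the curve is a line \<open>l\<close> in the plane of \<open>F\<close>, as long as this line stays in \<open>F\<close>; beyond the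
  edge shared with \<open>H\<close> one sees its mirror image. The case \<open>F = H\<close> means that the curve does not
  leave \<open>F\<close>.\<close>

definition chart ::
  "(real \<Rightarrow> real^3) \<Rightarrow> real \<Rightarrow> (real^3) set \<Rightarrow> (real^3) set \<Rightarrow> (real \<Rightarrow> real^3) \<Rightarrow> real \<Rightarrow> bool" where
  "chart \<gamma> t F H l \<epsilon> \<longleftrightarrow> F facet_of P \<and> H facet_of P \<and> (F = H \<or> hinged F H) \<and> line l \<and> \<epsilon> > 0 \<and>
     (\<forall>s\<in>{0..1}. \<bar>s - t\<bar> < \<epsilon> \<longrightarrow>
        \<gamma> s = l s \<and> l s \<in> F \<or> F \<noteq> H \<and> \<gamma> s = hinge_mirror F H (l s) \<and> \<gamma> s \<in> H)"

lemma chart_exists: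
  assumes "straight_at P \<gamma> t"
  shows "\<exists>F H l \<epsilon>. chart \<gamma> t F H l \<epsilon>"
proof -
  obtain F G D a v e where *: "equal_or_adjacent P F G" "unfolding_map F G D" "v \<noteq> 0" "e > 0"
    "\<forall>s\<in>{0..1}. \<bar>s - t\<bar> < e \<longrightarrow> \<gamma> s \<in> F \<union> G \<and> D (\<gamma> s) = a + s *\<^sub>R v"
    using assms unfolding straight_at_def by metis
  have FG: "F facet_of P" "G facet_of P" using *(1) by (auto simp: equal_or_adjacent_def)
  have line: "line (\<lambda>s. p + k (a + s *\<^sub>R v - d))" if "linear k" "\<forall>v. v \<noteq> 0 \<longrightarrow> k v \<noteq> 0" for p k d
    unfolding line_def
    by (intro exI[of _ "p + k (a - d)"] exI[of _ "k v"])
      (use that *(3) in \<open>simp add: fun_eq_iff linear_add[OF that(1)] linear_diff[OF that(1)] linear_scale[OF that(1)]\<close>)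
  show ?thesis
  proof (cases "F = G")
    case True
    have iso: "\<forall>x\<in>F. \<forall>y\<in>F. dist (D x) (D y) = dist x y" using *(2) by (simp add: unfolding_map_def)
    obtain k p d where k: "linear k" "\<forall>v. v \<noteq> 0 \<longrightarrow> k v \<noteq> 0" "\<forall>y\<in>F. p + k (D y - d) = y"
      by (rule unfold_facet[OF FG(1) iso]) (rule that)
    have "chart \<gamma> t F F (\<lambda>s. p + k (a + s *\<^sub>R v - d)) e"
      unfolding chart_def
    proof (intro conjI ballI impI disjI1)
      fix s :: real assume s: "s \<in> {0..1}" "\<bar>s - t\<bar> < e"
      then have "\<gamma> s \<in> F" "D (\<gamma> s) = a + s *\<^sub>R v" using *(5) True by auto
      then show "\<gamma> s = p + k (a + s *\<^sub>R v - d)" "p + k (a + s *\<^sub>R v - d) \<in> F" using k(3) by metis+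
    qed (use FG *(4) line[OF k(1,2)] in auto)
    then show ?thesis by blast
  next
    case False
    then have edge: "(F \<inter> G) edge_of P" using *(1) by (simp add: equal_or_adjacent_def)
    have "hinged F G"
    proof -
      have ad: "aff_dim (F \<inter> G) = 1" and f: "F \<inter> G face_of P" using edge by (auto simp: edge_of_def)
      have "F \<inter> G \<noteq> {}" using ad by auto
      then obtain x where x: "x \<in> F \<inter> G" by blast
      have "F \<inter> G \<noteq> {x}" using ad by auto
      then obtain y where y: "y \<in> F \<inter> G" "x \<noteq> y" using x by blast
      have conv: "convex (F \<inter> G)" by (rule face_of_imp_convex[OF f])
      have "midpoint x y \<in> closed_segment x y" by simp
      then have m: "midpoint x y \<in> F \<inter> G" using closed_segment_subset[OF x y(1) conv] by blast
      have "midpoint x y \<notin> S"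
      proof
        assume "midpoint x y \<in> S"
        then have "midpoint x y extreme_point_of P" by (simp add: extreme_iff_vertex)
        moreover have "midpoint x y \<in> open_segment x y" using y by simp
        moreover have "x \<in> P" "y \<in> P" using x y face_of_imp_subset[OF f] by auto
        ultimately show False unfolding extreme_point_of_def by blast
      qed
      then show ?thesis unfolding hinged_def using FG False m by blast
    qed
    obtain k p d where k: "linear k" "\<forall>v. v \<noteq> 0 \<longrightarrow> k v \<noteq> 0" "\<forall>y\<in>F. p + k (D y - d) = y"
      "\<forall>y\<in>G. p + k (D y - d) = hinge_mirror F G y"
      by (rule unfold_hinged[OF \<open>hinged F G\<close> *(2)]) (rule that)
    have "chart \<gamma> t F G (\<lambda>s. p + k (a + s *\<^sub>R v - d)) e"
      unfolding chart_def
    proof (intro conjI ballI impI)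
      fix s :: real assume s: "s \<in> {0..1}" "\<bar>s - t\<bar> < e"
      then have D: "\<gamma> s \<in> F \<union> G" "D (\<gamma> s) = a + s *\<^sub>R v" using *(5) by auto
      show "\<gamma> s = p + k (a + s *\<^sub>R v - d) \<and> p + k (a + s *\<^sub>R v - d) \<in> F \<or>
         F \<noteq> G \<and> \<gamma> s = hinge_mirror F G (p + k (a + s *\<^sub>R v - d)) \<and> \<gamma> s \<in> G"
      proof (cases "\<gamma> s \<in> F")
        case True then show ?thesis using k(3) D(2) by metis
      next
        case nF: False
        then have "\<gamma> s \<in> G" using D(1) by blast
        then have "p + k (a + s *\<^sub>R v - d) = hinge_mirror F G (\<gamma> s)" using k(4) D(2) by metis
        then show ?thesis using \<open>\<gamma> s \<in> G\<close> False by simp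
      qed
    qed (use FG *(4) line[OF k(1,2)] \<open>hinged F G\<close> in auto)
    then show ?thesis by blast
  qed
qed

text \<open>Either of the two faces may serve as the reference face, because reflections are involutions.\<close>

lemma chart_swap:
  assumes "chart \<gamma> t F H l \<epsilon>" "F \<noteq> H"
  shows "chart \<gamma> t H F (\<lambda>s. hinge_mirror F H (l s)) \<epsilon>"
  using assms hinged_sym line_mirror mid_sym[of H F] unfolding chart_def by auto

lemma chart_mono: "chart \<gamma> t F H l \<epsilon> \<Longrightarrow> 0 < \<delta> \<Longrightarrow> \<delta> \<le> \<epsilon> \<Longrightarrow> chart \<gamma> t F H l \<delta>"
  unfolding chart_def by force

definition runs :: "(real \<Rightarrow> real^3) \<Rightarrow> (real^3) set \<Rightarrow> (real \<Rightarrow> real^3) \<Rightarrow> real \<Rightarrow> real \<Rightarrow> bool" where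
  "runs \<gamma> F l a b \<longleftrightarrow> F facet_of P \<and> line l \<and> (\<forall>s. a < s \<and> s < b \<longrightarrow> \<gamma> s = l s \<and> l s \<in> F)"

lemma runs_subset: "runs \<gamma> F l a b \<Longrightarrow> a \<le> a' \<Longrightarrow> b' \<le> b \<Longrightarrow> runs \<gamma> F l a' b'"
  unfolding runs_def by force

lemma facet_closed_convex: "F facet_of P \<Longrightarrow> closed F" "F facet_of P \<Longrightarrow> convex F"
proof -
  assume F: "F facet_of P"
  show "convex F" by (rule face_of_imp_convex[OF facet_face[OF F]])
  have "compact P" using fin by (simp add: finite_imp_compact_convex_hull)
  then show "closed F" using face_of_imp_compact[OF _ _ facet_face[OF F]] by (simp add: compact_imp_closed)
qed

text \<open>Where the line has left the closed set \<open>F\<close>, it stays outside for a while, and the curve runs in \<open>H\<close>;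
  if it never leaves \<open>F\<close>, the curve runs in \<open>F\<close> throughout. This makes different charts comparable.\<close>

lemma chart_runs:
  assumes ch: "chart \<gamma> t F H l \<epsilon>" and ab: "a < b" "0 \<le> a" "b \<le> 1" "t - \<epsilon> \<le> a" "b \<le> t + \<epsilon>"
  obtains a' b' where "a \<le> a'" "a' < b'" "b' \<le> b"
    "runs \<gamma> F l a' b' \<or> F \<noteq> H \<and> runs \<gamma> H (\<lambda>s. hinge_mirror F H (l s)) a' b'"
proof -
  have c: "F facet_of P" "H facet_of P" "F = H \<or> hinged F H" "line l" using ch by (auto simp: chart_def)
  have alt: "\<gamma> s = l s \<and> l s \<in> F \<or> F \<noteq> H \<and> \<gamma> s = hinge_mirror F H (l s) \<and> \<gamma> s \<in> H" if "a < s" "s < b" for s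
    using ch that ab by (auto simp: chart_def)
  show thesis
  proof (cases "\<exists>s. a < s \<and> s < b \<and> l s \<notin> F")
    case True
    then obtain s where s: "a < s" "s < b" "l s \<notin> F" by blast
    have op: "open ({a<..<b} \<inter> l -` (- F))"
      by (intro continuous_open_preimage line_continuous c) (auto intro: facet_closed_convex c)
    have mem: "s \<in> {a<..<b} \<inter> l -` (- F)" using s by simp
    obtain e where e: "e > 0" "ball s e \<subseteq> {a<..<b} \<inter> l -` (- F)"
      by (rule openE[OF op mem]) (rule that)
    have in': "s' \<in> {a<..<b} \<and> l s' \<notin> F" if "s - e < s'" "s' < s + e" for s'
    proof -
      have "s' \<in> ball s e" using that by (simp add: dist_real_def abs_less_iff)
      then show ?thesis using e(2) by auto
    qed
    have "F \<noteq> H" using alt s by blast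
    moreover have "runs \<gamma> H (\<lambda>s. hinge_mirror F H (l s)) (s - e / 2) (s + e / 2)"
      unfolding runs_def
    proof (intro conjI allI impI)
      fix s' assume "s - e / 2 < s' \<and> s' < s + e / 2"
      then have "s' \<in> {a<..<b} \<and> l s' \<notin> F" using in' e(1) by simp
      then show "\<gamma> s' = hinge_mirror F H (l s')" "hinge_mirror F H (l s') \<in> H" using alt[of s'] by auto
    qed (use c line_mirror in auto)
    moreover have "s - e / 2 \<in> {a<..<b}" "s + e / 2 \<in> {a<..<b}" using in'[of "s - e/2"] in'[of "s + e/2"] e(1) by auto
    ultimately show thesis using that[of "s - e / 2" "s + e / 2"] e(1) by auto
  next
    case False
    have "runs \<gamma> F l a b"
      unfolding runs_def
    proof (intro conjI allI impI)
      fix s assume s: "a < s \<and> s < b"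
      then show F': "l s \<in> F" using False by blast
      show "\<gamma> s = l s" using alt[of s] hinge_mirror_fixes[OF _ F'] c(3) s by auto
    qed (use c in auto)
    then show thesis using that[of a b] ab by auto
  qed
qed

text \<open>Two faces containing the same piece of the curve share more than a vertex, so the curve runs along
  their common edge, which the reflection leaves pointwise fixed.\<close>

lemma runs_unique:
  assumes r: "runs \<gamma> F l a b" "runs \<gamma> F' l' a b" "a < b"
  shows "l = l'" "F \<noteq> F' \<Longrightarrow> hinged F F' \<and> (\<forall>s. hinge_mirror F F' (l s) = l s)"
proof -
  have c: "F facet_of P" "F' facet_of P" "line l" "line l'" using r by (auto simp: runs_def)
  define s1 s2 where "s1 = (2 * a + b) / 3" and "s2 = (a + 2 * b) / 3"
  have s: "a < s1" "s1 < s2" "s2 < b" using r(3) by (auto simp: s1_def s2_def)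
  have g: "\<gamma> s1 = l s1" "\<gamma> s2 = l s2" "\<gamma> s1 = l' s1" "\<gamma> s2 = l' s2"
    "l s1 \<in> F" "l s2 \<in> F" "l' s1 \<in> F'" "l' s2 \<in> F'"
    using r s unfolding runs_def by auto
  have "l s1 = l' s1" "l s2 = l' s2" using g(1-4) by simp_all
  then show eq: "l = l'" using line_eqI[OF c(3,4), of s1 s2] s(2) by blast
  assume ne: "F \<noteq> F'"
  have f: "F \<inter> F' face_of P" by (rule face_of_Int[OF facet_face[OF c(1)] facet_face[OF c(2)]])
  have "l s1 \<noteq> l s2" using line_inj[OF c(3)] s by simp
  then have o: "midpoint (l s1) (l s2) \<in> open_segment (l s1) (l s2)" by simp
  have in': "l s1 \<in> F \<inter> F'" "l s2 \<in> F \<inter> F'" using g eq by auto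
  have "midpoint (l s1) (l s2) \<in> F \<inter> F'"
    using o closed_segment_subset[OF in' face_of_imp_convex[OF f]] by (auto simp: open_segment_def)
  moreover have "midpoint (l s1) (l s2) \<notin> S"
  proof
    assume "midpoint (l s1) (l s2) \<in> S"
    then have "midpoint (l s1) (l s2) extreme_point_of P" by (simp add: extreme_iff_vertex)
    moreover have "l s1 \<in> P" "l s2 \<in> P" using in' face_of_imp_subset[OF f] by auto
    ultimately show False using o unfolding extreme_point_of_def by blast
  qed
  ultimately have h: "hinged F F'" unfolding hinged_def using c ne by blast
  have "hinge_mirror F F' (l s1) = l s1" "hinge_mirror F F' (l s2) = l s2" using hinge_mirror_edge[OF h] in' by auto
  then have "(\<lambda>s. hinge_mirror F F' (l s)) = l"
    using line_eqI[OF line_mirror[OF c(3), of "mid F F'"] c(3), of s1 s2] s(2) by blast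
  then show "hinged F F' \<and> (\<forall>s. hinge_mirror F F' (l s) = l s)" using h by (simp add: fun_eq_iff)
qed

subsection \<open>The lattice along a geodesic\<close>

lemma chart_at:
  assumes "chart \<gamma> t F H l \<epsilon>" "s \<in> {0..1}" "\<bar>s - t\<bar> < \<epsilon>"
  shows "\<gamma> s = l s \<and> l s \<in> F \<or> F \<noteq> H \<and> \<gamma> s = hinge_mirror F H (l s) \<and> \<gamma> s \<in> H"
  using assms unfolding chart_def by blast

text \<open>Whether \<open>l \<tau>\<close>, the unfolded position at a fixed and possibly distant time \<open>\<tau>\<close>, is a lattice point
  does not depend on the chart, because overlapping charts differ by reflections and these
  preserve lattices.\<close>

lemma chart_lattice_transfer:
  assumes ch: "chart \<gamma> t F H l \<epsilon>" "chart \<gamma> t' F' H' l' \<epsilon>'"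
    and ab: "a < b" "0 \<le> a" "b \<le> 1" "t - \<epsilon> \<le> a" "b \<le> t + \<epsilon>" "t' - \<epsilon>' \<le> a" "b \<le> t' + \<epsilon>'"
    and lat: "l \<tau> \<in> lattice (S \<inter> F)"
  shows "l' \<tau> \<in> lattice (S \<inter> F')"
proof -
  obtain a1 b1 where 1: "a \<le> a1" "a1 < b1" "b1 \<le> b"
    "runs \<gamma> F l a1 b1 \<or> F \<noteq> H \<and> runs \<gamma> H (\<lambda>s. hinge_mirror F H (l s)) a1 b1"
    by (rule chart_runs[OF ch(1) ab(1-5)]) (rule that)
  have "\<exists>G k. runs \<gamma> G k a1 b1 \<and> k \<tau> \<in> lattice (S \<inter> G)"
    using 1(4)
  proof
    assume "runs \<gamma> F l a1 b1" then show ?thesis using lat by blast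
  next
    assume r: "F \<noteq> H \<and> runs \<gamma> H (\<lambda>s. hinge_mirror F H (l s)) a1 b1"
    then have "hinged F H" using ch(1) by (auto simp: chart_def)
    then have "hinge_mirror F H (l \<tau>) \<in> lattice (S \<inter> H)" using lat by (rule hinge_mirror_lattice)
    then show ?thesis using r by (intro exI[of _ H] exI[of _ "\<lambda>s. hinge_mirror F H (l s)"]) simp
  qed
  then obtain G k where G: "runs \<gamma> G k a1 b1" "k \<tau> \<in> lattice (S \<inter> G)" by blast
  have ab': "0 \<le> a1" "b1 \<le> 1" "t' - \<epsilon>' \<le> a1" "b1 \<le> t' + \<epsilon>'" using ab 1 by linarith+
  obtain a2 b2 where 2: "a1 \<le> a2" "a2 < b2" "b2 \<le> b1"
    "runs \<gamma> F' l' a2 b2 \<or> F' \<noteq> H' \<and> runs \<gamma> H' (\<lambda>s. hinge_mirror F' H' (l' s)) a2 b2"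
    by (rule chart_runs[OF ch(2) 1(2) ab']) (rule that)
  have rG: "runs \<gamma> G k a2 b2" by (rule runs_subset[OF G(1) 2(1,3)])
  have step: "k' \<tau> \<in> lattice (S \<inter> G')" if r': "runs \<gamma> G' k' a2 b2" for G' k'
  proof (cases "G = G'")
    case True
    then show ?thesis using runs_unique(1)[OF rG r' 2(2)] G(2) by simp
  next
    case False
    have h: "hinged G G'" "\<forall>s. hinge_mirror G G' (k s) = k s" using runs_unique(2)[OF rG r' 2(2) False] by auto
    have "hinge_mirror G G' (k \<tau>) \<in> lattice (S \<inter> G')" by (rule hinge_mirror_lattice[OF h(1) G(2)])
    then show ?thesis using h(2) runs_unique(1)[OF rG r' 2(2)] by simp
  qed
  show ?thesis
    using 2(4)
  proof
    assume "runs \<gamma> F' l' a2 b2" then show ?thesis by (rule step)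
  next
    assume r: "F' \<noteq> H' \<and> runs \<gamma> H' (\<lambda>s. hinge_mirror F' H' (l' s)) a2 b2"
    then have "hinged H' F'" using ch(2) hinged_sym by (auto simp: chart_def)
    moreover have "hinge_mirror F' H' (l' \<tau>) \<in> lattice (S \<inter> H')" using step r by blast
    ultimately have "hinge_mirror H' F' (hinge_mirror F' H' (l' \<tau>)) \<in> lattice (S \<inter> F')" by (rule hinge_mirror_lattice)
    then show ?thesis by (simp add: mid_sym[of H' F'])
  qed
qed

lemma overlap_interval:
  fixes t x \<epsilon> \<epsilon>' :: real
  assumes "t \<in> {0..1}" "x \<in> {0..1}" "\<bar>x - t\<bar> < \<epsilon>" "0 < \<epsilon>'"
  obtains a b where "a < b" "0 \<le> a" "b \<le> 1" "t - \<epsilon> \<le> a" "b \<le> t + \<epsilon>" "x - \<epsilon>' \<le> a" "b \<le> x + \<epsilon>'"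
proof
  show "max 0 (max (t - \<epsilon>) (x - \<epsilon>')) < min 1 (min (t + \<epsilon>) (x + \<epsilon>'))" using assms by auto
qed auto

text \<open>The statement holds at time \<open>\<tau>\<close> itself, and it spreads to all of the interval by connectedness. For
  the two ends \<open>\<tau> = 0\<close> and \<open>\<tau> = 1\<close> this says that unfolding the whole curve into the plane of a face that
  it visits puts both end points on the lattice of that face.\<close>

lemma lattice_along_geodesic:
  assumes st: "\<forall>t\<in>{0..1}. straight_at P \<gamma> t" and \<tau>: "\<tau> \<in> {0..1}" "\<gamma> \<tau> \<in> S"
    and t: "t \<in> {0..1}" and ch: "chart \<gamma> t F H l \<epsilon>"
  shows "l \<tau> \<in> lattice (S \<inter> F)"
proof -
  define Q where "Q t \<longleftrightarrow> (\<forall>F H l \<epsilon>. chart \<gamma> t F H l \<epsilon> \<longrightarrow> l \<tau> \<in> lattice (S \<inter> F))" for t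
  have base: "Q \<tau>"
    unfolding Q_def
  proof (intro allI impI)
    fix F H l \<epsilon> assume c: "chart \<gamma> \<tau> F H l \<epsilon>"
    then have "\<gamma> \<tau> = l \<tau> \<and> l \<tau> \<in> F \<or> F \<noteq> H \<and> \<gamma> \<tau> = hinge_mirror F H (l \<tau>) \<and> \<gamma> \<tau> \<in> H"
      by (rule chart_at[OF _ \<tau>(1)]) (use c in \<open>simp add: chart_def\<close>)
    then show "l \<tau> \<in> lattice (S \<inter> F)"
    proof (elim disjE conjE)
      assume "\<gamma> \<tau> = l \<tau>" "l \<tau> \<in> F"
      then show ?thesis using \<tau>(2) by (intro lattice.vertex) simp
    next
      assume e: "F \<noteq> H" "\<gamma> \<tau> = hinge_mirror F H (l \<tau>)" "\<gamma> \<tau> \<in> H"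
      then have "hinged H F" using c hinged_sym by (auto simp: chart_def)
      moreover have "\<gamma> \<tau> \<in> lattice (S \<inter> H)" using \<tau>(2) e(3) by (intro lattice.vertex) simp
      ultimately have "hinge_mirror H F (\<gamma> \<tau>) \<in> lattice (S \<inter> F)" by (rule hinge_mirror_lattice)
      then show ?thesis using e(2) by (simp add: mid_sym[of H F])
    qed
  qed
  have "Q t"
  proof (rule connected_induction_simple[where S = "{0..1::real}" and P = Q and a = \<tau>])
    fix t0 :: real assume t0: "t0 \<in> {0..1}"
    obtain F0 H0 l0 e0 where c0: "chart \<gamma> t0 F0 H0 l0 e0" using chart_exists st t0 by blast
    then have e0: "e0 > 0" by (simp add: chart_def)
    have tr: "Q y" if x: "x \<in> {0..1}" "\<bar>x - t0\<bar> < e0" and y: "y \<in> {0..1}" "\<bar>y - t0\<bar> < e0" and "Q x" for x y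
    proof -
      obtain F1 H1 l1 e1 where c1: "chart \<gamma> x F1 H1 l1 e1" using chart_exists st x(1) by blast
      then have e1: "e1 > 0" by (simp add: chart_def)
      have q1: "l1 \<tau> \<in> lattice (S \<inter> F1)" using \<open>Q x\<close> c1 unfolding Q_def by blast
      obtain a b where ab: "a < b" "0 \<le> a" "b \<le> 1" "t0 - e0 \<le> a" "b \<le> t0 + e0" "x - e1 \<le> a" "b \<le> x + e1"
        by (rule overlap_interval[OF t0 x e1]) (rule that)
      have q0: "l0 \<tau> \<in> lattice (S \<inter> F0)"
        by (rule chart_lattice_transfer[OF c1 c0 ab(1-3) ab(6,7,4,5) q1])
      show "Q y"
        unfolding Q_def
      proof (intro allI impI)
        fix F2 H2 l2 e2 assume c2: "chart \<gamma> y F2 H2 l2 e2"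
        then have e2: "e2 > 0" by (simp add: chart_def)
        obtain a b where ab: "a < b" "0 \<le> a" "b \<le> 1" "t0 - e0 \<le> a" "b \<le> t0 + e0" "y - e2 \<le> a" "b \<le> y + e2"
          by (rule overlap_interval[OF t0 y e2]) (rule that)
        show "l2 \<tau> \<in> lattice (S \<inter> F2)"
          by (rule chart_lattice_transfer[OF c0 c2 ab q0])
      qed
    qed
    show "\<exists>T. openin (top_of_set {0..1}) T \<and> t0 \<in> T \<and> (\<forall>x\<in>T. \<forall>y\<in>T. Q x \<longrightarrow> Q y)"
    proof (intro exI[of _ "{0..1} \<inter> ball t0 e0"] conjI ballI impI)
      show "openin (top_of_set {0..1}) ({0..1} \<inter> ball t0 e0)" by (intro openin_open_Int) simp
      show "t0 \<in> {0..1} \<inter> ball t0 e0" using t0 e0 by simp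
      fix x y assume "x \<in> {0..1} \<inter> ball t0 e0" "y \<in> {0..1} \<inter> ball t0 e0" "Q x"
      then show "Q y" by (intro tr[of x y]) (auto simp: dist_real_def abs_minus_commute)
    qed
  qed (use \<tau> t base in auto)
  then show ?thesis using ch unfolding Q_def by blast
qed

subsection \<open>Uniqueness of continuation\<close>

lemma facets_near:
  assumes cont: "continuous_on {0..1} \<gamma>" and t: "t \<in> {0..1::real}"
  obtains \<delta> where "\<delta> > 0" "\<forall>s\<in>{0..1}. \<bar>s - t\<bar> < \<delta> \<longrightarrow> (\<forall>G. G facet_of P \<longrightarrow> \<gamma> s \<in> G \<longrightarrow> \<gamma> t \<in> G)"
proof -
  define C where "C = \<Union>{G. G facet_of P \<and> \<gamma> t \<notin> G}"
  have "polytope P" using fin unfolding polytope_def by blast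
  then have "finite {G. G facet_of P \<and> \<gamma> t \<notin> G}"
    by (rule rev_finite_subset[OF finite_polytope_facets]) auto
  then have "closed C" unfolding C_def by (intro closed_Union) (auto intro: facet_closed_convex)
  then have op: "open (- C)" by (rule open_Compl)
  have mem: "\<gamma> t \<in> - C" by (auto simp: C_def)
  obtain e where e: "e > 0" "ball (\<gamma> t) e \<subseteq> - C" by (rule openE[OF op mem]) (rule that)
  obtain d where d: "d > 0" "\<forall>s\<in>{0..1}. dist s t < d \<longrightarrow> dist (\<gamma> s) (\<gamma> t) < e"
    using cont[unfolded continuous_on_iff, rule_format, OF t e(1)] by auto
  have "\<forall>s\<in>{0..1}. \<bar>s - t\<bar> < d \<longrightarrow> (\<forall>G. G facet_of P \<longrightarrow> \<gamma> s \<in> G \<longrightarrow> \<gamma> t \<in> G)"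
  proof (intro ballI impI allI)
    fix s G assume s: "s \<in> {0..1::real}" "\<bar>s - t\<bar> < d" and G: "G facet_of P" "\<gamma> s \<in> G"
    then have "\<gamma> s \<in> ball (\<gamma> t) e" using d(2) by (simp add: dist_real_def dist_commute)
    then have "\<gamma> s \<notin> C" using e(2) by blast
    then show "\<gamma> t \<in> G" using G by (auto simp: C_def)
  qed
  then show thesis by (rule that[OF d(1)])
qed

text \<open>A line that touches the supporting plane at an interior point of its path through the solid
  cannot cross it, hence stays in it.\<close>

lemma tangent_line_in_edge:
  assumes h: "hinged F H" and l: "line l" and e: "e > 0" "\<forall>s. \<bar>s - t\<bar> < e \<longrightarrow> l s \<in> P" "l t \<in> F \<inter> H"
  shows "hinge_mirror F H (l s) = l s"
proof -
  obtain p u where lp: "l = (\<lambda>s. p + s *\<^sub>R u)" using l unfolding line_def by blast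
  define m where "m = mid F H"
  have lin: "l s \<bullet> m = l t \<bullet> m + (s - t) * (u \<bullet> m)" for s
    unfolding lp by (simp add: inner_add_left algebra_simps)
  have at: "l t \<bullet> m = m \<bullet> m" unfolding m_def by (rule hinged_mid(3)[OF h e(3)])
  have le: "(s - t) * (u \<bullet> m) \<le> 0" if "\<bar>s - t\<bar> < e" for s
    using hinged_mid(2)[OF h, of "l s"] e(2) that lin[of s] at unfolding m_def by fastforce
  have "(e / 2) * (u \<bullet> m) \<le> 0" "(- (e / 2)) * (u \<bullet> m) \<le> 0"
    using le[of "t + e / 2"] le[of "t - e / 2"] e(1) by simp_all
  then have "u \<bullet> m = 0" using e(1) by (auto simp: mult_le_0_iff zero_le_mult_iff)
  then have "l s \<bullet> m = m \<bullet> m" unfolding lin[of s] at by simp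
  then show ?thesis using mirror_fixes_iff[OF hinged_mid(1)[OF h]] by (simp add: m_def)
qed

text \<open>A chart need not use both faces that meet at \<open>\<gamma> t\<close>: if the curve runs along an edge, the chart may know
  only one of them, and the other face of the chart may be far from \<open>\<gamma> t\<close>. This lemma supplies a chart
  for a prescribed face \<open>F\<close> at \<open>\<gamma> t\<close> whose second face is the other face at \<open>\<gamma> t\<close>, if there is one. Two
  geodesics through the same point thereby get charts over the same pair of faces.\<close>

lemma canonical_chart:
  assumes cont: "continuous_on {0..1} \<gamma>" and t: "0 < t" "t < 1" and st: "straight_at P \<gamma> t"
    and x: "\<gamma> t \<notin> S" and F: "F facet_of P" "\<gamma> t \<in> F"
  shows "\<exists>H l \<delta>. chart \<gamma> t F H l \<delta> \<and> \<delta> \<le> t \<and> \<delta> \<le> 1 - t \<and>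
     (if F = H then \<forall>G. hinged F G \<longrightarrow> \<gamma> t \<notin> G else \<gamma> t \<in> H)"
proof -
  have t01: "t \<in> {0..1}" using t by simp
  obtain d where d: "d > 0" "\<forall>s\<in>{0..1}. \<bar>s - t\<bar> < d \<longrightarrow> (\<forall>G. G facet_of P \<longrightarrow> \<gamma> s \<in> G \<longrightarrow> \<gamma> t \<in> G)"
    by (rule facets_near[OF cont t01]) (rule that)
  obtain K0 L0 l0 e0 where c0: "chart \<gamma> t K0 L0 l0 e0" using chart_exists[OF st] by blast
  then have "e0 > 0" by (simp add: chart_def)
  define e where "e = min (min d e0) (min t (1 - t))"
  have e: "e > 0" "e \<le> e0" "e \<le> d" "e \<le> t" "e \<le> 1 - t" using d(1) \<open>e0 > 0\<close> t by (auto simp: e_def)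
  have ce: "chart \<gamma> t K0 L0 l0 e" by (rule chart_mono[OF c0 e(1,2)])
  have "\<exists>K L l. chart \<gamma> t K L l e \<and> \<gamma> t \<in> K"
  proof (cases "\<gamma> t \<in> K0")
    case True then show ?thesis using ce by blast
  next
    case False
    have "\<gamma> t = l0 t \<and> l0 t \<in> K0 \<or> K0 \<noteq> L0 \<and> \<gamma> t = hinge_mirror K0 L0 (l0 t) \<and> \<gamma> t \<in> L0"
      using chart_at[OF ce t01] e(1) by simp
    then have KL0: "K0 \<noteq> L0" "\<gamma> t \<in> L0" using False by auto
    show ?thesis by (intro exI conjI, rule chart_swap[OF ce KL0(1)], rule KL0(2))
  qed
  then obtain K L l where c: "chart \<gamma> t K L l e" "\<gamma> t \<in> K" by blast
  have KL: "K facet_of P" "L facet_of P" "K = L \<or> hinged K L" "line l"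
    using c(1) by (auto simp: chart_def)
  have alt: "\<gamma> s = l s \<and> l s \<in> K \<or> K \<noteq> L \<and> \<gamma> s = hinge_mirror K L (l s) \<and> \<gamma> s \<in> L" if "\<bar>s - t\<bar> < e" for s
    by (rule chart_at[OF c(1) _ that]) (use that e in auto)
  have near: "\<gamma> t \<in> G" if "\<bar>s - t\<bar> < e" "G facet_of P" "\<gamma> s \<in> G" for s G
  proof -
    have "s \<in> {0..1}" "\<bar>s - t\<bar> < d" using that(1) e by auto
    then show ?thesis using d(2) that(2,3) by blast
  qed
  have hinge: "hinged A B" if "A facet_of P" "B facet_of P" "\<gamma> t \<in> A" "\<gamma> t \<in> B" "A \<noteq> B" for A B
    unfolding hinged_def using that x by blast
  show ?thesis
  proof (cases "K \<noteq> L \<and> \<gamma> t \<in> L")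
    case two: True
    then have hKL: "hinged K L" using KL by blast
    have "F = K \<or> F = L"
    proof (rule ccontr)
      assume ne: "\<not> (F = K \<or> F = L)"
      then have "hinged K F" using hinge[of K F] KL F c(2) by blast
      from third_facet[OF hKL this, of "\<gamma> t"] show False using two c(2) F x ne by blast
    qed
    then show ?thesis
    proof
      assume "F = K"
      then show ?thesis using c(1) e two by (intro exI[of _ L] exI[of _ l] exI[of _ e]) simp
    next
      assume "F = L"
      moreover have "chart \<gamma> t L K (\<lambda>s. hinge_mirror K L (l s)) e"
        by (rule chart_swap[OF c(1)]) (use two in blast)
      moreover have "L \<noteq> K" using two by blast
      ultimately show ?thesis using c(2) e
        by (intro exI[of _ K] exI[of _ "\<lambda>s. hinge_mirror K L (l s)"] exI[of _ e]) simp
    qed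
  next
    case one: False
    have run: "\<gamma> s = l s \<and> l s \<in> K" if "\<bar>s - t\<bar> < e" for s
      using alt[OF that] near[OF that KL(2)] one by blast
    have "l t = \<gamma> t" using run[of t] e(1) by simp
    show ?thesis
    proof (cases "\<exists>H. hinged F H \<and> \<gamma> t \<in> H")
      case False
      then have "K = F" using hinge[of F K] F KL(1) c(2) by blast
      have "chart \<gamma> t F F l e" unfolding chart_def using F(1) KL(4) e(1) run \<open>K = F\<close> by simp
      then show ?thesis using False e by (intro exI[of _ F] exI[of _ l] exI[of _ e]) auto
    next
      case True
      then obtain H where H: "hinged F H" "\<gamma> t \<in> H" by blast
      then have FH: "F \<noteq> H" "H facet_of P" by (auto simp: hinged_def)
      have KFH: "K = F \<or> K = H"
      proof (rule ccontr)
        assume ne: "\<not> (K = F \<or> K = H)"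
        then have "hinged F K" using hinge[of F K] KL F c(2) by blast
        from third_facet[OF H(1) this, of "\<gamma> t"] show False using H c(2) F x ne by blast
      qed
      have "\<forall>s. \<bar>s - t\<bar> < e \<longrightarrow> l s \<in> P" using run facet_of_imp_subset[OF KL(1)] by blast
      moreover have "l t \<in> F \<inter> H" using \<open>l t = \<gamma> t\<close> F H by simp
      ultimately have fixed: "hinge_mirror F H (l s) = l s" for s using tangent_line_in_edge[OF H(1) KL(4) e(1)] by blast
      have "chart \<gamma> t F H l e"
        unfolding chart_def using F(1) FH H(1) KL(4) e(1) run KFH by (auto simp: fixed)
      then show ?thesis using FH H(2) e by (intro exI[of _ H] exI[of _ l] exI[of _ e]) simp
    qed
  qed
qed

text \<open>Canonical charts of both curves at the common point use the same faces. Since the curves agree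
  before \<open>t\<close>, the lines in the charts agree, and a line determines the curve on both sides of \<open>t\<close>.\<close>

lemma geodesics_agree_beyond:
  assumes cont: "continuous_on {0..1} \<gamma>" "continuous_on {0..1} \<gamma>'"
    and t: "0 < t" "t < 1" and st: "straight_at P \<gamma> t" "straight_at P \<gamma>' t"
    and x: "\<gamma> t = \<gamma>' t" "\<gamma> t \<notin> S"
    and ag: "a < t" "0 \<le> a" "\<forall>s. a < s \<and> s < t \<longrightarrow> \<gamma> s = \<gamma>' s"
  shows "\<exists>\<delta>>0. \<delta> \<le> 1 - t \<and> (\<forall>s. \<bar>s - t\<bar> < \<delta> \<longrightarrow> \<gamma> s = \<gamma>' s)"
proof -
  have t01: "t \<in> {0..1}" using t by simp
  obtain F where F: "F facet_of P" "\<gamma> t \<in> F"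
  proof -
    obtain A B l e where c: "chart \<gamma> t A B l e" using chart_exists[OF st(1)] by blast
    then have "\<gamma> t \<in> A \<or> \<gamma> t \<in> B" "A facet_of P" "B facet_of P"
      using chart_at[OF c t01] by (auto simp: chart_def)
    then show thesis using that by blast
  qed
  obtain H l d where c: "chart \<gamma> t F H l d" "d \<le> t" "d \<le> 1 - t"
    "if F = H then \<forall>G. hinged F G \<longrightarrow> \<gamma> t \<notin> G else \<gamma> t \<in> H"
    using canonical_chart[OF cont(1) t st(1) x(2) F] by blast
  obtain H' l' d' where c': "chart \<gamma>' t F H' l' d'" "d' \<le> t" "d' \<le> 1 - t"
    "if F = H' then \<forall>G. hinged F G \<longrightarrow> \<gamma>' t \<notin> G else \<gamma>' t \<in> H'"
    using canonical_chart[OF cont(2) t st(2)] x F by metis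
  have hd: "F = H \<or> hinged F H" "F = H' \<or> hinged F H'" "line l" "line l'" "d > 0" "d' > 0"
    using c(1) c'(1) by (auto simp: chart_def)
  have HH: "H' = H"
  proof (cases "F = H")
    case True
    then show ?thesis using c(4) c'(4) hd(2) x(1) by (auto split: if_splits)
  next
    case False
    then have h: "hinged F H" "\<gamma> t \<in> H" using hd(1) c(4) by auto
    then have "F \<noteq> H'" using c'(4) x(1) by auto
    then have "hinged F H'" "\<gamma> t \<in> H'" using hd(2) c'(4) x(1) by auto
    with third_facet[OF h(1) this(1), of "\<gamma> t"] show ?thesis using h(2) F(2) x(2) by blast
  qed
  note c'1 = c'(1)[unfolded HH]
  have ll: "l' = l"
  proof -
    define a0 where "a0 = max a (max (t - d) (t - d'))"
    have a0: "a0 < t" "0 \<le> a0" "t \<le> 1" "t - d \<le> a0" "t \<le> t + d" using ag t hd(5,6) by (auto simp: a0_def)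
    obtain a1 b1 where 1: "a0 \<le> a1" "a1 < b1" "b1 \<le> t"
      "runs \<gamma> F l a1 b1 \<or> F \<noteq> H \<and> runs \<gamma> H (\<lambda>s. hinge_mirror F H (l s)) a1 b1"
      by (rule chart_runs[OF c(1) a0]) (rule that)
    have a1: "0 \<le> a1" "b1 \<le> 1" "t - d' \<le> a1" "b1 \<le> t + d'"
      using 1 t hd(6) ag by (auto simp: a0_def)
    obtain a2 b2 where 2: "a1 \<le> a2" "a2 < b2" "b2 \<le> b1"
      "runs \<gamma>' F l' a2 b2 \<or> F \<noteq> H \<and> runs \<gamma>' H (\<lambda>s. hinge_mirror F H (l' s)) a2 b2"
      by (rule chart_runs[OF c'1 1(2) a1]) (rule that)
    have "\<gamma>' s = \<gamma> s" if "a2 < s" "s < b2" for s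
      using ag(3) that 1 2 by (auto simp: a0_def)
    then have r': "runs \<gamma> G k a2 b2" if "runs \<gamma>' G k a2 b2" for G k
      using that unfolding runs_def by auto
    have r1: "runs \<gamma> F l a2 b2 \<or> F \<noteq> H \<and> runs \<gamma> H (\<lambda>s. hinge_mirror F H (l s)) a2 b2"
      using 1(4) runs_subset[OF _ 2(1,3)] by blast
    have r2: "runs \<gamma> F l' a2 b2 \<or> F \<noteq> H \<and> runs \<gamma> H (\<lambda>s. hinge_mirror F H (l' s)) a2 b2"
      using 2(4) r' by blast
    note U = runs_unique[OF _ _ 2(2)]
    have inv: "l s = l' s" if "hinge_mirror F H (l s) = hinge_mirror F H (l' s)" for s
      using arg_cong[OF that, of "hinge_mirror F H"] by simp
    \<comment> \<open>If the curve is seen in different faces, it runs along the edge, where the reflection is the identity.\<close>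
    from r1 r2 show ?thesis
    proof (elim disjE conjE)
      assume "runs \<gamma> F l a2 b2" "runs \<gamma> F l' a2 b2"
      from U(1)[OF this] show ?thesis by simp
    next
      assume A: "runs \<gamma> F l a2 b2" "runs \<gamma> H (\<lambda>s. hinge_mirror F H (l' s)) a2 b2" and ne: "F \<noteq> H"
      have e: "l s = hinge_mirror F H (l' s)" for s using fun_cong[OF U(1)[OF A]] .
      have f: "hinge_mirror F H (l s) = l s" for s using U(2)[OF A ne] by blast
      have "l s = l' s" for s using inv[of s] e[of s] f[of s] by simp
      then show ?thesis by auto
    next
      assume A: "runs \<gamma> F l' a2 b2" "runs \<gamma> H (\<lambda>s. hinge_mirror F H (l s)) a2 b2" and ne: "F \<noteq> H"
      have e: "l' s = hinge_mirror F H (l s)" for s using fun_cong[OF U(1)[OF A]] .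
      have f: "hinge_mirror F H (l' s) = l' s" for s using U(2)[OF A ne] by blast
      have "l s = l' s" for s using inv[of s] e[of s] f[of s] by simp
      then show ?thesis by auto
    next
      assume A: "runs \<gamma> H (\<lambda>s. hinge_mirror F H (l s)) a2 b2" "runs \<gamma> H (\<lambda>s. hinge_mirror F H (l' s)) a2 b2"
      have "l s = l' s" for s using inv[OF fun_cong[OF U(1)[OF A]]] .
      then show ?thesis by auto
    qed
  qed
  have "\<gamma> s = \<gamma>' s" if "\<bar>s - t\<bar> < min d d'" for s
  proof -
    have s: "s \<in> {0..1}" "\<bar>s - t\<bar> < d" "\<bar>s - t\<bar> < d'" using that c(2,3) by auto
    have fx: "hinge_mirror F H (l s) = l s" if "F \<noteq> H" "l s \<in> F" "hinge_mirror F H (l s) \<in> H"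
      using hinge_mirror_fixes that hd(1) by blast
    from chart_at[OF c(1) s(1,2)] chart_at[OF c'1 s(1,3)] show ?thesis
      unfolding ll using fx by (elim disjE conjE) simp_all
  qed
  then show ?thesis using hd(5,6) c(3) by (intro exI[of _ "min d d'"]) auto
qed

text \<open>Otherwise there is a first time after which the curves differ. They agree there by continuity, and
  beyond it by the preceding lemma.\<close>

lemma geodesics_agree:
  assumes cont: "continuous_on {0..1} \<gamma>" "continuous_on {0..1} \<gamma>'"
    and st: "\<forall>t\<in>{0..1}. straight_at P \<gamma> t" "\<forall>t\<in>{0..1}. straight_at P \<gamma>' t"
    and nv: "\<forall>t\<in>{0<..<1}. \<gamma> t \<notin> S"
    and t0: "0 < t0" "t0 < 1" and ag: "\<delta> > 0" "\<forall>s. \<bar>s - t0\<bar> < \<delta> \<longrightarrow> \<gamma> s = \<gamma>' s"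
  shows "\<gamma> 1 = \<gamma>' 1"
proof (rule ccontr)
  assume neq: "\<gamma> 1 \<noteq> \<gamma>' 1"
  define B where "B = {s \<in> {t0..1}. \<gamma> s \<noteq> \<gamma>' s}"
  define t where "t = Inf B"
  have B1: "1 \<in> B" using neq t0 by (simp add: B_def)
  have bdd: "bdd_below B" by (rule bdd_belowI[of _ t0]) (simp add: B_def)
  have "t \<le> 1" unfolding t_def by (rule cInf_lower[OF B1 bdd])
  have Bge: "t0 + \<delta> \<le> s" if "s \<in> B" for s
  proof (rule ccontr)
    assume "\<not> t0 + \<delta> \<le> s"
    then have "\<bar>s - t0\<bar> < \<delta>" using that by (auto simp: B_def)
    then show False using ag(2) that by (simp add: B_def)
  qed
  have "t0 + \<delta> \<le> t" unfolding t_def by (rule cInf_greatest) (use B1 Bge in auto)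
  then have tt: "t0 < t" using ag(1) by simp
  have before: "\<gamma> s = \<gamma>' s" if "t0 \<le> s" "s < t" for s
  proof (rule ccontr)
    assume "\<gamma> s \<noteq> \<gamma>' s"
    then have "s \<in> B" using that \<open>t \<le> 1\<close> by (simp add: B_def)
    then have "t \<le> s" unfolding t_def by (rule cInf_lower[OF _ bdd])
    then show False using that by simp
  qed
  have cl: "closure {t0..<t} = {t0..t}" using tt by simp
  have cs: "continuous_on (closure {t0..<t}) (\<lambda>s. \<gamma> s - \<gamma>' s)"
    unfolding cl using cont t0 \<open>t \<le> 1\<close>
    by (intro continuous_on_diff) (auto elim: continuous_on_subset)
  have "\<gamma> t - \<gamma>' t = 0"
    by (rule continuous_constant_on_closure[OF cs]) (use before tt cl in auto)
  then have tx: "\<gamma> t = \<gamma>' t" by simp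
  then have "t < 1" using neq \<open>t \<le> 1\<close> by (cases "t = 1") auto
  have tI: "0 < t" "t \<in> {0..1}" using t0 tt \<open>t < 1\<close> by auto
  obtain d where d: "d > 0" "d \<le> 1 - t" "\<forall>s. \<bar>s - t\<bar> < d \<longrightarrow> \<gamma> s = \<gamma>' s"
    using geodesics_agree_beyond[OF cont tI(1) \<open>t < 1\<close> st(1)[rule_format, OF tI(2)]
       st(2)[rule_format, OF tI(2)] tx, of t0] nv tI(1) \<open>t < 1\<close> tt t0(1) before by auto
  have "t + d \<le> t"
    unfolding t_def
  proof (rule cInf_greatest)
    fix s assume s: "s \<in> B"
    have "t \<le> s" unfolding t_def by (rule cInf_lower[OF s bdd])
    show "Inf B + d \<le> s"
    proof (rule ccontr)
      assume "\<not> Inf B + d \<le> s"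
      then have "\<bar>s - t\<bar> < d" using \<open>t \<le> s\<close> by (simp add: t_def)
      then show False using d(3) s by (simp add: B_def)
    qed
  qed (use B1 in auto)
  then show False using d(1) by simp
qed

subsection \<open>Reversal of a geodesic by a half-turn\<close>

lemma hinged_not_flat:
  assumes "hinged F H"
  obtains y where "y \<in> F" "y \<bullet> mid F H < mid F H \<bullet> mid F H"
proof -
  obtain p q r where e: "S \<inter> (F \<inter> H) = {p, q}" "p \<bullet> q = c" "corner sq N c p q r" "S \<inter> F = tile sq p q r"
    using hinged_edge[OF assms] by metis
  have pqr: "p \<in> S" "q \<in> S" "r \<in> F" using e(1) corner_in[OF e(4)] by auto
  have "p \<noteq> q" using e(2) norm[OF pqr(1)] c_less by auto
  then have m: "mid F H = (1/2) *\<^sub>R (p + q)" by (simp add: mid_def e(1))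
  have "r \<bullet> (p + q) < N + c"
    using e(3) c_less by (auto simp: corner_def inner_add_right inner_commute split: if_splits)
  moreover have "mid F H \<bullet> mid F H = (1/2) * (N + c)"
    using adjacent_sum(1)[OF pqr(1,2) e(2)] by (simp add: m)
  moreover have "r \<bullet> mid F H = (1/2) * (r \<bullet> (p + q))" unfolding m by (simp only: inner_scaleR_right)
  ultimately show thesis using that[OF pqr(3)] by simp
qed

text \<open>The reversed image under the half-turn is a geodesic too. If it agrees with the curve near the
  middle, it agrees everywhere, so the half-turn exchanges the end points and thus fixes the vertex
  at which both lie.\<close>

lemma no_geodesic_reversed:
  assumes cont: "continuous_on {0..1} \<gamma>" and st: "\<forall>t\<in>{0..1}. straight_at P \<gamma> t"
    and nv: "\<forall>t\<in>{0<..<1}. \<gamma> t \<notin> S" and ends: "\<gamma> 0 \<in> S" "\<gamma> 1 = \<gamma> 0"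
    and h: "half_turn m ` P = P" "\<forall>v\<in>S. half_turn m v \<noteq> v"
    and ag: "\<delta> > 0" "\<forall>s. \<bar>s - 1/2\<bar> < \<delta> \<longrightarrow> \<gamma> s = half_turn m (\<gamma> (1 - s))"
  shows False
proof -
  define \<gamma>' where "\<gamma>' s = half_turn m (\<gamma> (1 - s))" for s
  have cr: "continuous_on {0..1} (\<lambda>s. \<gamma> (1 - s))"
    by (rule continuous_on_compose2[OF cont]) (auto intro!: continuous_intros)
  have cg: "continuous_on {0..1} \<gamma>'"
    unfolding \<gamma>'_def[abs_def] by (rule linear_continuous_on_compose[OF cr linear_half_turn])
  have sg: "\<forall>t\<in>{0..1}. straight_at P \<gamma>' t"
  proof
    fix t :: real assume "t \<in> {0..1}"
    then have "straight_at P \<gamma> (1 - t)" using st by simp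
    then have "straight_at P (\<lambda>s. \<gamma> (1 - s)) (1 - (1 - t))" by (rule straight_at_reverse)
    then have "straight_at P (\<lambda>s. \<gamma> (1 - s)) t" by simp
    then have "straight_at (half_turn m ` P) (half_turn m \<circ> (\<lambda>s. \<gamma> (1 - s))) t"
      by (rule straight_at_similarity[OF similarity_half_turn])
    then show "straight_at P \<gamma>' t" by (simp add: h(1) \<gamma>'_def[abs_def] comp_def)
  qed
  have "\<gamma> 1 = \<gamma>' 1"
    by (rule geodesics_agree[OF cont cg st sg nv _ _ ag(1) ag(2)[folded \<gamma>'_def]]) simp_all
  then have "half_turn m (\<gamma> 0) = \<gamma> 0" using ends(2) by (simp add: \<gamma>'_def)
  then show False using ends(1) h(2) by blast
qed

theorem no_closed_saddle_connection: "\<not> closed_saddle_connection P \<gamma>"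
proof
  assume c: "closed_saddle_connection P \<gamma>"
  have cont: "continuous_on {0..1} \<gamma>" and st: "\<forall>t\<in>{0..1}. straight_at P \<gamma> t"
    and nv: "\<forall>t\<in>{0<..<1}. \<gamma> t \<notin> S" and ends: "\<gamma> 0 \<in> S" "\<gamma> 1 = \<gamma> 0"
    using c unfolding closed_saddle_connection_def saddle_connection_def
    by (auto simp: path_def pathstart_def pathfinish_def extreme_iff_vertex)
  have half: "(1/2::real) \<in> {0..1}" "0 < (1/2::real)" "(1/2::real) < 1" by auto
  define x where "x = \<gamma> (1/2)"
  have xS: "x \<notin> S" using nv by (simp add: x_def)
  have sth: "straight_at P \<gamma> (1/2)" using st half(1) by blast
  obtain F H l e where ch: "chart \<gamma> (1/2) F H l e" and lx: "l (1/2) = x" "x \<in> F"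
  proof -
    obtain F H l e where ch: "chart \<gamma> (1/2) F H l e" using chart_exists[OF sth] by blast
    then have "e > 0" by (simp add: chart_def)
    then have "\<bar>1/2 - 1/2 :: real\<bar> < e" by simp
    then consider "\<gamma> (1/2) = l (1/2)" "l (1/2) \<in> F"
      | "F \<noteq> H" "\<gamma> (1/2) = hinge_mirror F H (l (1/2))" "\<gamma> (1/2) \<in> H"
      using chart_at[OF ch half(1)] by blast
    then show thesis
    proof cases
      case 1 then show thesis using that[OF ch] by (simp add: x_def)
    next
      case 2 then show thesis using that[OF chart_swap[OF ch 2(1)]] by (simp add: x_def)
    qed
  qed
  have F: "F facet_of P" and l: "line l" using ch by (auto simp: chart_def)
  have lat: "l 0 \<in> lattice (S \<inter> F)" "l 1 \<in> lattice (S \<inter> F)"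
    using lattice_along_geodesic[OF st _ _ half(1) ch] ends by simp_all
  have xm: "x = (1/2) *\<^sub>R (l 0 + l 1)"
    using l lx(1) unfolding line_def by (auto simp: scaleR_add_right simp flip: scaleR_add_left)
  have sym: "k (1 - s) = 2 *\<^sub>R x - k s" if "line k" "k (1/2) = x" for k s
  proof -
    obtain p u where k: "k = (\<lambda>s. p + s *\<^sub>R u)" using \<open>line k\<close> unfolding line_def by blast
    have "2 *\<^sub>R x = 2 *\<^sub>R p + u" using that(2) unfolding k by (auto simp: scaleR_add_right)
    then show ?thesis unfolding k by (simp add: algebra_simps scaleR_2)
  qed
  show False
  proof (rule center_symmetry[OF F lat xm lx(2) xS])
    \<comment> \<open>The curve crosses an edge at its midpoint. The half-turn and the reflection differ by the point reflection in \<open>x\<close>, which reverses the line.\<close>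
    fix H' assume H': "hinged F H'" "mid F H' = x"
    let ?h = "half_turn x" and ?r = "mirror x"
    have hF: "?h ` F = H'" "?h ` P = P" "\<forall>v\<in>S. ?h v \<noteq> v" using hinged_mid(4-6)[OF H'(1)] H'(2) by auto
    have "?h x \<in> ?h ` F" using lx(2) by (rule imageI)
    then have xH: "x \<in> H'" using hF(1) by simp
    obtain G k d where k: "chart \<gamma> (1/2) F G k d" "d \<le> 1/2"
      "if F = G then \<forall>G. hinged F G \<longrightarrow> \<gamma> (1/2) \<notin> G else \<gamma> (1/2) \<in> G"
      using canonical_chart[OF cont half(2,3) sth xS[unfolded x_def] F lx(2)[unfolded x_def]] by blast
    have "F \<noteq> G" using k(3) H'(1) xH by (auto simp: x_def)
    then have FG: "hinged F G" "x \<in> G" using k by (auto simp: chart_def x_def)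
    have "G = H'" by (rule third_facet[OF H'(1) FG(1), of x]) (use xH lx(2) FG(2) xS in auto)
    note k1 = k(1)[unfolded \<open>G = H'\<close>]
    have kl: "line k" and d: "d > 0" using k1 by (auto simp: chart_def)
    have alt: "\<gamma> s = k s \<and> k s \<in> F \<or> \<gamma> s = ?r (k s) \<and> ?r (k s) \<in> H'" if "\<bar>s - 1/2\<bar> < d" for s
    proof -
      have "s \<in> {0..1}" using that k(2) by (simp add: abs_less_iff)
      then show ?thesis using chart_at[OF k1 _ that] unfolding H'(2) by auto
    qed
    have rx: "?r x = x" by (simp add: mirror_def scaleR_2)
    have "k (1/2) = x"
    proof -
      from alt[of "1/2"] d have "x = k (1/2) \<or> x = ?r (k (1/2))" by (auto simp: x_def)
      then show ?thesis
      proof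
        assume "x = ?r (k (1/2))"
        then have "?r x = ?r (?r (k (1/2)))" by simp
        then show ?thesis using rx by simp
      qed simp
    qed
    then have ks: "k (1 - s) = 2 *\<^sub>R x - k s" for s by (rule sym[OF kl])
    have hr: "?h y = 2 *\<^sub>R x - ?r y" for y by (simp add: mirror_def)
    have rr: "?r (2 *\<^sub>R x - y) = 2 *\<^sub>R x - ?r y" for y
      using mirror_comb[of x x x y] rx by (simp add: scaleR_2)
    have hH: "?h ` H' = F" unfolding hF(1)[symmetric] image_image by simp
    have fx: "?r y = y" if "y \<in> F" "?r y \<in> H'" for y
      using hinge_mirror_fixes[OF H'(1)] that unfolding H'(2) by blast
    have "\<gamma> s = ?h (\<gamma> (1 - s))" if s: "\<bar>s - 1/2\<bar> < d" for s
    proof -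
      have s': "\<bar>(1 - s) - 1/2\<bar> < d" using s by (simp add: abs_minus_commute)
      have "?h (\<gamma> (1 - s)) = k s \<and> k s \<in> F \<or> ?h (\<gamma> (1 - s)) = ?r (k s) \<and> ?r (k s) \<in> H'"
        using alt[OF s']
      proof (elim disjE conjE)
        assume a: "\<gamma> (1 - s) = k (1 - s)" "k (1 - s) \<in> F"
        then have "?h (\<gamma> (1 - s)) = ?r (k s)" by (simp add: hr ks rr)
        moreover have "?h (\<gamma> (1 - s)) \<in> H'" using a hF(1) by auto
        ultimately show ?thesis by simp
      next
        assume a: "\<gamma> (1 - s) = ?r (k (1 - s))" "?r (k (1 - s)) \<in> H'"
        then have "?h (\<gamma> (1 - s)) = k s" by (simp add: hr ks)
        moreover have "?h (\<gamma> (1 - s)) \<in> F" using a hH by auto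
        ultimately show ?thesis by simp
      qed
      then show ?thesis using alt[OF s] fx[of "k s"] by (elim disjE conjE) simp_all
    qed
    then show False using no_geodesic_reversed[OF cont st nv ends hF(2,3) d] by blast
  next
    \<comment> \<open>The curve passes through the centre of a square.\<close>
    fix m assume m: "turn_axis m" "\<And>y. y \<in> F \<Longrightarrow> half_turn m y = 2 *\<^sub>R x - y"
    have hP: "half_turn m ` P = P" "\<forall>v\<in>S. half_turn m v \<noteq> v" using turn_axis_symmetry[OF m(1)] by auto
    have FP: "F \<subseteq> P" by (rule facet_of_imp_subset[OF F])
    have single: "x \<notin> G" if G: "hinged F G" for G
    proof
      assume "x \<in> G"
      then have xm: "x \<bullet> mid F G = mid F G \<bullet> mid F G" using hinged_mid(3)[OF G] lx(2) by blast
      obtain y where y: "y \<in> F" "y \<bullet> mid F G < mid F G \<bullet> mid F G"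
        by (rule hinged_not_flat[OF G]) (rule that)
      have "half_turn m y \<in> P" using hP(1) y(1) FP by blast
      then have "(2 *\<^sub>R x - y) \<bullet> mid F G \<le> mid F G \<bullet> mid F G" using hinged_mid(2)[OF G] m(2)[OF y(1)] by simp
      then show False using xm y(2) by (simp add: inner_diff_left)
    qed
    obtain G k d where k: "chart \<gamma> (1/2) F G k d" "d \<le> 1/2"
      "if F = G then \<forall>G. hinged F G \<longrightarrow> \<gamma> (1/2) \<notin> G else \<gamma> (1/2) \<in> G"
      using canonical_chart[OF cont half(2,3) sth xS[unfolded x_def] F lx(2)[unfolded x_def]] by blast
    have FG: "F = G" using k(1,3) single[of G] by (auto simp: chart_def x_def split: if_splits)
    have kl: "line k" and d: "d > 0" using k(1) by (auto simp: chart_def)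
    have alt: "\<gamma> s = k s \<and> k s \<in> F" if "\<bar>s - 1/2\<bar> < d" for s
    proof -
      have "s \<in> {0..1}" using that k(2) by (simp add: abs_less_iff)
      then show ?thesis using chart_at[OF k(1) _ that] FG by auto
    qed
    have "k (1/2) = x" using alt[of "1/2"] d by (simp add: x_def)
    then have ks: "k (1 - s) = 2 *\<^sub>R x - k s" for s by (rule sym[OF kl])
    have "\<gamma> s = half_turn m (\<gamma> (1 - s))" if s: "\<bar>s - 1/2\<bar> < d" for s
    proof -
      have s': "\<bar>(1 - s) - 1/2\<bar> < d" using s by (simp add: abs_minus_commute)
      show ?thesis using alt[OF s] alt[OF s'] m(2)[of "k (1 - s)"] by (simp add: ks)
    qed
    then show False using no_geodesic_reversed[OF cont st nv ends hP d] by blast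
  qed
qed

end

section \<open>The four vertex sets\<close>

abbreviation v3 :: "real \<Rightarrow> real \<Rightarrow> real \<Rightarrow> real^3" where "v3 x y z \<equiv> vector [x, y, z]"

lemma v3_simps [simp]:
  "v3 a b c \<bullet> v3 x y z = a * x + b * y + c * z"
  "v3 a b c + v3 x y z = v3 (a + x) (b + y) (c + z)"
  "v3 a b c - v3 x y z = v3 (a - x) (b - y) (c - z)"
  "k *\<^sub>R v3 x y z = v3 (k * x) (k * y) (k * z)"
  "numeral n * v3 x y z = v3 (numeral n * x) (numeral n * y) (numeral n * z)"
  "- v3 x y z = v3 (- x) (- y) (- z)"
  "v3 a b c = v3 x y z \<longleftrightarrow> a = x \<and> b = y \<and> c = z"
  "v3 x y z = 0 \<longleftrightarrow> x = 0 \<and> y = 0 \<and> z = 0"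
  by (auto simp: inner_vec_def sum_3 vec_eq_iff forall_3 vector_3 numeral_index)

lemma v3_cases: obtains x y z where "(v :: real^3) = v3 x y z"
proof
  show "v = v3 (v $ 1) (v $ 2) (v $ 3)" by (simp add: vec_eq_iff forall_3 vector_3)
qed

text \<open>The Gram matrix is \<open>(N - c) I + c J\<close> with the all-one matrix \<open>J\<close>; on coefficient vectors with sum
  zero it acts as multiplication by \<open>N - c\<close>.\<close>

lemma equiangular_affine_independent:
  fixes T :: "'a::euclidean_space set"
  assumes T: "finite T" "\<And>v. v \<in> T \<Longrightarrow> v \<bullet> v = N" "\<And>v w. v \<in> T \<Longrightarrow> w \<in> T \<Longrightarrow> v \<noteq> w \<Longrightarrow> v \<bullet> w = c" and "c < N"
  shows "\<not> affine_dependent T"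
proof
  assume "affine_dependent T"
  then obtain k where k: "sum k T = 0" "\<exists>v\<in>T. k v \<noteq> 0" "(\<Sum>v\<in>T. k v *\<^sub>R v) = 0"
    using affine_dependent_explicit_finite[OF T(1)] by blast
  have "k w = 0" if w: "w \<in> T" for w
  proof -
    have "0 = (\<Sum>v\<in>T. k v *\<^sub>R v) \<bullet> w" by (simp add: k(3))
    also have "\<dots> = (\<Sum>v\<in>T. k v * (v \<bullet> w))" by (simp add: inner_sum_left)
    also have "\<dots> = (\<Sum>v\<in>T. k v * c + (if v = w then k w * (N - c) else 0))"
      by (intro sum.cong refl) (use T(2,3) w in \<open>auto simp: algebra_simps\<close>)
    also have "\<dots> = k w * (N - c)"
      using T(1) w k(1) by (simp add: sum.distrib sum.delta' flip: sum_distrib_right)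
    finally show ?thesis using \<open>c < N\<close> by simp
  qed
  then show False using k(2) by blast
qed

lemma facet_hull_dim:
  fixes S :: "(real^3) set"
  assumes S: "finite S" "aff_dim S = 3" and F: "F facet_of convex hull S"
  shows "aff_dim (S \<inter> F) = 2"
proof -
  have f: "F face_of convex hull S" by (rule facet_of_imp_face_of[OF F])
  obtain S' where S': "S' \<subseteq> S" "F = convex hull S'"
    using face_of_convex_hull_subset[OF finite_imp_compact[OF S(1)] f] by metis
  have "S' \<subseteq> S \<inter> F" "S \<inter> F \<subseteq> F" using S' hull_subset[of S' convex] by auto
  then have "aff_dim S' \<le> aff_dim (S \<inter> F)" "aff_dim (S \<inter> F) \<le> aff_dim F" by (auto intro: aff_dim_subset)
  moreover have "aff_dim F = aff_dim S'" unfolding S'(2) by (rule aff_dim_convex_hull)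
  moreover have "aff_dim F = 2" using F S(2) by (simp add: facet_of_def aff_dim_convex_hull)
  ultimately show ?thesis by simp
qed

text \<open>Pairwise adjacent vertices are affinely independent, so a facet, having dimension 2, contains exactly
  three of them.\<close>

lemma triangular_facet:
  fixes S :: "(real^3) set"
  assumes S: "finite S" "aff_dim S = 3" and F: "F facet_of convex hull S"
    and norm: "\<And>v. v \<in> S \<Longrightarrow> v \<bullet> v = N" and "c < N"
    and adj: "\<And>v w. v \<in> S \<inter> F \<Longrightarrow> w \<in> S \<inter> F \<Longrightarrow> v \<noteq> w \<Longrightarrow> v \<bullet> w = c"
  shows "\<exists>p q r. corner False N c p q r \<and> S \<inter> F = tile False p q r"
proof -
  have fin: "finite (S \<inter> F)" using S(1) by simp
  have "\<not> affine_dependent (S \<inter> F)"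
    by (rule equiangular_affine_independent[OF fin _ adj \<open>c < N\<close>]) (use norm in auto)
  then have "int (card (S \<inter> F)) = 3"
    using aff_dim_affine_independent[of "S \<inter> F"] facet_hull_dim[OF S F] by simp
  then have "card (S \<inter> F) = 3" by simp
  then obtain p q r where e: "S \<inter> F = {p, q, r}" and d: "p \<noteq> q" "p \<noteq> r" "q \<noteq> r"
    unfolding card_3_iff by auto
  have "p \<bullet> q = c" "p \<bullet> r = c" "q \<bullet> r = c"
    by (rule adj; use d e in simp)+
  then have "corner False N c p q r" by (simp add: corner_def)
  then show ?thesis using e unfolding tile_def by auto
qed

lemma symmetric_aff_dim:
  fixes S :: "(real^3) set"
  assumes sym: "\<And>v. v \<in> S \<Longrightarrow> - v \<in> S" and ne: "S \<noteq> {}" and sp: "\<And>a. \<forall>v\<in>S. a \<bullet> v = 0 \<Longrightarrow> a = 0"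
  shows "aff_dim S = 3"
proof (rule ccontr)
  assume "aff_dim S \<noteq> 3"
  moreover have "aff_dim S \<le> 3" using aff_dim_le_DIM[of S] by simp
  ultimately have "aff_dim S < DIM(real^3)" by simp
  then obtain a b where a: "a \<noteq> 0" "S \<subseteq> {x. a \<bullet> x = b}" by (rule aff_lowdim_subset_hyperplane)
  have "a \<bullet> v = 0" if v: "v \<in> S" for v
  proof -
    have "a \<bullet> v = b" "a \<bullet> (- v) = b" using a(2) v sym[OF v] by blast+
    then show ?thesis by simp
  qed
  then show False using sp a(1) by blast
qed

lemma symmetric_facet_support:
  fixes S :: "(real^3) set"
  assumes S: "finite S" and sym: "\<And>v. v \<in> S \<Longrightarrow> - v \<in> S" and ne: "S \<noteq> {}"
    and sp: "\<And>a. \<forall>v\<in>S. a \<bullet> v = 0 \<Longrightarrow> a = 0" and F: "F facet_of convex hull S"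
  obtains a b where "b > 0" "\<forall>v\<in>S. a \<bullet> v \<le> b" "S \<inter> F = {v \<in> S. a \<bullet> v = b}"
proof -
  have "polyhedron (convex hull S)" using S by (simp add: polytope_imp_polyhedron polytope_convex_hull)
  then obtain a b where ab: "a \<noteq> 0" "convex hull S \<subseteq> {x. a \<bullet> x \<le> b}" "F = convex hull S \<inter> {x. a \<bullet> x = b}"
    using facet_of_polyhedron[OF _ F] by metis
  have le: "\<forall>v\<in>S. a \<bullet> v \<le> b" using ab(2) hull_subset[of S convex] by blast
  have abs: "\<bar>a \<bullet> v\<bar> \<le> b" if v: "v \<in> S" for v
    using bspec[OF le v] bspec[OF le sym[OF v]] by (simp add: abs_le_iff)
  have "b \<noteq> 0"
  proof
    assume "b = 0"
    then have "\<forall>v\<in>S. a \<bullet> v = 0" using abs by fastforce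
    then show False using sp ab(1) by blast
  qed
  moreover have "b \<ge> 0" using ne abs by fastforce
  ultimately have "b > 0" by simp
  moreover have "S \<inter> F = {v \<in> S. a \<bullet> v = b}" using ab(3) hull_subset[of S convex] by blast
  ultimately show thesis using le that by blast
qed

text \<open>Let \<open>a \<bullet> x = b\<close> with \<open>b > 0\<close> be the plane of a facet. Two nonadjacent vertices \<open>p\<close>, \<open>q\<close> cannot both lie on it if
  they are antipodal, nor if some multiple \<open>k *\<^sub>R (p + q)\<close> with \<open>k > 1\<close> is the sum of two vertices \<open>r\<close>, \<open>s\<close>,
  since then \<open>a \<bullet> (r + s) > 2 * b\<close>. The second alternative says that the midpoint of \<open>p\<close> and \<open>q\<close> lies below
  that of \<open>r\<close> and \<open>s\<close>, as for two vertices of the icosahedron at distance two.\<close>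

lemma centrally_symmetric_triangular_solid:
  fixes S :: "(real^3) set"
  assumes S: "finite S" and sym: "\<And>v. v \<in> S \<Longrightarrow> - v \<in> S" and ne: "S \<noteq> {}"
    and sp: "\<And>a. \<forall>v\<in>S. a \<bullet> v = 0 \<Longrightarrow> a = 0"
    and norm: "\<And>v. v \<in> S \<Longrightarrow> v \<bullet> v = N" and c: "c < N" "- N < c"
    and cls: "\<And>p q. p \<in> S \<Longrightarrow> q \<in> S \<Longrightarrow> p \<noteq> q \<Longrightarrow>
       p \<bullet> q = c \<or> p \<bullet> q < c \<and> (q = - p \<or> (\<exists>k>1. \<exists>r\<in>S. \<exists>s\<in>S. r + s = k *\<^sub>R (p + q)))"
    and turn: "\<And>p q v. p \<in> S \<Longrightarrow> q \<in> S \<Longrightarrow> p \<bullet> q = c \<Longrightarrow> v \<in> S \<Longrightarrow> half_turn (p + q) v \<in> S - {v}"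
  shows "reversible_solid S N c False"
proof
  show "v \<bullet> w \<le> c" if "v \<in> S" "w \<in> S" "v \<noteq> w" for v w using cls[OF that] by auto
  show "half_turn (p + q) v \<in> S - {v}"
    if "p \<in> S" "q \<in> S" "p \<bullet> q = c \<or> False \<and> p \<bullet> q = 2 * c - N \<and> p + q \<noteq> 0" "v \<in> S" for p q v
    using turn that by blast
  fix F assume F: "F facet_of convex hull S"
  obtain a b where ab: "b > 0" "\<forall>v\<in>S. a \<bullet> v \<le> b" "S \<inter> F = {v \<in> S. a \<bullet> v = b}"
    by (rule symmetric_facet_support[OF S sym ne sp F]) (auto intro: that)
  show "\<exists>p q r. corner False N c p q r \<and> S \<inter> F = tile False p q r"
  proof (rule triangular_facet[OF S symmetric_aff_dim[OF sym ne sp] F norm c(1)])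
    fix v w assume "v \<in> S \<inter> F" "w \<in> S \<inter> F" and ne: "v \<noteq> w"
    then have vw: "v \<in> S" "w \<in> S" "a \<bullet> v = b" "a \<bullet> w = b" using ab(3) by auto
    show "v \<bullet> w = c"
    proof (rule ccontr)
      assume "v \<bullet> w \<noteq> c"
      then consider "w = - v" | k r s where "k > 1" "r \<in> S" "s \<in> S" "r + s = k *\<^sub>R (v + w)"
        using cls[OF vw(1,2) ne] by blast
      then show False
      proof cases
        case 1 then show False using vw ab(1) by simp
      next
        case 2
        have "a \<bullet> (r + s) = k * (b + b)" unfolding 2(4) using vw(3,4) by (simp add: inner_add_right)
        moreover have "a \<bullet> r \<le> b" "a \<bullet> s \<le> b" using ab(2) 2 by auto
        ultimately have "k * (b + b) \<le> 1 * (b + b)" by (simp add: inner_add_right)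
        then show False using 2(1) ab(1) by simp
      qed
    qed
  qed
qed (use S norm c in auto)

subsection \<open>Tetrahedron\<close>

definition tetrahedron_vertices :: "(real^3) set" where
  "tetrahedron_vertices = {v3 1 1 1, v3 1 (-1) (-1), v3 (-1) 1 (-1), v3 (-1) (-1) 1}"

lemma reversible_tetrahedron: "reversible_solid tetrahedron_vertices 3 (-1) False"
proof
  let ?S = tetrahedron_vertices
  show fin: "finite ?S" by (simp add: tetrahedron_vertices_def)
  show norm: "v \<bullet> v = 3" if "v \<in> ?S" for v using that by (auto simp: tetrahedron_vertices_def)
  have ip: "v \<bullet> w = -1" if "v \<in> ?S" "w \<in> ?S" "v \<noteq> w" for v w
    using that by (auto simp: tetrahedron_vertices_def)
  then show "v \<bullet> w \<le> -1" if "v \<in> ?S" "w \<in> ?S" "v \<noteq> w" for v w using that by simp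
  show "half_turn (p + q) v \<in> ?S - {v}"
    if "p \<in> ?S" "q \<in> ?S" "p \<bullet> q = -1 \<or> False \<and> p \<bullet> q = 2 * (-1) - 3 \<and> p + q \<noteq> 0" "v \<in> ?S" for p q v
    using that by (auto simp: tetrahedron_vertices_def half_turn_def)
  fix F assume F: "F facet_of convex hull ?S"
  have "\<not> affine_dependent ?S" by (rule equiangular_affine_independent[OF fin norm ip]) auto
  then have "aff_dim ?S = int (card ?S) - 1" using aff_dim_affine_independent[of ?S] by simp
  moreover have "card ?S = 4" by (simp add: tetrahedron_vertices_def)
  ultimately have ad: "aff_dim ?S = 3" by simp
  show "\<exists>p q r. corner False 3 (-1) p q r \<and> ?S \<inter> F = tile False p q r"
    by (rule triangular_facet[OF fin ad F norm]) (auto intro!: ip)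
qed auto

subsection \<open>Octahedron\<close>

definition octahedron_vertices :: "(real^3) set" where
  "octahedron_vertices = {v3 1 0 0, v3 (-1) 0 0, v3 0 1 0, v3 0 (-1) 0, v3 0 0 1, v3 0 0 (-1)}"

lemma reversible_octahedron: "reversible_solid octahedron_vertices 1 0 False"
proof (rule centrally_symmetric_triangular_solid)
  let ?S = octahedron_vertices
  show "finite ?S" "?S \<noteq> {}" by (simp_all add: octahedron_vertices_def)
  show "- v \<in> ?S" if "v \<in> ?S" for v using that by (auto simp: octahedron_vertices_def)
  show "v \<bullet> v = 1" if "v \<in> ?S" for v using that by (auto simp: octahedron_vertices_def)
  show "a = 0" if "\<forall>v\<in>?S. a \<bullet> v = 0" for a
    using that by (cases a rule: v3_cases) (auto simp: octahedron_vertices_def)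
  show "p \<bullet> q = 0 \<or> p \<bullet> q < 0 \<and> (q = - p \<or> (\<exists>k>1. \<exists>r\<in>?S. \<exists>s\<in>?S. r + s = k *\<^sub>R (p + q)))"
    if "p \<in> ?S" "q \<in> ?S" "p \<noteq> q" for p q
  proof -
    have "p \<bullet> q = 0 \<or> p \<bullet> q < 0 \<and> q = - p" using that by (auto simp: octahedron_vertices_def)
    then show ?thesis by blast
  qed
  show "half_turn (p + q) v \<in> ?S - {v}" if "p \<in> ?S" "q \<in> ?S" "p \<bullet> q = 0" "v \<in> ?S" for p q v
    using that by (auto simp: octahedron_vertices_def half_turn_def)
qed auto

subsection \<open>Transport by coordinate symmetries\<close>

definition flip :: "real \<Rightarrow> real \<Rightarrow> real \<Rightarrow> real^3 \<Rightarrow> real^3" where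
  "flip a b c v = v3 (a * v $ 1) (b * v $ 2) (c * v $ 3)"

definition cycle :: "real^3 \<Rightarrow> real^3" where
  "cycle v = v3 (v $ 3) (v $ 1) (v $ 2)"

lemma flip_v3 [simp]: "flip a b c (v3 x y z) = v3 (a * x) (b * y) (c * z)"
  by (simp add: flip_def vector_3)

lemma cycle_v3 [simp]: "cycle (v3 x y z) = v3 z x y"
  by (simp add: cycle_def vector_3)

lemma orthogonal_flip:
  assumes "a \<in> {1, -1}" "b \<in> {1, -1}" "c \<in> {1, -1}"
  shows "orthogonal_transformation (flip a b c)"
  unfolding orthogonal_transformation_def
proof
  show "linear (flip a b c)"
    by (rule linearI) (auto simp: flip_def vec_eq_iff forall_3 vector_3 algebra_simps)
  show "\<forall>v w. flip a b c v \<bullet> flip a b c w = v \<bullet> w"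
    using assms by (auto simp: flip_def inner_vec_def sum_3 vector_3)
qed

lemma orthogonal_cycle: "orthogonal_transformation cycle"
  unfolding orthogonal_transformation_def
proof
  show "linear cycle"
    by (rule linearI) (auto simp: cycle_def vec_eq_iff forall_3 vector_3)
  show "\<forall>v w. cycle v \<bullet> cycle w = v \<bullet> w"
    by (auto simp: cycle_def inner_vec_def sum_3 vector_3)
qed

lemma half_turn_orthogonal:
  assumes "orthogonal_transformation g"
  shows "half_turn (g m) (g v) = g (half_turn m v)"
proof -
  have l: "linear g" and i: "\<And>v w. g v \<bullet> g w = v \<bullet> w"
    using assms by (auto simp: orthogonal_transformation_def)
  show ?thesis by (simp add: half_turn_def i linear_diff[OF l] linear_scale[OF l])
qed

lemma orthogonal_onto:
  assumes g: "orthogonal_transformation g" and S: "finite S" "g ` S \<subseteq> S"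
  shows "g ` S = S"
  using endo_inj_surj[OF S inj_on_subset[OF orthogonal_transformation_inj[OF g]]] by simp

text \<open>The symmetry condition of the locale at one vertex \<open>p\<close>. It is invariant under symmetries of \<open>S\<close>, so that
  checking it at one vertex suffices.\<close>

definition turnable :: "(real^3) set \<Rightarrow> (real \<Rightarrow> bool) \<Rightarrow> real^3 \<Rightarrow> bool" where
  "turnable S A p \<longleftrightarrow> (\<forall>q\<in>S. \<forall>v\<in>S. A (p \<bullet> q) \<longrightarrow> half_turn (p + q) v \<in> S - {v})"

lemma turnable_orthogonal:
  assumes g: "orthogonal_transformation g" and S: "g ` S = S" and p: "turnable S A p"
  shows "turnable S A (g p)"
  unfolding turnable_def
proof (intro ballI impI)
  fix q v assume "q \<in> S" "v \<in> S" and A: "A (g p \<bullet> q)"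
  then have "q \<in> g ` S" "v \<in> g ` S" using S by simp_all
  then obtain q' v' where *: "q' \<in> S" "q = g q'" "v' \<in> S" "v = g v'" by blast
  have l: "linear g" and i: "\<And>v w. g v \<bullet> g w = v \<bullet> w"
    using g by (auto simp: orthogonal_transformation_def)
  have "A (p \<bullet> q')" using A by (simp add: *(2) i)
  then have h: "half_turn (p + q') v' \<in> S" "half_turn (p + q') v' \<noteq> v'"
    using p *(1,3) unfolding turnable_def by blast+
  have e: "half_turn (g p + q) v = g (half_turn (p + q') v')"
    unfolding *(2,4) linear_add[OF l, symmetric] by (rule half_turn_orthogonal[OF g])
  have "g (half_turn (p + q') v') \<in> S" using h(1) S by blast
  moreover have "g (half_turn (p + q') v') \<noteq> g v'"
    using h(2) orthogonal_transformation_inj[OF g] by (simp add: inj_eq)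
  ultimately show "half_turn (g p + q) v \<in> S - {v}" unfolding e unfolding *(4) by simp
qed

subsection \<open>Cube\<close>

definition cube_vertices :: "(real^3) set" where
  "cube_vertices = {v3 1 1 1, v3 1 1 (-1), v3 1 (-1) 1, v3 1 (-1) (-1),
     v3 (-1) 1 1, v3 (-1) 1 (-1), v3 (-1) (-1) 1, v3 (-1) (-1) (-1)}"

lemma cube_vertex_iff: "v3 x y z \<in> cube_vertices \<longleftrightarrow> x \<in> {1, -1} \<and> y \<in> {1, -1} \<and> z \<in> {1, -1}"
  by (auto simp: cube_vertices_def)

lemma cube_vertex_cases:
  assumes "v \<in> cube_vertices"
  obtains x y z where "v = v3 x y z" "x \<in> {1, -1}" "y \<in> {1, -1}" "z \<in> {1, -1}"
  using assms by (cases v rule: v3_cases) (simp add: cube_vertex_iff)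

lemma cube_turnable:
  assumes "p \<in> cube_vertices"
  shows "turnable cube_vertices (\<lambda>t. t = 1 \<or> t = -1) p"
proof -
  have base: "turnable cube_vertices (\<lambda>t. t = 1 \<or> t = -1) (v3 1 1 1)"
    unfolding turnable_def
  proof (intro ballI impI)
    fix q v assume q: "q \<in> cube_vertices" and v: "v \<in> cube_vertices"
      and a: "v3 1 1 1 \<bullet> q = 1 \<or> v3 1 1 1 \<bullet> q = -1"
    obtain x y z where v: "v = v3 x y z" "x \<in> {1, -1}" "y \<in> {1, -1}" "z \<in> {1, -1}"
      by (rule cube_vertex_cases[OF v]) (rule that)
    from q a have "q \<in> {v3 1 1 (-1), v3 1 (-1) 1, v3 (-1) 1 1, v3 1 (-1) (-1), v3 (-1) 1 (-1), v3 (-1) (-1) 1}"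
      by (auto simp: cube_vertices_def)
    \<comment> \<open>The axes are the lines through \<open>(1, 1, 0)\<close> and \<open>(1, 0, 0)\<close> and their coordinate permutations.\<close>
    then have "half_turn (v3 1 1 1 + q) v \<in> {v3 y x (- z), v3 z (- y) x, v3 (- x) z y,
       v3 x (- y) (- z), v3 (- x) y (- z), v3 (- x) (- y) z}"
      by (auto simp: half_turn_def v(1) add_divide_distrib)
    then show "half_turn (v3 1 1 1 + q) v \<in> cube_vertices - {v}"
      using v(2-4) by (auto simp: v(1) cube_vertex_iff)
  qed
  obtain x y z where p: "p = v3 x y z" "x \<in> {1, -1}" "y \<in> {1, -1}" "z \<in> {1, -1}"
    by (rule cube_vertex_cases[OF assms]) (rule that)
  note o = orthogonal_flip[OF p(2-4)]
  have "flip x y z ` cube_vertices \<subseteq> cube_vertices"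
  proof
    fix w assume "w \<in> flip x y z ` cube_vertices"
    then obtain v where "v \<in> cube_vertices" "w = flip x y z v" by blast
    then show "w \<in> cube_vertices"
      using p(2-4) by (elim cube_vertex_cases) (auto simp: cube_vertex_iff)
  qed
  then have "flip x y z ` cube_vertices = cube_vertices"
    by (intro orthogonal_onto[OF o]) (simp_all add: cube_vertices_def)
  from turnable_orthogonal[OF o this base] show ?thesis by (simp add: p(1))
qed

text \<open>A vertex maximizes \<open>a\<close> only if its coordinates agree in sign with the nonzero coordinates of \<open>a\<close>. Two nonzero
  coordinates of \<open>a\<close> would leave at most two such vertices, so \<open>a\<close> is a coordinate direction.\<close>

lemma cube_facet_vertices:
  assumes b: "b > 0" and le: "\<forall>v\<in>cube_vertices. a \<bullet> v \<le> b"
    and T: "T = {v \<in> cube_vertices. a \<bullet> v = b}" and card: "card T \<ge> 3"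
  shows "\<exists>p q r. corner True 3 1 p q r \<and> T = tile True p q r"
proof -
  obtain x y z where a: "a = v3 x y z" by (rule v3_cases)
  have sgn: "(x \<noteq> 0 \<longrightarrow> t1 = sgn x) \<and> (y \<noteq> 0 \<longrightarrow> t2 = sgn y) \<and> (z \<noteq> 0 \<longrightarrow> t3 = sgn z)"
    if t: "v3 t1 t2 t3 \<in> T" for t1 t2 t3
  proof -
    have tt: "t1 \<in> {1, -1}" "t2 \<in> {1, -1}" "t3 \<in> {1, -1}" and e: "x * t1 + y * t2 + z * t3 = b"
      using t by (auto simp: T cube_vertex_iff a)
    have "v3 (- t1) t2 t3 \<in> cube_vertices" "v3 t1 (- t2) t3 \<in> cube_vertices" "v3 t1 t2 (- t3) \<in> cube_vertices"
      using tt by (auto simp: cube_vertex_iff)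
    then have "a \<bullet> v3 (- t1) t2 t3 \<le> b" "a \<bullet> v3 t1 (- t2) t3 \<le> b" "a \<bullet> v3 t1 t2 (- t3) \<le> b"
      using le by blast+
    then have "0 \<le> x * t1" "0 \<le> y * t2" "0 \<le> z * t3" using e by (simp_all add: a)
    then show ?thesis using tt by (auto simp: sgn_if)
  qed
  have small: False if "T \<subseteq> {v, w}" for v w
  proof -
    have "card T \<le> card {v, w}" by (rule card_mono) (use that in auto)
    also have "\<dots> \<le> 2" by (simp add: card_insert_if)
    finally show False using card by simp
  qed
  have TS: "\<exists>t1 t2 t3. v = v3 t1 t2 t3 \<and> t1 \<in> {1, -1} \<and> t2 \<in> {1, -1} \<and> t3 \<in> {1, -1}" if "v \<in> T" for v
  proof -
    have "v \<in> cube_vertices" using that T by simp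
    then obtain t1 t2 t3 where "v = v3 t1 t2 t3" "t1 \<in> {1, -1}" "t2 \<in> {1, -1}" "t3 \<in> {1, -1}"
      by (rule cube_vertex_cases) (rule that)
    then show ?thesis by blast
  qed
  have "\<not> (x \<noteq> 0 \<and> y \<noteq> 0)"
  proof
    assume nz: "x \<noteq> 0 \<and> y \<noteq> 0"
    have "T \<subseteq> {v3 (sgn x) (sgn y) 1, v3 (sgn x) (sgn y) (-1)}"
    proof
      fix v assume v: "v \<in> T"
      then obtain t1 t2 t3 where t: "v = v3 t1 t2 t3" "t1 \<in> {1, -1}" "t2 \<in> {1, -1}" "t3 \<in> {1, -1}"
        using TS by blast
      show "v \<in> {v3 (sgn x) (sgn y) 1, v3 (sgn x) (sgn y) (-1)}"
        using sgn[of t1 t2 t3] v t nz by auto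
    qed
    then show False by (rule small)
  qed
  moreover have "\<not> (x \<noteq> 0 \<and> z \<noteq> 0)"
  proof
    assume nz: "x \<noteq> 0 \<and> z \<noteq> 0"
    have "T \<subseteq> {v3 (sgn x) 1 (sgn z), v3 (sgn x) (-1) (sgn z)}"
    proof
      fix v assume v: "v \<in> T"
      then obtain t1 t2 t3 where t: "v = v3 t1 t2 t3" "t1 \<in> {1, -1}" "t2 \<in> {1, -1}" "t3 \<in> {1, -1}"
        using TS by blast
      show "v \<in> {v3 (sgn x) 1 (sgn z), v3 (sgn x) (-1) (sgn z)}"
        using sgn[of t1 t2 t3] v t nz by auto
    qed
    then show False by (rule small)
  qed
  moreover have "\<not> (y \<noteq> 0 \<and> z \<noteq> 0)"
  proof
    assume nz: "y \<noteq> 0 \<and> z \<noteq> 0"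
    have "T \<subseteq> {v3 1 (sgn y) (sgn z), v3 (-1) (sgn y) (sgn z)}"
    proof
      fix v assume v: "v \<in> T"
      then obtain t1 t2 t3 where t: "v = v3 t1 t2 t3" "t1 \<in> {1, -1}" "t2 \<in> {1, -1}" "t3 \<in> {1, -1}"
        using TS by blast
      show "v \<in> {v3 1 (sgn y) (sgn z), v3 (-1) (sgn y) (sgn z)}"
        using sgn[of t1 t2 t3] v t nz by auto
    qed
    then show False by (rule small)
  qed
  moreover have "\<not> (x = 0 \<and> y = 0 \<and> z = 0)"
  proof
    assume "x = 0 \<and> y = 0 \<and> z = 0"
    then have "T = {}" using b by (auto simp: T a elim!: cube_vertex_cases)
    then show False using card by simp
  qed
  ultimately consider "x \<noteq> 0" "y = 0" "z = 0" | "y \<noteq> 0" "x = 0" "z = 0" | "z \<noteq> 0" "x = 0" "y = 0" by blast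
  then show ?thesis
  proof cases
    case 1
    define s where "s = sgn x"
    have s: "s = 1 \<or> s = -1" using 1(1) by (auto simp: s_def sgn_if)
    have "T \<noteq> {}" using card by auto
    then obtain t1 t2 t3 where t: "v3 t1 t2 t3 \<in> T" using TS by blast
    have bs: "b = x * s" using t sgn[OF t] 1 by (auto simp: T a s_def)
    have "T = {v3 s 1 1, v3 s 1 (-1), v3 s (-1) 1, v3 s (-1) (-1)}"
    proof (intro set_eqI iffI)
      fix v assume v: "v \<in> T"
      then obtain u1 u2 u3 where u: "v = v3 u1 u2 u3" "u1 \<in> {1, -1}" "u2 \<in> {1, -1}" "u3 \<in> {1, -1}"
        using TS by blast
      then show "v \<in> {v3 s 1 1, v3 s 1 (-1), v3 s (-1) 1, v3 s (-1) (-1)}"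
        using sgn[of u1 u2 u3] v 1(1) by (auto simp: s_def)
    next
      fix v assume "v \<in> {v3 s 1 1, v3 s 1 (-1), v3 s (-1) 1, v3 s (-1) (-1)}"
      then show "v \<in> T" using s 1(2,3) by (auto simp: T a bs cube_vertex_iff)
    qed
    then have "T = tile True (v3 s 1 1) (v3 s 1 (-1)) (v3 s (-1) 1)"
      by (simp add: tile_def)
    moreover have "corner True 3 1 (v3 s 1 1) (v3 s 1 (-1)) (v3 s (-1) 1)"
      using s by (auto simp: corner_def)
    ultimately show ?thesis by blast
  next
    case 2
    define s where "s = sgn y"
    have s: "s = 1 \<or> s = -1" using 2(1) by (auto simp: s_def sgn_if)
    have "T \<noteq> {}" using card by auto
    then obtain t1 t2 t3 where t: "v3 t1 t2 t3 \<in> T" using TS by blast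
    have bs: "b = y * s" using t sgn[OF t] 2 by (auto simp: T a s_def)
    have "T = {v3 1 s 1, v3 1 s (-1), v3 (-1) s 1, v3 (-1) s (-1)}"
    proof (intro set_eqI iffI)
      fix v assume v: "v \<in> T"
      then obtain u1 u2 u3 where u: "v = v3 u1 u2 u3" "u1 \<in> {1, -1}" "u2 \<in> {1, -1}" "u3 \<in> {1, -1}"
        using TS by blast
      then show "v \<in> {v3 1 s 1, v3 1 s (-1), v3 (-1) s 1, v3 (-1) s (-1)}"
        using sgn[of u1 u2 u3] v 2(1) by (auto simp: s_def)
    next
      fix v assume "v \<in> {v3 1 s 1, v3 1 s (-1), v3 (-1) s 1, v3 (-1) s (-1)}"
      then show "v \<in> T" using s 2(2,3) by (auto simp: T a bs cube_vertex_iff)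
    qed
    then have "T = tile True (v3 1 s 1) (v3 1 s (-1)) (v3 (-1) s 1)"
      by (simp add: tile_def)
    moreover have "corner True 3 1 (v3 1 s 1) (v3 1 s (-1)) (v3 (-1) s 1)"
      using s by (auto simp: corner_def)
    ultimately show ?thesis by blast
  next
    case 3
    define s where "s = sgn z"
    have s: "s = 1 \<or> s = -1" using 3(1) by (auto simp: s_def sgn_if)
    have "T \<noteq> {}" using card by auto
    then obtain t1 t2 t3 where t: "v3 t1 t2 t3 \<in> T" using TS by blast
    have bs: "b = z * s" using t sgn[OF t] 3 by (auto simp: T a s_def)
    have "T = {v3 1 1 s, v3 1 (-1) s, v3 (-1) 1 s, v3 (-1) (-1) s}"
    proof (intro set_eqI iffI)
      fix v assume v: "v \<in> T"
      then obtain u1 u2 u3 where u: "v = v3 u1 u2 u3" "u1 \<in> {1, -1}" "u2 \<in> {1, -1}" "u3 \<in> {1, -1}"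
        using TS by blast
      then show "v \<in> {v3 1 1 s, v3 1 (-1) s, v3 (-1) 1 s, v3 (-1) (-1) s}"
        using sgn[of u1 u2 u3] v 3(1) by (auto simp: s_def)
    next
      fix v assume "v \<in> {v3 1 1 s, v3 1 (-1) s, v3 (-1) 1 s, v3 (-1) (-1) s}"
      then show "v \<in> T" using s 3(2,3) by (auto simp: T a bs cube_vertex_iff)
    qed
    then have "T = tile True (v3 1 1 s) (v3 1 (-1) s) (v3 (-1) 1 s)"
      by (simp add: tile_def)
    moreover have "corner True 3 1 (v3 1 1 s) (v3 1 (-1) s) (v3 (-1) 1 s)"
      using s by (auto simp: corner_def)
    ultimately show ?thesis by blast
  qed
qed

lemma reversible_cube: "reversible_solid cube_vertices 3 1 True"
proof
  let ?S = cube_vertices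
  show fin: "finite ?S" by (simp add: cube_vertices_def)
  show norm: "v \<bullet> v = 3" if "v \<in> ?S" for v using that by (auto simp: cube_vertices_def)
  show "v \<bullet> w \<le> 1" if "v \<in> ?S" "w \<in> ?S" "v \<noteq> w" for v w
    using that by (elim cube_vertex_cases) auto
  show "half_turn (p + q) v \<in> ?S - {v}"
    if "p \<in> ?S" "q \<in> ?S" "p \<bullet> q = 1 \<or> True \<and> p \<bullet> q = 2 * 1 - 3 \<and> p + q \<noteq> 0" "v \<in> ?S" for p q v
  proof -
    have "p \<bullet> q = 1 \<or> p \<bullet> q = -1" using that(3) by auto
    then show ?thesis using cube_turnable[OF that(1)] that(2,4) unfolding turnable_def by blast
  qed
  have sym: "- v \<in> ?S" if "v \<in> ?S" for v
    using that by (elim cube_vertex_cases) (auto simp: cube_vertex_iff)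
  have ne: "?S \<noteq> {}" by (simp add: cube_vertices_def)
  have sp: "a = 0" if "\<forall>v\<in>?S. a \<bullet> v = 0" for a
    using that by (cases a rule: v3_cases) (auto simp: cube_vertices_def)
  fix F assume F: "F facet_of convex hull ?S"
  obtain a b where ab: "b > 0" "\<forall>v\<in>?S. a \<bullet> v \<le> b" "?S \<inter> F = {v \<in> ?S. a \<bullet> v = b}"
    by (rule symmetric_facet_support[OF fin sym ne sp F]) (auto intro: that)
  have "aff_dim (?S \<inter> F) = 2" by (rule facet_hull_dim[OF fin symmetric_aff_dim[OF sym ne sp] F]) auto
  moreover have "aff_dim (?S \<inter> F) \<le> int (card (?S \<inter> F)) - 1" using fin by (intro aff_dim_le_card) simp
  ultimately have "card (?S \<inter> F) \<ge> 3" by simp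
  then show "\<exists>p q r. corner True 3 1 p q r \<and> ?S \<inter> F = tile True p q r"
    by (rule cube_facet_vertices[OF ab])
qed auto

subsection \<open>Icosahedron\<close>

abbreviation \<phi> :: real where "\<phi> \<equiv> golden_ratio"

lemma golden: "\<phi> * \<phi> = \<phi> + 1" "\<phi> > 1"
proof -
  have "(1 + sqrt 5) * (1 + sqrt 5) = 2 * (1 + sqrt 5) + 4" by (simp add: algebra_simps)
  then show "\<phi> * \<phi> = \<phi> + 1" unfolding golden_ratio_def by (simp only: times_divide_times_eq) simp
  have "sqrt 5 > sqrt 1" by (intro real_sqrt_less_mono) simp
  then show "\<phi> > 1" by (simp add: golden_ratio_def)
qed

lemma golden': "\<phi> * (\<phi> * x) = \<phi> * x + x"
  unfolding mult.assoc[symmetric] golden(1) by (simp add: distrib_right)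

definition icosahedron_vertices :: "(real^3) set" where
  "icosahedron_vertices =
    {v3 0 1 \<phi>, v3 0 1 (- \<phi>), v3 0 (-1) \<phi>, v3 0 (-1) (- \<phi>),
     v3 \<phi> 0 1, v3 \<phi> 0 (-1), v3 (- \<phi>) 0 1, v3 (- \<phi>) 0 (-1),
     v3 1 \<phi> 0, v3 1 (- \<phi>) 0, v3 (-1) \<phi> 0, v3 (-1) (- \<phi>) 0}"

lemma icosahedron_vertex_iff: "v3 x y z \<in> icosahedron_vertices \<longleftrightarrow>
    x = 0 \<and> (y = 1 \<or> y = -1) \<and> (z = \<phi> \<or> z = - \<phi>) \<or>
    y = 0 \<and> (z = 1 \<or> z = -1) \<and> (x = \<phi> \<or> x = - \<phi>) \<or>
    z = 0 \<and> (x = 1 \<or> x = -1) \<and> (y = \<phi> \<or> y = - \<phi>)"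
  unfolding icosahedron_vertices_def insert_iff empty_iff v3_simps by argo

lemma icosahedron_vertex_cases:
  assumes "v \<in> icosahedron_vertices"
  obtains b c where "b = 1 \<or> b = -1" "c = \<phi> \<or> c = - \<phi>" "v = v3 0 b c \<or> v = v3 c 0 b \<or> v = v3 b c 0"
proof -
  obtain x y z where v: "v = v3 x y z" by (rule v3_cases)
  show thesis using assms that unfolding v icosahedron_vertex_iff by blast
qed

lemma icosahedron_flip:
  assumes "a \<in> {1, -1}" "b \<in> {1, -1}" "c \<in> {1, -1}"
  shows "flip a b c ` icosahedron_vertices = icosahedron_vertices"
proof (rule orthogonal_onto[OF orthogonal_flip[OF assms]])
  show "flip a b c ` icosahedron_vertices \<subseteq> icosahedron_vertices"
  proof
    fix w assume "w \<in> flip a b c ` icosahedron_vertices"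
    then obtain v where v: "v \<in> icosahedron_vertices" "w = flip a b c v" by blast
    obtain s t where "s = 1 \<or> s = -1" "t = \<phi> \<or> t = - \<phi>" "v = v3 0 s t \<or> v = v3 t 0 s \<or> v = v3 s t 0"
      by (rule icosahedron_vertex_cases[OF v(1)]) (rule that)
    then show "w \<in> icosahedron_vertices"
      using assms unfolding v(2) by (elim disjE insertE emptyE) (simp_all add: icosahedron_vertex_iff)
  qed
qed (simp add: icosahedron_vertices_def)

lemma icosahedron_cycle: "cycle ` icosahedron_vertices = icosahedron_vertices"
proof (rule orthogonal_onto[OF orthogonal_cycle])
  show "cycle ` icosahedron_vertices \<subseteq> icosahedron_vertices"
  proof
    fix w assume "w \<in> cycle ` icosahedron_vertices"
    then obtain v where v: "v \<in> icosahedron_vertices" "w = cycle v" by blast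
    obtain s t where "s = 1 \<or> s = -1" "t = \<phi> \<or> t = - \<phi>" "v = v3 0 s t \<or> v = v3 t 0 s \<or> v = v3 s t 0"
      by (rule icosahedron_vertex_cases[OF v(1)]) (rule that)
    then show "w \<in> icosahedron_vertices"
      unfolding v(2) by (elim disjE) (simp_all add: icosahedron_vertex_iff)
  qed
qed (simp add: icosahedron_vertices_def)

text \<open>Sign changes and cyclic permutations of the coordinates act transitively on the vertices.\<close>

lemma icosahedron_orbit:
  assumes base: "Q (v3 0 1 \<phi>)" and p: "p \<in> icosahedron_vertices"
    and step: "\<And>g p. orthogonal_transformation g \<Longrightarrow> g ` icosahedron_vertices = icosahedron_vertices \<Longrightarrow> Q p \<Longrightarrow> Q (g p)"
  shows "Q p"
proof -
  have 1: "Q (v3 0 b (c * \<phi>))" if "b \<in> {1, -1}" "c \<in> {1, -1}" for b c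
    using step[OF orthogonal_flip[of 1 b c] icosahedron_flip[of 1 b c] base] that by simp
  have r: "Q (v3 z x y)" if "Q (v3 x y z)" for x y z
    using step[OF orthogonal_cycle icosahedron_cycle that] by simp
  have 2: "Q (v3 (c * \<phi>) 0 b)" if "b \<in> {1, -1}" "c \<in> {1, -1}" for b c by (rule r[OF 1[OF that]])
  have 3: "Q (v3 b (c * \<phi>) 0)" if "b \<in> {1, -1}" "c \<in> {1, -1}" for b c by (rule r[OF 2[OF that]])
  obtain s t where st: "s = 1 \<or> s = -1" "t = \<phi> \<or> t = - \<phi>" "p = v3 0 s t \<or> p = v3 t 0 s \<or> p = v3 s t 0"
    by (rule icosahedron_vertex_cases[OF p]) (rule that)
  obtain c where c: "c \<in> {1, -1}" "t = c * \<phi>" using st(2) by (elim disjE) (simp_all add: that[of 1] that[of "-1"])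
  have "s \<in> {1, -1}" using st(1) by simp
  from st(3) 1[OF this c(1)] 2[OF this c(1)] 3[OF this c(1)] show ?thesis unfolding c(2) by blast
qed

lemma half_turn_unit:
  assumes "n \<bullet> n = 1" "k \<noteq> 0" shows "half_turn (k *\<^sub>R n) v = (2 * (v \<bullet> n)) *\<^sub>R n - v"
  unfolding half_turn_scale[OF assms(2)] by (simp add: half_turn_def assms(1))

lemma icosahedron_turnable_base: "turnable icosahedron_vertices (\<lambda>t. t = \<phi>) (v3 0 1 \<phi>)"
  unfolding turnable_def
proof (intro ballI impI)
  fix q v assume q: "q \<in> icosahedron_vertices" and v: "v \<in> icosahedron_vertices" and a: "v3 0 1 \<phi> \<bullet> q = \<phi>"
  have f0: "2 * \<phi> \<noteq> 0" using golden(2) by simp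
  have "q \<in> {v3 0 (-1) \<phi>, v3 \<phi> 0 1, v3 (- \<phi>) 0 1, v3 1 \<phi> 0, v3 (-1) \<phi> 0}"
    using q a golden by (auto simp: icosahedron_vertices_def)
  \<comment> \<open>Unit vectors along the five axes through edge midpoints next to the vertex \<open>(0, 1, \<phi>)\<close>, using \<open>1 / \<phi> = \<phi> - 1\<close>.\<close>
  then consider "v3 0 1 \<phi> + q = (2 * \<phi>) *\<^sub>R v3 0 0 1"
    | s where "s = 1 \<or> s = -1" "v3 0 1 \<phi> + q = (2 * \<phi>) *\<^sub>R v3 (s / 2) ((\<phi> - 1) / 2) (\<phi> / 2)"
    | s where "s = 1 \<or> s = -1" "v3 0 1 \<phi> + q = (2 * \<phi>) *\<^sub>R v3 (s * (\<phi> - 1) / 2) (\<phi> / 2) (1 / 2)"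
  proof -
    assume A: "v3 0 1 \<phi> + q = (2 * \<phi>) *\<^sub>R v3 0 0 1 \<Longrightarrow> thesis"
      and B: "\<And>s. s = 1 \<or> s = - 1 \<Longrightarrow> v3 0 1 \<phi> + q = (2 * \<phi>) *\<^sub>R v3 (s / 2) ((\<phi> - 1) / 2) (\<phi> / 2) \<Longrightarrow> thesis"
      and C: "\<And>s. s = 1 \<or> s = - 1 \<Longrightarrow> v3 0 1 \<phi> + q = (2 * \<phi>) *\<^sub>R v3 (s * (\<phi> - 1) / 2) (\<phi> / 2) (1 / 2) \<Longrightarrow> thesis"
    assume "q \<in> {v3 0 (-1) \<phi>, v3 \<phi> 0 1, v3 (- \<phi>) 0 1, v3 1 \<phi> 0, v3 (-1) \<phi> 0}"
    then show thesis
      using A B[of 1] B[of "-1"] C[of 1] C[of "-1"] by (auto simp: algebra_simps golden golden')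
  qed
  then show "half_turn (v3 0 1 \<phi> + q) v \<in> icosahedron_vertices - {v}"
  proof cases
    case 1
    have "v3 0 0 1 \<bullet> v3 0 0 1 = 1" by simp
    from half_turn_unit[OF this f0] show ?thesis
      unfolding 1 using v golden(2) by (auto simp: icosahedron_vertices_def)
  next
    case 2
    let ?n = "v3 (s / 2) ((\<phi> - 1) / 2) (\<phi> / 2)"
    have n: "?n \<bullet> ?n = 1" using 2(1) by (auto simp: field_simps golden golden')
    show ?thesis
      unfolding 2(2) half_turn_unit[OF n f0] using v 2(1) golden(2)
      by (auto simp: icosahedron_vertices_def field_simps golden golden')
  next
    case 3
    let ?n = "v3 (s * (\<phi> - 1) / 2) (\<phi> / 2) (1 / 2)"
    have n: "?n \<bullet> ?n = 1" using 3(1) by (auto simp: field_simps golden golden')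
    show ?thesis
      unfolding 3(2) half_turn_unit[OF n f0] using v 3(1) golden(2)
      by (auto simp: icosahedron_vertices_def field_simps golden golden')
  qed
qed

text \<open>The classification of pairs required for solids with triangular faces, at one vertex.\<close>

definition adjacent_or_dominated :: "(real^3) set \<Rightarrow> real \<Rightarrow> real^3 \<Rightarrow> bool" where
  "adjacent_or_dominated S c p \<longleftrightarrow> (\<forall>q\<in>S. q \<noteq> p \<longrightarrow>
     p \<bullet> q = c \<or> p \<bullet> q < c \<and> (q = - p \<or> (\<exists>k>1. \<exists>r\<in>S. \<exists>s\<in>S. r + s = k *\<^sub>R (p + q))))"

lemma adjacent_or_dominated_orthogonal:
  assumes g: "orthogonal_transformation g" and S: "g ` S = S" and p: "adjacent_or_dominated S c p"
  shows "adjacent_or_dominated S c (g p)"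
  unfolding adjacent_or_dominated_def
proof (intro ballI impI)
  fix q assume "q \<in> S" and ne: "q \<noteq> g p"
  then have "q \<in> g ` S" using S by simp
  then obtain q' where q': "q' \<in> S" "q = g q'" by blast
  have l: "linear g" and i: "\<And>v w. g v \<bullet> g w = v \<bullet> w"
    using g by (auto simp: orthogonal_transformation_def)
  have "q' \<noteq> p" using ne q'(2) by auto
  with p q'(1) have "p \<bullet> q' = c \<or> p \<bullet> q' < c \<and> (q' = - p \<or> (\<exists>k>1. \<exists>r\<in>S. \<exists>s\<in>S. r + s = k *\<^sub>R (p + q')))"
    unfolding adjacent_or_dominated_def by blast
  then show "g p \<bullet> q = c \<or> g p \<bullet> q < c \<and> (q = - g p \<or> (\<exists>k>1. \<exists>r\<in>S. \<exists>s\<in>S. r + s = k *\<^sub>R (g p + q)))"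
  proof (elim disjE conjE exE bexE)
    assume "p \<bullet> q' = c" then show ?thesis by (simp add: q'(2) i)
  next
    assume "p \<bullet> q' < c" "q' = - p" then show ?thesis by (simp add: q'(2) i flip: linear_neg[OF l])
  next
    fix k r s assume *: "p \<bullet> q' < c" "k > 1" "r \<in> S" "s \<in> S" "r + s = k *\<^sub>R (p + q')"
    have "g r + g s = k *\<^sub>R (g p + q)"
      using arg_cong[OF *(5), of g] by (simp add: q'(2) linear_add[OF l] linear_scale[OF l])
    moreover have "g r \<in> S" "g s \<in> S" using *(3,4) S by auto
    ultimately show ?thesis using *(1,2) by (auto simp: q'(2) i)
  qed
qed

text \<open>For a vertex \<open>q\<close> at distance two from \<open>p\<close>, the two common neighbours \<open>r\<close>, \<open>s\<close> of \<open>p\<close> and \<open>q\<close> satisfy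
  \<open>r + s = \<phi> (p + q)\<close>: the half-turn about the edge \<open>r s\<close> exchanges \<open>p\<close> and \<open>q\<close>.\<close>

lemma icosahedron_dominated_base: "adjacent_or_dominated icosahedron_vertices \<phi> (v3 0 1 \<phi>)"
  unfolding adjacent_or_dominated_def
proof (intro ballI impI)
  let ?S = icosahedron_vertices and ?p = "v3 0 1 \<phi>"
  fix q assume q: "q \<in> ?S" "q \<noteq> ?p"
  have dom: "?p \<bullet> q = \<phi> \<or> ?p \<bullet> q < \<phi> \<and> (q = - ?p \<or> (\<exists>k>1. \<exists>r\<in>?S. \<exists>s\<in>?S. r + s = k *\<^sub>R (?p + q)))"
    if "?p \<bullet> q = - \<phi>" "r \<in> ?S" "s \<in> ?S" "r + s = \<phi> *\<^sub>R (?p + q)" for r s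
    using that golden(2) by force
  have "?p \<bullet> q = \<phi> \<or> q = - ?p \<or> q \<in> {v3 0 1 (- \<phi>), v3 \<phi> 0 (-1), v3 (- \<phi>) 0 (-1), v3 1 (- \<phi>) 0, v3 (-1) (- \<phi>) 0}"
    using q by (auto simp: icosahedron_vertices_def golden)
  then show "?p \<bullet> q = \<phi> \<or> ?p \<bullet> q < \<phi> \<and> (q = - ?p \<or> (\<exists>k>1. \<exists>r\<in>?S. \<exists>s\<in>?S. r + s = k *\<^sub>R (?p + q)))"
  proof (elim disjE insertE)
    assume "q = v3 0 1 (- \<phi>)"
    then show ?thesis by (intro dom[of "v3 1 \<phi> 0" "v3 (-1) \<phi> 0"]) (auto simp: icosahedron_vertices_def golden algebra_simps)
  next
    assume "q = v3 \<phi> 0 (-1)"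
    then show ?thesis by (intro dom[of "v3 1 \<phi> 0" "v3 \<phi> 0 1"]) (auto simp: icosahedron_vertices_def golden algebra_simps)
  next
    assume "q = v3 (- \<phi>) 0 (-1)"
    then show ?thesis by (intro dom[of "v3 (-1) \<phi> 0" "v3 (- \<phi>) 0 1"]) (auto simp: icosahedron_vertices_def golden algebra_simps)
  next
    assume "q = v3 1 (- \<phi>) 0"
    then show ?thesis by (intro dom[of "v3 \<phi> 0 1" "v3 0 (-1) \<phi>"]) (auto simp: icosahedron_vertices_def golden algebra_simps)
  next
    assume "q = v3 (-1) (- \<phi>) 0"
    then show ?thesis by (intro dom[of "v3 (- \<phi>) 0 1" "v3 0 (-1) \<phi>"]) (auto simp: icosahedron_vertices_def golden algebra_simps)
  next
    assume "q = - ?p"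
    then show ?thesis using golden by simp
  qed auto
qed

lemma reversible_icosahedron: "reversible_solid icosahedron_vertices (\<phi> + 2) \<phi> False"
proof (rule centrally_symmetric_triangular_solid)
  let ?S = icosahedron_vertices
  show "finite ?S" "?S \<noteq> {}" by (simp_all add: icosahedron_vertices_def)
  show "- v \<in> ?S" if "v \<in> ?S" for v using that by (auto simp: icosahedron_vertices_def)
  show "v \<bullet> v = \<phi> + 2" if "v \<in> ?S" for v using that by (auto simp: icosahedron_vertices_def golden)
  show "a = 0" if "\<forall>v\<in>?S. a \<bullet> v = 0" for a
  proof -
    obtain x y z where a: "a = v3 x y z" by (rule v3_cases)
    have "a \<bullet> v3 0 1 \<phi> = 0" "a \<bullet> v3 0 (-1) \<phi> = 0" "a \<bullet> v3 \<phi> 0 1 = 0" "a \<bullet> v3 \<phi> 0 (-1) = 0"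
      "a \<bullet> v3 1 \<phi> 0 = 0" "a \<bullet> v3 (-1) \<phi> 0 = 0"
      by (rule bspec[OF that]; simp add: icosahedron_vertex_iff)+
    then have "x = 0" "y = 0" "z = 0" unfolding a v3_simps by linarith+
    then show ?thesis by (simp add: a)
  qed
  show "p \<bullet> q = \<phi> \<or> p \<bullet> q < \<phi> \<and> (q = - p \<or> (\<exists>k>1. \<exists>r\<in>?S. \<exists>s\<in>?S. r + s = k *\<^sub>R (p + q)))"
    if "p \<in> ?S" "q \<in> ?S" "p \<noteq> q" for p q
  proof -
    have "adjacent_or_dominated ?S \<phi> p"
      by (rule icosahedron_orbit[where Q = "adjacent_or_dominated ?S \<phi>", OF icosahedron_dominated_base that(1)])
        (rule adjacent_or_dominated_orthogonal)
    then show ?thesis using that(2) that(3)[symmetric] unfolding adjacent_or_dominated_def by blast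
  qed
  show "half_turn (p + q) v \<in> ?S - {v}" if "p \<in> ?S" "q \<in> ?S" "p \<bullet> q = \<phi>" "v \<in> ?S" for p q v
  proof -
    have "turnable ?S (\<lambda>t. t = \<phi>) p"
      by (rule icosahedron_orbit[where Q = "turnable ?S (\<lambda>t. t = \<phi>)", OF icosahedron_turnable_base that(1)])
        (rule turnable_orthogonal)
    then show ?thesis using that(2-4) unfolding turnable_def by blast
  qed
qed (use golden(2) in auto)

section \<open>The theorem\<close>

lemma std_vertices:
  "std_tetrahedron = convex hull tetrahedron_vertices"
  "std_octahedron = convex hull octahedron_vertices"
  "std_cube = convex hull cube_vertices"
  "std_icosahedron = convex hull icosahedron_vertices"
proof -
  show "std_tetrahedron = convex hull tetrahedron_vertices"
    by (simp add: std_tetrahedron_def tetrahedron_vertices_def)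
  have s1: "{f a | a. a \<in> {-1, 1::real}} = {f 1, f (-1)}" for f :: "real \<Rightarrow> real^3" by auto
  have s2: "{f a b | a b. a \<in> {-1, 1::real} \<and> b \<in> {-1, 1::real}} = {f 1 1, f 1 (-1), f (-1) 1, f (-1) (-1)}"
    for f :: "real \<Rightarrow> real \<Rightarrow> real^3" by blast
  have s3: "{f a b c | a b c. a \<in> {-1, 1::real} \<and> b \<in> {-1, 1::real} \<and> c \<in> {-1, 1::real}} =
     {f 1 1 1, f 1 1 (-1), f 1 (-1) 1, f 1 (-1) (-1), f (-1) 1 1, f (-1) 1 (-1), f (-1) (-1) 1, f (-1) (-1) (-1)}"
    for f :: "real \<Rightarrow> real \<Rightarrow> real \<Rightarrow> real^3" by blast
  show "std_octahedron = convex hull octahedron_vertices"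
    unfolding std_octahedron_def octahedron_vertices_def s1 by (simp add: insert_commute Un_commute)
  show "std_cube = convex hull cube_vertices"
    unfolding std_cube_def cube_vertices_def s3 by simp
  show "std_icosahedron = convex hull icosahedron_vertices"
    unfolding std_icosahedron_def icosahedron_vertices_def s2
    by (intro arg_cong[where f = "\<lambda>X. convex hull X"]) auto
qed

lemma similar_to_convex_hull_no_closed_saddle_connection:
  assumes "reversible_solid S N c sq" "similar_to (convex hull S) P"
  shows "\<not> closed_saddle_connection P \<gamma>"
proof
  assume c: "closed_saddle_connection P \<gamma>"
  obtain f where f: "similarity f" "P = f ` (convex hull S)" using assms(2) unfolding similar_to_def by blast
  have "inv f ` P = convex hull S"
    unfolding f(2) using similarity_bij[OF f(1)] by (simp add: bij_is_inj image_inv_f_f)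
  then have "closed_saddle_connection (convex hull S) (inv f \<circ> \<gamma>)"
    using closed_saddle_connection_similarity[OF similarity_inv[OF f(1)] c] by simp
  then show False using reversible_solid.no_closed_saddle_connection[OF assms(1)] by blast
qed

theorem theorem1p3:
  fixes P :: "(real^3) set"
  assumes "regular_tetrahedron P \<or> regular_octahedron P \<or> cube P \<or> regular_icosahedron P"
  shows "\<not> (\<exists>\<gamma>. closed_saddle_connection P \<gamma>)"
  using assms
    similar_to_convex_hull_no_closed_saddle_connection[OF reversible_tetrahedron]
    similar_to_convex_hull_no_closed_saddle_connection[OF reversible_octahedron]
    similar_to_convex_hull_no_closed_saddle_connection[OF reversible_cube]
    similar_to_convex_hull_no_closed_saddle_connection[OF reversible_icosahedron]
  unfolding regular_tetrahedron_def regular_octahedron_def cube_def regular_icosahedron_def std_vertices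
  by blast

end
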